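(* Let $X\subset\mathbb{R}^n$ be open. The spaces $C^\infty(X)$ and $\mathcal{D}'_\emptyset(X)$ are topologically isomorphic (through the canonical identification of smooth functions with distributions), where $C^\infty(X)$ has its usual Fréchet topology and $\mathcal{D}'_\emptyset(X)$ has the normal topology.
   Context: Write $\mathcal{D}(X)=C_c^\infty(X)$. The topology of $C^\infty(X)$ is defined by the seminorms $\pi_{m,K}(\varphi)=\sup_{x\in K,|\alpha|\le m}|\partial^\alpha\varphi(x)|$, $m\in\mathbb{N}$, $K\subset X$ compact. $\mathcal{D}'_\emptyset(X)$ is the space of distributions on $X$ with empty wave front set. Its normal topology is the locally convex topology defined by the seminorms $p_B(u)=\sup_{\phi\in B}|\langle u,\phi\rangle|$, $B$ running over the bounded subsets of $\mathcal{D}(X)$, and $\|u\|_{N,V,\chi}=\sup_{k\in V}(1+|k|)^N|\widehat{u\chi}(k)|$ for all $N\ge 0$, $\chi\in\mathcal{D}(X)$ and closed cones $V\subset\mathbb{R}^n$ (the condition of disjointness from $\Gamma=\emptyset$ being void); here $\widehat{w}(k)=\langle w,e^{-ik\cdot x}\rangle$. *)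

theory Defs
  imports "HOL-Analysis.Analysis"
begin

section \<open>Topologies defined by seminorms\<close>

text \<open>All vector spaces below are spaces of complex-valued functions with pointwise operations:
  functions on \<open>\<real>\<^sup>n\<close>, or functionals on such functions. Seminorms take values in \<open>[0, \<infinity>]\<close>, so
  that suprema need no side conditions and the supremum over an empty set is \<open>0\<close>. A
  subbase consists of the open semiballs.\<close>

definition seminorm_topology ::
  "('a \<Rightarrow> complex) set \<Rightarrow> (('a \<Rightarrow> complex) \<Rightarrow> ennreal) set \<Rightarrow> ('a \<Rightarrow> complex) topology" where
  "seminorm_topology S P =
     topology_generated_by
       (insert S {{g \<in> S. p (\<lambda>x. g x - f x) < ennreal e} | f p e. f \<in> S \<and> p \<in> P \<and> 0 < e})"

lemma topspace_seminorm_topology [simp]: "topspace (seminorm_topology S P) = S"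
  unfolding seminorm_topology_def topology_generated_by_topspace by auto

definition seminorm_on :: "('a \<Rightarrow> complex) set \<Rightarrow> (('a \<Rightarrow> complex) \<Rightarrow> real) \<Rightarrow> bool" where
  "seminorm_on S p \<longleftrightarrow>
     (\<forall>f\<in>S. 0 \<le> p f) \<and>
     (\<forall>f\<in>S. \<forall>g\<in>S. p (\<lambda>x. f x + g x) \<le> p f + p g) \<and>
     (\<forall>c. \<forall>f\<in>S. p (\<lambda>x. c * f x) = cmod c * p f)"


section \<open>Smooth functions and test functions\<close>

definition partial_deriv :: "'n::finite \<Rightarrow> (real^'n \<Rightarrow> complex) \<Rightarrow> real^'n \<Rightarrow> complex" where
  "partial_deriv i f x = frechet_derivative f (at x) (axis i 1)"

text \<open>Multi-indices \<open>\<alpha>\<close> are represented by lists of coordinate directions, with \<open>|\<alpha>|\<close> the length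
  of the list. Partial derivatives of smooth functions commute, so the lists that
  are permutations of each other give the same derivative \<open>\<partial>\<^sup>\<alpha> f\<close>.\<close>

definition partial_derivs :: "'n::finite list \<Rightarrow> (real^'n \<Rightarrow> complex) \<Rightarrow> real^'n \<Rightarrow> complex" where
  "partial_derivs \<alpha> f = foldr partial_deriv \<alpha> f"

text \<open>A function on \<open>X\<close> is represented by its extension by \<open>0\<close> to the whole space; nothing is
  required of the extension at the boundary of \<open>X\<close>.\<close>

definition smooth_functions :: "(real^'n::finite) set \<Rightarrow> (real^'n \<Rightarrow> complex) set" where
  "smooth_functions X =
     {f. (\<forall>\<alpha>. \<forall>x\<in>X. partial_derivs \<alpha> f differentiable (at x)) \<and> (\<forall>x. x \<notin> X \<longrightarrow> f x = 0)}"

definition smooth_seminorm ::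
  "nat \<Rightarrow> (real^'n::finite) set \<Rightarrow> (real^'n \<Rightarrow> complex) \<Rightarrow> ennreal" where
  "smooth_seminorm m K f =
     (SUP x\<in>K. SUP \<alpha>\<in>{\<alpha>. length \<alpha> \<le> m}. ennreal (cmod (partial_derivs \<alpha> f x)))"

definition smooth_topology :: "(real^'n::finite) set \<Rightarrow> (real^'n \<Rightarrow> complex) topology" where
  "smooth_topology X =
     seminorm_topology (smooth_functions X) {smooth_seminorm m K | m K. compact K \<and> K \<subseteq> X}"

definition supp :: "(real^'n::finite \<Rightarrow> complex) \<Rightarrow> (real^'n) set" where
  "supp f = closure {x. f x \<noteq> 0}"

definition test_functions_in ::
  "(real^'n::finite) set \<Rightarrow> (real^'n) set \<Rightarrow> (real^'n \<Rightarrow> complex) set" where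
  "test_functions_in X K = {f \<in> smooth_functions X. supp f \<subseteq> K}"

definition test_functions :: "(real^'n::finite) set \<Rightarrow> (real^'n \<Rightarrow> complex) set" where
  "test_functions X = {f \<in> smooth_functions X. compact (supp f) \<and> supp f \<subseteq> X}"

text \<open>The usual locally convex inductive limit topology of \<open>\<D>(X)\<close>: its continuous seminorms are
  those whose restriction to every \<open>\<D>\<^sub>K\<close>, with the topology induced by \<open>C\<^sup>\<infinity>(X)\<close>, is continuous.\<close>

definition test_seminorm :: "(real^'n::finite) set \<Rightarrow> ((real^'n \<Rightarrow> complex) \<Rightarrow> real) \<Rightarrow> bool" where
  "test_seminorm X p \<longleftrightarrow>
     seminorm_on (test_functions X) p \<and>
     (\<forall>K. compact K \<and> K \<subseteq> X \<longrightarrow>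
        continuous_map (subtopology (smooth_topology X) (test_functions_in X K)) euclideanreal p)"

definition test_topology :: "(real^'n::finite) set \<Rightarrow> (real^'n \<Rightarrow> complex) topology" where
  "test_topology X =
     seminorm_topology (test_functions X) {\<lambda>f. ennreal (p f) | p. test_seminorm X p}"

definition bounded_test_set :: "(real^'n::finite) set \<Rightarrow> (real^'n \<Rightarrow> complex) set \<Rightarrow> bool" where
  "bounded_test_set X B \<longleftrightarrow>
     B \<subseteq> test_functions X \<and> (\<forall>p. test_seminorm X p \<longrightarrow> bounded (p ` B))"


section \<open>Distributions and wave front sets\<close>

text \<open>Distributions are total functions, normalised to be \<open>0\<close> off the test functions, so that
  equality of distributions is equality of functions.\<close>

definition distributions :: "(real^'n::finite) set \<Rightarrow> ((real^'n \<Rightarrow> complex) \<Rightarrow> complex) set" where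
  "distributions X =
     {u. (\<forall>\<phi>\<in>test_functions X. \<forall>\<psi>\<in>test_functions X. u (\<lambda>x. \<phi> x + \<psi> x) = u \<phi> + u \<psi>) \<and>
         (\<forall>c. \<forall>\<phi>\<in>test_functions X. u (\<lambda>x. c * \<phi> x) = c * u \<phi>) \<and>
         continuous_map (test_topology X) euclidean u \<and>
         (\<forall>\<phi>. \<phi> \<notin> test_functions X \<longrightarrow> u \<phi> = 0)}"

text \<open>The Fourier transform of the compactly supported distribution \<open>u\<rho>\<close> at \<open>k\<close>: the
  pairing of \<open>u\<rho>\<close> with \<open>x \<mapsto> exp (-i k\<cdot>x)\<close> is that of \<open>u\<close> with \<open>\<rho>\<close> times this function.\<close>

definition fourier_cutoff ::
  "((real^'n::finite \<Rightarrow> complex) \<Rightarrow> complex) \<Rightarrow> (real^'n \<Rightarrow> complex) \<Rightarrow> real^'n \<Rightarrow> complex" where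
  "fourier_cutoff u \<rho> k = u (\<lambda>x. \<rho> x * exp (- \<i> * complex_of_real (k \<bullet> x)))"

definition conic_seminorm ::
  "nat \<Rightarrow> (real^'n::finite) set \<Rightarrow> (real^'n \<Rightarrow> complex) \<Rightarrow>
   ((real^'n \<Rightarrow> complex) \<Rightarrow> complex) \<Rightarrow> ennreal" where
  "conic_seminorm N V \<rho> u = (SUP k\<in>V. ennreal ((1 + norm k) ^ N * cmod (fourier_cutoff u \<rho> k)))"

definition wave_front_set ::
  "(real^'n::finite) set \<Rightarrow> ((real^'n \<Rightarrow> complex) \<Rightarrow> complex) \<Rightarrow> ((real^'n) \<times> (real^'n)) set" where
  "wave_front_set X u =
     {(x, k). x \<in> X \<and> k \<noteq> 0 \<and>
        \<not> (\<exists>\<rho>\<in>test_functions X. \<exists>V. \<rho> x \<noteq> 0 \<and> closed V \<and> cone V \<and> k \<in> interior V \<and>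
             (\<forall>N. conic_seminorm N V \<rho> u < \<infinity>))}"

definition distributions_wf ::
  "(real^'n::finite) set \<Rightarrow> ((real^'n) \<times> (real^'n)) set \<Rightarrow> ((real^'n \<Rightarrow> complex) \<Rightarrow> complex) set" where
  "distributions_wf X \<Gamma> = {u \<in> distributions X. wave_front_set X u \<subseteq> \<Gamma>}"

definition strong_seminorm ::
  "(real^'n::finite \<Rightarrow> complex) set \<Rightarrow> ((real^'n \<Rightarrow> complex) \<Rightarrow> complex) \<Rightarrow> ennreal" where
  "strong_seminorm B u = (SUP \<phi>\<in>B. ennreal (cmod (u \<phi>)))"

definition normal_topology ::
  "(real^'n::finite) set \<Rightarrow> ((real^'n) \<times> (real^'n)) set \<Rightarrow>
   ((real^'n \<Rightarrow> complex) \<Rightarrow> complex) topology" where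
  "normal_topology X \<Gamma> =
     seminorm_topology (distributions_wf X \<Gamma>)
       ({strong_seminorm B | B. bounded_test_set X B} \<union>
        {conic_seminorm N V \<rho> | N V \<rho>.
           \<rho> \<in> test_functions X \<and> closed V \<and> cone V \<and> (supp \<rho> \<times> V) \<inter> \<Gamma> = {}})"

definition distribution_of ::
  "(real^'n::finite) set \<Rightarrow> (real^'n \<Rightarrow> complex) \<Rightarrow> (real^'n \<Rightarrow> complex) \<Rightarrow> complex" where
  "distribution_of X f \<phi> =
     (if \<phi> \<in> test_functions X then LINT x:X|lborel. f x * \<phi> x else 0)"

end

theory Submission
  imports Defs
begin

text \<open>A smooth \<open>f\<close> pairs with a bounded set \<open>B\<close> of test functions by an \<open>L\<^sup>1\<close> estimate, because the members
  of \<open>B\<close> are supported in a common compact set, and the Fourier transform of \<open>f\<rho>\<close> is estimated through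
  integration by parts; this gives continuity of \<open>f \<mapsto> u\<^sub>f\<close>. Conversely, Fourier inversion bounds the
  derivatives of \<open>f\<chi>\<close> by the seminorms with \<open>V = \<real>\<^sup>n\<close>, which are available because \<open>\<Gamma> = \<emptyset>\<close>; with
  \<open>\<chi> = 1\<close> near a given point this gives continuity of the inverse.

  For surjectivity let \<open>WF(u) = \<emptyset>\<close>. Around \<open>x\<close> finitely many cones, with cutoffs \<open>\<rho>\<^sub>j\<close>, cover all
  directions. The Fourier transform of \<open>u\<rho>\<psi>\<close> is the convolution of those of \<open>u\<rho>\<close> and \<open>\<psi>\<close>, hence
  multiplication by a test function preserves rapid decay on slightly smaller cones, and the Fourier
  transform of \<open>u\<rho>\<close> with \<open>\<rho> = \<Prod>\<rho>\<^sub>j\<close> decays rapidly in all directions. So \<open>u\<rho>\<close> has a smooth density,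
  and dividing by \<open>\<rho>\<close> gives local densities of \<open>u\<close>, which agree on overlaps.

  Fourier inversion is used only up to a nonzero constant factor.\<close>

section \<open>Calculus of iterated partial derivatives\<close>

text \<open>Continuity for the inductive limit topology is awkward to use, and a functional cannot
  be moved under an integral over frequencies without justification. Both difficulties are met by
  order bounds: on each compact set \<open>|u \<phi>| <= C * A\<close> whenever \<open>A\<close>
  bounds finitely many derivatives of \<open>\<phi>\<close>. The inversion integral is then
  approximated, in the norm of such a bound, by finite sums of characters.

  The wave front set supplies a different cutoff for each direction, so decay must survive
  multiplication by the other cutoffs before one cutoff can serve all directions; the polynomial
  growth of the transform outside the good cone is the price to be controlled there.

  A bounded set of test functions has a common compact support because the inductive limit has many
  continuous seminorms, among them locally finite sums of weighted point evaluations with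
  arbitrarily fast growing weights.

  Smoothness of concrete functions (bumps, reciprocals, characters, Fourier transforms) is obtained
  by exhibiting a family closed under partial derivatives. Continuity of the inverse is a direct
  estimate and does not go through an open mapping theorem.\<close>

definition smooth_on :: "(real^'n::finite) set \<Rightarrow> (real^'n \<Rightarrow> complex) \<Rightarrow> bool" where
  "smooth_on U f \<longleftrightarrow> (\<forall>\<alpha>. \<forall>x\<in>U. partial_derivs \<alpha> f differentiable (at x))"

text \<open>Peels off the derivative that is taken first, whereas a list in
  \<open>partial_derivs\<close> unfolds at the one taken last. The product rule acts on the first
  derivative, so an induction with arbitrary functions gives closure under products. Index
  \<open>m\<close> means that all derivatives up to order \<open>m\<close> are differentiable, hence
  one order more than \<open>m\<close>.\<close>

primrec times_diff :: "nat \<Rightarrow> (real^'n::finite) set \<Rightarrow> (real^'n \<Rightarrow> complex) \<Rightarrow> bool" where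
  "times_diff 0 U f \<longleftrightarrow> (\<forall>x\<in>U. f differentiable (at x))"
| "times_diff (Suc m) U f \<longleftrightarrow>
     (\<forall>x\<in>U. f differentiable (at x)) \<and> (\<forall>i. times_diff m U (partial_deriv i f))"

lemma partial_derivs_Nil [simp]: "partial_derivs [] f = f"
  and partial_derivs_Cons: "partial_derivs (i # \<alpha>) f = partial_deriv i (partial_derivs \<alpha> f)"
  and partial_derivs_snoc: "partial_derivs (\<alpha> @ [i]) f = partial_derivs \<alpha> (partial_deriv i f)"
  by (simp_all add: partial_derivs_def)

lemma partial_derivs_append: "partial_derivs (\<alpha> @ \<beta>) f = partial_derivs \<alpha> (partial_derivs \<beta> f)"
  by (simp add: partial_derivs_def)

lemma partial_deriv_eq: "(f has_derivative D) (at x) \<Longrightarrow> partial_deriv i f x = D (axis i 1)"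
  unfolding partial_deriv_def by (metis frechet_derivative_at)

lemma has_derivative_cong_open:
  assumes "open U" "x \<in> U" "\<And>y. y \<in> U \<Longrightarrow> f y = g y"
  shows "(f has_derivative D) (at x) \<longleftrightarrow> (g has_derivative D) (at x)"
  using has_derivative_transform_within_open[of f D x UNIV U g]
    has_derivative_transform_within_open[of g D x UNIV U f] assms by auto

lemma differentiable_cong_open:
  assumes "open U" "x \<in> U" "\<And>y. y \<in> U \<Longrightarrow> f y = g y"
  shows "f differentiable (at x) \<longleftrightarrow> g differentiable (at x)"
  unfolding differentiable_def using has_derivative_cong_open[OF assms] by auto

lemma partial_deriv_cong:
  assumes "open U" "x \<in> U" "\<And>y. y \<in> U \<Longrightarrow> f y = g y"
  shows "partial_deriv i f x = partial_deriv i g x"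
  unfolding partial_deriv_def frechet_derivative_def
  using has_derivative_cong_open[OF assms] by simp

lemma partial_derivs_cong:
  assumes "open U" "\<And>y. y \<in> U \<Longrightarrow> f y = g y" "x \<in> U"
  shows "partial_derivs \<alpha> f x = partial_derivs \<alpha> g x"
  using assms(3)
  by (induction \<alpha> arbitrary: x)
    (auto simp: partial_derivs_Cons assms(2) intro: partial_deriv_cong[OF assms(1)])

lemma times_diff_cong:
  assumes "open U" "\<And>y. y \<in> U \<Longrightarrow> f y = g y"
  shows "times_diff m U f \<longleftrightarrow> times_diff m U g"
  using assms(2)
proof (induction m arbitrary: f g)
  case 0
  then show ?case using differentiable_cong_open[OF assms(1), of _ f g] by auto
next
  case (Suc m)
  have "times_diff m U (partial_deriv i f) \<longleftrightarrow> times_diff m U (partial_deriv i g)" for i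
    by (intro Suc.IH partial_deriv_cong[OF assms(1)] Suc.prems)
  then show ?case using differentiable_cong_open[OF assms(1), of _ f g] Suc.prems by auto
qed

lemma times_diff_iff:
  "times_diff m U f \<longleftrightarrow> (\<forall>\<alpha>. length \<alpha> \<le> m \<longrightarrow> (\<forall>x\<in>U. partial_derivs \<alpha> f differentiable (at x)))"
proof (induction m arbitrary: f)
  case (Suc m)
  show ?case
  proof
    assume f: "times_diff (Suc m) U f"
    show "\<forall>\<alpha>. length \<alpha> \<le> Suc m \<longrightarrow> (\<forall>x\<in>U. partial_derivs \<alpha> f differentiable (at x))"
    proof (intro allI impI)
      fix \<alpha> :: "'a list" assume "length \<alpha> \<le> Suc m"
      then show "\<forall>x\<in>U. partial_derivs \<alpha> f differentiable (at x)"
        using f Suc.IH by (cases \<alpha> rule: rev_cases) (auto simp: partial_derivs_snoc)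
    qed
  next
    assume a: "\<forall>\<alpha>. length \<alpha> \<le> Suc m \<longrightarrow> (\<forall>x\<in>U. partial_derivs \<alpha> f differentiable (at x))"
    have "\<forall>x\<in>U. partial_derivs \<alpha> (partial_deriv i f) differentiable at x" if "length \<alpha> \<le> m" for \<alpha> i
      using a[rule_format, of "\<alpha> @ [i]"] that by (simp add: partial_derivs_snoc)
    moreover have "\<forall>x\<in>U. f differentiable at x" using a[rule_format, of "[]"] by simp
    ultimately show "times_diff (Suc m) U f" by (simp add: Suc.IH)
  qed
qed simp

lemma smooth_on_iff: "smooth_on U f \<longleftrightarrow> (\<forall>m. times_diff m U f)"
  unfolding smooth_on_def times_diff_iff by blast

lemma smooth_on_cong:
  assumes "open U" "\<And>y. y \<in> U \<Longrightarrow> f y = g y"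
  shows "smooth_on U f \<longleftrightarrow> smooth_on U g"
  unfolding smooth_on_iff using times_diff_cong[OF assms] by simp

lemma smooth_on_subset: "smooth_on U f \<Longrightarrow> V \<subseteq> U \<Longrightarrow> smooth_on V f"
  unfolding smooth_on_def by blast

lemma smooth_on_Un: "smooth_on U f \<Longrightarrow> smooth_on V f \<Longrightarrow> smooth_on (U \<union> V) f"
  unfolding smooth_on_def by blast

lemma smooth_on_local: "(\<And>x. x \<in> U \<Longrightarrow> \<exists>V. x \<in> V \<and> smooth_on V f) \<Longrightarrow> smooth_on U f"
  unfolding smooth_on_def by blast

lemma smooth_on_differentiable: "smooth_on U f \<Longrightarrow> x \<in> U \<Longrightarrow> f differentiable (at x)"
  unfolding smooth_on_def by (metis partial_derivs_Nil)

lemma smooth_on_partial_deriv: "smooth_on U f \<Longrightarrow> smooth_on U (partial_deriv i f)"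
  unfolding smooth_on_def by (metis partial_derivs_snoc)

lemma smooth_on_partial_derivs: "smooth_on U f \<Longrightarrow> smooth_on U (partial_derivs \<alpha> f)"
  unfolding smooth_on_def by (metis partial_derivs_append)

lemma smooth_on_continuous_on: "smooth_on U f \<Longrightarrow> continuous_on U f"
  by (simp add: continuous_at_imp_continuous_on differentiable_imp_continuous_within smooth_on_differentiable)

lemma times_diff_coinduct:
  assumes "open U" "f \<in> F" and "\<And>f x. f \<in> F \<Longrightarrow> x \<in> U \<Longrightarrow> f differentiable (at x)"
    and step: "\<And>f i. f \<in> F \<Longrightarrow> \<exists>g\<in>F. \<forall>x\<in>U. partial_deriv i f x = g x"
  shows "times_diff m U f"
  using assms(2)
proof (induction m arbitrary: f)
  case 0 then show ?case using assms(3) by simp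
next
  case (Suc m)
  have "times_diff m U (partial_deriv i f)" for i
    using step[OF Suc.prems, of i] Suc.IH times_diff_cong[OF assms(1)] by metis
  then show ?case using assms(3) Suc.prems by simp
qed

text \<open>Avoids formulas for higher derivatives: a concrete function is placed in a family of
  differentiable functions whose partial derivatives agree on \<open>U\<close> with members of the
  family again. Reciprocals, conjugates, characters, flat functions and Fourier transforms are all
  treated in this way.\<close>

lemma smooth_on_coinduct:
  assumes "open U" "f \<in> F" and "\<And>f x. f \<in> F \<Longrightarrow> x \<in> U \<Longrightarrow> f differentiable (at x)"
    and "\<And>f i. f \<in> F \<Longrightarrow> \<exists>g\<in>F. \<forall>x\<in>U. partial_deriv i f x = g x"
  shows "smooth_on U f"
  unfolding smooth_on_iff using times_diff_coinduct[OF assms] by blast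

section \<open>Sums and products of smooth functions\<close>

lemma partial_deriv_add:
  assumes "f differentiable (at x)" "g differentiable (at x)"
  shows "partial_deriv i (\<lambda>x. f x + g x) x = partial_deriv i f x + partial_deriv i g x"
  using partial_deriv_eq[OF has_derivative_add[OF assms[unfolded frechet_derivative_works]]]
  by (simp add: partial_deriv_def)

lemma partial_deriv_mult:
  assumes "f differentiable (at x)" "g differentiable (at x)"
  shows "partial_deriv i (\<lambda>x. f x * g x) x = f x * partial_deriv i g x + partial_deriv i f x * g x"
  using partial_deriv_eq[OF has_derivative_mult[OF assms[unfolded frechet_derivative_works]]]
  by (simp add: partial_deriv_def)

lemma partial_deriv_const [simp]: "partial_deriv i (\<lambda>x. c) = (\<lambda>x. 0)"
  by (rule ext) (simp add: partial_deriv_eq[OF has_derivative_const])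

lemma times_diff_add:
  assumes "open U" shows "times_diff m U f \<Longrightarrow> times_diff m U g \<Longrightarrow> times_diff m U (\<lambda>x. f x + g x)"
proof (induction m arbitrary: f g)
  case (Suc m)
  have "times_diff m U (partial_deriv i (\<lambda>x. f x + g x))
      = times_diff m U (\<lambda>x. partial_deriv i f x + partial_deriv i g x)" for i
    using Suc.prems by (intro times_diff_cong[OF assms] partial_deriv_add) auto
  then show ?case using Suc by auto
qed auto

lemma times_diff_Suc_imp: "times_diff (Suc m) U f \<Longrightarrow> times_diff m U f"
  unfolding times_diff_iff by auto

lemma times_diff_mult:
  assumes "open U" shows "times_diff m U f \<Longrightarrow> times_diff m U g \<Longrightarrow> times_diff m U (\<lambda>x. f x * g x)"
proof (induction m arbitrary: f g)
  case (Suc m)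
  have "times_diff m U (partial_deriv i (\<lambda>x. f x * g x))
      = times_diff m U (\<lambda>x. f x * partial_deriv i g x + partial_deriv i f x * g x)" for i
    using Suc.prems by (intro times_diff_cong[OF assms] partial_deriv_mult) auto
  moreover have "times_diff m U (\<lambda>x. f x * partial_deriv i g x + partial_deriv i f x * g x)" for i
    using Suc.prems Suc.prems[THEN times_diff_Suc_imp] by (intro times_diff_add[OF assms] Suc.IH) auto
  ultimately show ?case using Suc.prems by auto
qed auto

lemma smooth_on_add: "open U \<Longrightarrow> smooth_on U f \<Longrightarrow> smooth_on U g \<Longrightarrow> smooth_on U (\<lambda>x. f x + g x)"
  unfolding smooth_on_iff using times_diff_add by blast

lemma smooth_on_mult: "open U \<Longrightarrow> smooth_on U f \<Longrightarrow> smooth_on U g \<Longrightarrow> smooth_on U (\<lambda>x. f x * g x)"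
  unfolding smooth_on_iff using times_diff_mult by blast

lemma smooth_on_const [simp]: "smooth_on U (\<lambda>x. c)"
proof -
  have *: "\<exists>c'. partial_derivs \<alpha> (\<lambda>x. c) = (\<lambda>x. c')" for \<alpha> :: "'a list"
    by (induction \<alpha>) (auto simp: partial_derivs_Cons)
  show ?thesis unfolding smooth_on_def
  proof (intro allI ballI)
    fix \<alpha> :: "'a list" and x
    obtain c' where "partial_derivs \<alpha> (\<lambda>x. c) = (\<lambda>x. c')" using * by blast
    then show "partial_derivs \<alpha> (\<lambda>x. c) differentiable at x" by simp
  qed
qed

lemma smooth_on_diff:
  "open U \<Longrightarrow> smooth_on U f \<Longrightarrow> smooth_on U g \<Longrightarrow> smooth_on U (\<lambda>x. f x - g x)"
  using smooth_on_add[OF _ _ smooth_on_mult[OF _ smooth_on_const[of U "-1"]], of f g] by simp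

lemma smooth_on_sum:
  assumes "open U" "\<And>j. j \<in> J \<Longrightarrow> smooth_on U (f j)"
  shows "smooth_on U (\<lambda>x. \<Sum>j\<in>J. f j x)"
proof (cases "finite J")
  case True
  then show ?thesis using assms(2)
    by (induction J) (auto intro!: smooth_on_add[OF assms(1)])
qed simp

lemma partial_derivs_add:
  assumes "open U" "smooth_on U f" "smooth_on U g" "x \<in> U"
  shows "partial_derivs \<alpha> (\<lambda>x. f x + g x) x = partial_derivs \<alpha> f x + partial_derivs \<alpha> g x"
  using assms(4)
proof (induction \<alpha> arbitrary: x)
  case (Cons i \<alpha>)
  have "partial_deriv i (partial_derivs \<alpha> (\<lambda>x. f x + g x)) x
      = partial_deriv i (\<lambda>x. partial_derivs \<alpha> f x + partial_derivs \<alpha> g x) x"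
    using Cons by (intro partial_deriv_cong[OF assms(1)])
  then show ?case
    using assms Cons.prems by (simp add: partial_derivs_Cons partial_deriv_add smooth_on_def)
qed simp

lemma partial_derivs_cmult:
  assumes "open U" "smooth_on U f" "x \<in> U"
  shows "partial_derivs \<alpha> (\<lambda>x. c * f x) x = c * partial_derivs \<alpha> f x"
  using assms(3)
proof (induction \<alpha> arbitrary: x)
  case (Cons i \<alpha>)
  have "partial_deriv i (partial_derivs \<alpha> (\<lambda>x. c * f x)) x
      = partial_deriv i (\<lambda>x. c * partial_derivs \<alpha> f x) x"
    using Cons by (intro partial_deriv_cong[OF assms(1)])
  then show ?case
    using assms Cons.prems by (simp add: partial_derivs_Cons partial_deriv_mult smooth_on_def)
qed simp

lemma partial_derivs_diff:
  assumes "open U" "smooth_on U f" "smooth_on U g" "x \<in> U"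
  shows "partial_derivs \<alpha> (\<lambda>x. f x - g x) x = partial_derivs \<alpha> f x - partial_derivs \<alpha> g x"
  using partial_derivs_add[OF assms(1,2) smooth_on_mult[OF assms(1) smooth_on_const[of U "-1"] assms(3)] assms(4)]
    partial_derivs_cmult[OF assms(1,3,4), of \<alpha> "-1"] by simp

lemma partial_derivs_zero [simp]: "partial_derivs \<alpha> (\<lambda>x. 0) = (\<lambda>x. 0)"
  by (induction \<alpha>) (auto simp: partial_derivs_Cons)

lemma partial_derivs_sum:
  assumes "open U" "\<And>j. j \<in> J \<Longrightarrow> smooth_on U (f j)" "x \<in> U"
  shows "partial_derivs \<alpha> (\<lambda>x. \<Sum>j\<in>J. f j x) x = (\<Sum>j\<in>J. partial_derivs \<alpha> (f j) x)"
proof (cases "finite J")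
  case True
  then show ?thesis using assms(2)
    by (induction J)
      (auto simp: partial_derivs_add[OF assms(1) _ smooth_on_sum[OF assms(1)] assms(3)])
qed simp

section \<open>Uniform bounds for derivatives on a set\<close>

definition deriv_bound ::
  "nat \<Rightarrow> (real^'n::finite) set \<Rightarrow> (real^'n \<Rightarrow> complex) \<Rightarrow> real \<Rightarrow> bool" where
  "deriv_bound m K f A \<longleftrightarrow> (\<forall>x\<in>K. \<forall>\<alpha>. length \<alpha> \<le> m \<longrightarrow> cmod (partial_derivs \<alpha> f x) \<le> A)"

lemma deriv_bound_partial_deriv: "deriv_bound (Suc m) K f A \<Longrightarrow> deriv_bound m K (partial_deriv i f) A"
  unfolding deriv_bound_def
  by (metis Suc_le_mono length_append_singleton partial_derivs_snoc)

lemma deriv_bound_mono: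
  "deriv_bound m K f A \<Longrightarrow> m' \<le> m \<Longrightarrow> K' \<subseteq> K \<Longrightarrow> A \<le> A' \<Longrightarrow> deriv_bound m' K' f A'"
  unfolding deriv_bound_def by (meson order_trans subsetD)

text \<open>Leibniz by induction on the order: each differentiation replaces one product by two,
  whence the factor \<open>2 ^ m\<close>. The derivative is split off at the inner end of the list,
  so that both summands are products with \<open>m\<close> derivatives left to take.\<close>

lemma deriv_bound_mult:
  assumes "open U" "K \<subseteq> U" "smooth_on U f" "smooth_on U g"
    and "deriv_bound m K f A" "deriv_bound m K g B" "0 \<le> A" "0 \<le> B"
  shows "deriv_bound m K (\<lambda>x. f x * g x) (2 ^ m * A * B)"
  using assms(3-6)
proof (induction m arbitrary: f g)
  case 0
  show ?case unfolding deriv_bound_def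
  proof (intro ballI allI impI)
    fix x and \<alpha> :: "'a list" assume x: "x \<in> K" and "length \<alpha> \<le> 0"
    then have "\<alpha> = []" by simp
    moreover have "cmod (f x) \<le> A" "cmod (g x) \<le> B" using 0 x unfolding deriv_bound_def
      by (metis le0 list.size(3) partial_derivs_Nil)+
    ultimately show "cmod (partial_derivs \<alpha> (\<lambda>x. f x * g x) x) \<le> 2 ^ 0 * A * B"
      by (simp add: norm_mult mult_mono assms)
  qed
next
  case (Suc m)
  show ?case unfolding deriv_bound_def
  proof (intro ballI allI impI)
    fix x and \<alpha> :: "'a list" assume x: "x \<in> K" and l: "length \<alpha> \<le> Suc m"
    show "cmod (partial_derivs \<alpha> (\<lambda>x. f x * g x) x) \<le> 2 ^ Suc m * A * B"
    proof (cases \<alpha> rule: rev_cases)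
      case Nil
      have "cmod (f x) \<le> A" "cmod (g x) \<le> B" using Suc.prems x unfolding deriv_bound_def
        by (metis le0 list.size(3) partial_derivs_Nil)+
      then have "cmod (f x * g x) \<le> A * B" by (simp add: norm_mult mult_mono assms)
      also have "\<dots> \<le> 2 ^ Suc m * (A * B)"
        using mult_right_mono[of 1 "2 ^ Suc m" "A * B"] one_le_power[of "2::real" "Suc m"] assms(7,8)
        by simp
      finally show ?thesis using Nil by (simp add: mult.assoc)
    next
      case (snoc \<beta> i)
      have [simp]: "x \<in> U" using x assms by blast
      have "deriv_bound m K (\<lambda>x. f x * partial_deriv i g x) (2 ^ m * A * B)"
        "deriv_bound m K (\<lambda>x. partial_deriv i f x * g x) (2 ^ m * A * B)"
        using Suc.prems by (auto intro!: Suc.IH smooth_on_partial_deriv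
            intro: deriv_bound_partial_deriv deriv_bound_mono[OF _ le_SucI[OF order_refl] subset_refl order_refl])
      then have b: "cmod (partial_derivs \<beta> (\<lambda>x. f x * partial_deriv i g x) x) \<le> 2 ^ m * A * B"
        "cmod (partial_derivs \<beta> (\<lambda>x. partial_deriv i f x * g x) x) \<le> 2 ^ m * A * B"
        using l x snoc unfolding deriv_bound_def by auto
      have "partial_derivs \<alpha> (\<lambda>x. f x * g x) x
          = partial_derivs \<beta> (\<lambda>x. f x * partial_deriv i g x + partial_deriv i f x * g x) x"
        unfolding snoc partial_derivs_snoc using Suc.prems
        by (intro partial_derivs_cong[OF assms(1)] partial_deriv_mult) (auto intro: smooth_on_differentiable)
      also have "\<dots> = partial_derivs \<beta> (\<lambda>x. f x * partial_deriv i g x) x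
          + partial_derivs \<beta> (\<lambda>x. partial_deriv i f x * g x) x"
        using Suc.prems assms(1)
        by (intro partial_derivs_add[OF assms(1)]) (auto intro: smooth_on_mult smooth_on_partial_deriv)
      finally show ?thesis using b norm_triangle_ineq[of "partial_derivs \<beta> (\<lambda>x. f x * partial_deriv i g x) x"
            "partial_derivs \<beta> (\<lambda>x. partial_deriv i f x * g x) x"] by simp
    qed
  qed
qed

lemma finite_lists_bounded: "finite {\<alpha> :: 'a::finite list. length \<alpha> \<le> m}"
  using finite_lists_length_le[of "UNIV :: 'a set" m] by simp

lemma deriv_bound_exists:
  fixes f :: "real^'n::finite \<Rightarrow> complex"
  assumes "smooth_on U f" "compact K" "K \<subseteq> U"
  obtains A where "0 \<le> A" "deriv_bound m K f A"
proof -
  have "\<exists>A. \<forall>x\<in>K. cmod (partial_derivs \<alpha> f x) \<le> A" for \<alpha> :: "'n list"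
  proof -
    have "compact (partial_derivs \<alpha> f ` K)"
      using assms smooth_on_partial_derivs smooth_on_continuous_on continuous_on_subset compact_continuous_image
      by metis
    then have "bounded (partial_derivs \<alpha> f ` K)" by (rule compact_imp_bounded)
    then show ?thesis unfolding bounded_iff by auto
  qed
  then obtain A where A: "\<And>\<alpha> x. x \<in> K \<Longrightarrow> cmod (partial_derivs \<alpha> f x) \<le> A \<alpha>" by metis
  \<comment> \<open>The sum over the finitely many lists stands in for a maximum.\<close>
  let ?A = "\<Sum>\<alpha>\<in>{\<alpha> :: 'n list. length \<alpha> \<le> m}. \<bar>A \<alpha>\<bar>"
  have "cmod (partial_derivs \<alpha> f x) \<le> ?A" if "x \<in> K" "length \<alpha> \<le> m" for x \<alpha>
  proof -
    have "A \<alpha> \<le> \<bar>A \<alpha>\<bar>" by simp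
    also have "\<dots> \<le> ?A" using that by (intro member_le_sum finite_lists_bounded) auto
    finally show ?thesis using A[OF that(1), of \<alpha>] by linarith
  qed
  then show ?thesis by (intro that[of ?A]) (auto simp: deriv_bound_def sum_nonneg)
qed

text \<open>The passage between the \<open>ennreal\<close>-valued seminorms of the topology and
  \<open>deriv_bound\<close>, in which the estimates are carried out with real numbers.\<close>

lemma smooth_seminorm_le_iff:
  "0 \<le> A \<Longrightarrow> smooth_seminorm m K f \<le> ennreal A \<longleftrightarrow> deriv_bound m K f A"
  unfolding smooth_seminorm_def deriv_bound_def by (auto simp: SUP_le_iff)

section \<open>Reciprocals and conjugates of smooth functions\<close>

lemma smooth_on_inverse:
  assumes U: "open U" and h: "smooth_on U h" "\<And>x. x \<in> U \<Longrightarrow> h x \<noteq> 0"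
  shows "smooth_on U (\<lambda>x. inverse (h x))"
proof (rule smooth_on_coinduct[OF U, where F = "{f. \<exists>s m. smooth_on U s \<and> f = (\<lambda>x. s x * inverse (h x) ^ m)}"])
  show "(\<lambda>x. inverse (h x)) \<in> {f. \<exists>s m. smooth_on U s \<and> f = (\<lambda>x. s x * inverse (h x) ^ m)}"
    by (auto intro!: exI[of _ "\<lambda>x. 1"] exI[of _ 1])
next
  have D: "((\<lambda>x. s x * inverse (h x) ^ m) has_derivative
      (\<lambda>v. s x * (- of_nat m * inverse (h x) ^ Suc m * frechet_derivative h (at x) v)
          + frechet_derivative s (at x) v * inverse (h x) ^ m)) (at x)"
    if s: "smooth_on U s" and x: "x \<in> U" for s m x
  proof -
    have 1: "(h has_derivative frechet_derivative h (at x)) (at x)"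
      "(s has_derivative frechet_derivative s (at x)) (at x)"
      using smooth_on_differentiable[OF h(1) x] smooth_on_differentiable[OF s x] frechet_derivative_works by auto
    have "((\<lambda>x. inverse (h x)) has_derivative (\<lambda>v. - (inverse (h x) * frechet_derivative h (at x) v * inverse (h x)))) (at x)"
      by (rule Deriv.has_derivative_inverse[OF h(2)[OF x] 1(1)])
    from has_derivative_mult[OF 1(2) has_derivative_power[OF this, of m]]
    show ?thesis
      by (rule has_derivative_eq_rhs) (cases m; auto simp: fun_eq_iff algebra_simps)
  qed
  fix f assume "f \<in> {f. \<exists>s m. smooth_on U s \<and> f = (\<lambda>x. s x * inverse (h x) ^ m)}"
  then obtain s m where s: "smooth_on U s" and f: "f = (\<lambda>x. s x * inverse (h x) ^ m)" by auto
  show "f differentiable at x" if "x \<in> U" for x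
    using D[OF s that] f differentiable_def by blast
  fix i
  \<comment> \<open>The numerator in \<open>(s / h^m)' = (s' h - m s h') / h^(m+1)\<close>; the free
    smooth factor \<open>s\<close> is what closes the family under differentiation.\<close>
  let ?s = "\<lambda>x. partial_deriv i s x * h x - of_nat m * (s x * partial_deriv i h x)"
  have "smooth_on U ?s"
    by (intro smooth_on_diff smooth_on_mult smooth_on_const smooth_on_partial_deriv U s h)
  moreover have "partial_deriv i f x = ?s x * inverse (h x) ^ Suc m" if "x \<in> U" for x
    unfolding f partial_deriv_eq[OF D[OF s that]]
    using h(2)[OF that] by (simp add: partial_deriv_def field_simps)
  ultimately show "\<exists>g\<in>{f. \<exists>s m. smooth_on U s \<and> f = (\<lambda>x. s x * inverse (h x) ^ m)}.
      \<forall>x\<in>U. partial_deriv i f x = g x"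
    by (intro bexI[of _ "\<lambda>x. ?s x * inverse (h x) ^ Suc m"] CollectI exI[of _ ?s] exI[of _ "Suc m"]) auto
qed

lemma smooth_on_cnj:
  assumes "open U" "smooth_on U f" shows "smooth_on U (\<lambda>x. cnj (f x))"
proof (rule smooth_on_coinduct[OF assms(1), where F = "{g. \<exists>f. smooth_on U f \<and> g = (\<lambda>x. cnj (f x))}"])
  have D: "((\<lambda>x. cnj (f x)) has_derivative (\<lambda>v. cnj (frechet_derivative f (at x) v))) (at x)"
    if "smooth_on U f" "x \<in> U" for f x
    using has_derivative_cnj smooth_on_differentiable[OF that] frechet_derivative_works by blast
  fix g assume "g \<in> {g. \<exists>f. smooth_on U f \<and> g = (\<lambda>x. cnj (f x))}"
  then obtain f where f: "smooth_on U f" "g = (\<lambda>x. cnj (f x))" by auto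
  show "g differentiable at x" if "x \<in> U" for x
    using D[OF f(1) that] f differentiable_def by blast
  show "\<exists>g'\<in>{g. \<exists>f. smooth_on U f \<and> g = (\<lambda>x. cnj (f x))}. \<forall>x\<in>U. partial_deriv i g x = g' x" for i
    using smooth_on_partial_deriv[OF f(1), of i] partial_deriv_eq[OF D[OF f(1)]] f(2)
    by (intro bexI[of _ "\<lambda>x. cnj (partial_deriv i f x)"]) (auto simp: partial_deriv_def)
qed (use assms in auto)

section \<open>Characters and the symbols of derivatives\<close>

definition expi :: "real^'n::finite \<Rightarrow> real^'n \<Rightarrow> complex" where
  "expi l x = exp (\<i> * complex_of_real (l \<bullet> x))"

text \<open>The symbol \<open>(i l)^\<alpha>\<close> of the derivative with multi-index
  \<open>\<alpha>\<close>: its eigenvalue on the character \<open>expi l\<close>, and the factor by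
  which it acts on the Fourier transform.\<close>

definition moment :: "'n::finite list \<Rightarrow> real^'n \<Rightarrow> complex" where
  "moment \<alpha> l = (\<Prod>i\<leftarrow>\<alpha>. \<i> * complex_of_real (l $ i))"

lemma norm_expi [simp]: "cmod (expi l x) = 1"
  unfolding expi_def by (simp add: norm_exp_i_times)

lemma expi_add: "expi (k + l) x = expi k x * expi l x"
  and expi_add_right: "expi l (x + y) = expi l x * expi l y"
  unfolding expi_def by (simp_all add: inner_add_left inner_add_right ring_distribs exp_add)

lemma expi_0 [simp]: "expi 0 x = 1" "expi l 0 = 1"
  by (simp_all add: expi_def)

lemma expi_commute: "expi l x = expi x l"
  by (simp add: expi_def inner_commute)

lemma expi_minus_left: "expi (- l) x = cnj (expi l x)"
  by (simp add: expi_def exp_cnj)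

lemma expi_minus_right: "expi l (- x) = cnj (expi l x)"
  by (simp add: expi_def exp_cnj)

lemma has_derivative_expi:
  "(expi l has_derivative (\<lambda>v. \<i> * complex_of_real (l \<bullet> v) * expi l x)) (at x)"
proof -
  have "((\<lambda>x. \<i> * complex_of_real (l \<bullet> x)) has_derivative (\<lambda>v. \<i> * complex_of_real (l \<bullet> v))) (at x)"
    by (auto intro!: derivative_eq_intros)
  then have "((\<lambda>x. exp (\<i> * complex_of_real (l \<bullet> x))) has_derivative
     (\<lambda>v. (\<i> * complex_of_real (l \<bullet> v)) * exp (\<i> * complex_of_real (l \<bullet> x)))) (at x)"
    by (rule has_derivative_compose[OF _ DERIV_exp[unfolded has_field_derivative_def], THEN has_derivative_eq_rhs])
      (simp add: mult.commute)
  then show ?thesis unfolding expi_def .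
qed

lemma partial_deriv_expi: "partial_deriv i (expi l) x = \<i> * complex_of_real (l $ i) * expi l x"
  by (simp add: partial_deriv_eq[OF has_derivative_expi] inner_axis)

lemma smooth_on_expi: "smooth_on U (expi l)"
proof -
  have "smooth_on UNIV (expi l)"
  proof (rule smooth_on_coinduct[where F = "range (\<lambda>c x. c * expi l x)"])
    show "expi l \<in> range (\<lambda>c x. c * expi l x)" by (rule range_eqI[of _ _ 1]) simp
    have D: "expi l differentiable at x" for x
      using has_derivative_expi[of l] differentiable_def by blast
    fix f assume "f \<in> range (\<lambda>c x. c * expi l x)"
    then obtain c where f: "f = (\<lambda>x. c * expi l x)" by auto
    show "f differentiable at x" for x using D unfolding f by simp
    show "\<exists>g\<in>range (\<lambda>c x. c * expi l x). \<forall>x\<in>UNIV. partial_deriv i f x = g x" for i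
      using D unfolding f
      by (intro bexI[of _ "\<lambda>x. (c * (\<i> * complex_of_real (l $ i))) * expi l x"])
        (auto simp: partial_deriv_mult partial_deriv_expi)
  qed simp
  then show ?thesis using smooth_on_subset by blast
qed

lemma partial_derivs_expi: "partial_derivs \<alpha> (expi l) x = moment \<alpha> l * expi l x"
proof (induction \<alpha> arbitrary: x)
  case (Cons i \<alpha>)
  have "partial_derivs \<alpha> (expi l) = (\<lambda>x. moment \<alpha> l * expi l x)" using Cons by auto
  moreover have "expi l differentiable at x"
    using has_derivative_expi[of l] differentiable_def by blast
  ultimately show ?case
    by (simp add: partial_derivs_Cons partial_deriv_mult partial_deriv_expi moment_def)
qed (simp add: moment_def)

lemma norm_moment_le: "cmod (moment \<alpha> l) \<le> (1 + norm l) ^ length \<alpha>"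
proof (induction \<alpha>)
  case (Cons i \<alpha>)
  have "cmod (moment (i # \<alpha>) l) = \<bar>l $ i\<bar> * cmod (moment \<alpha> l)"
    by (simp add: moment_def norm_mult)
  also have "\<dots> \<le> (1 + norm l) * (1 + norm l) ^ length \<alpha>"
    using component_le_norm_cart[of l i] Cons by (intro mult_mono) auto
  finally show ?case by simp
qed (simp add: moment_def)

lemma continuous_on_moment: "continuous_on S (moment \<alpha>)"
proof (induction \<alpha>)
  case Nil
  then show ?case by (simp add: moment_def[abs_def])
next
  case (Cons i \<alpha>)
  have "moment (i # \<alpha>) = (\<lambda>l. \<i> * complex_of_real (l $ i) * moment \<alpha> l)"
    by (simp add: moment_def[abs_def])
  then show ?case using Cons by (auto intro!: continuous_intros)
qed

lemma continuous_on_expi [continuous_intros]: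
  "continuous_on S f \<Longrightarrow> continuous_on S g \<Longrightarrow> continuous_on S (\<lambda>x. expi (f x) (g x))"
  unfolding expi_def by (intro continuous_intros)

section \<open>Cutoff functions\<close>

lemma pow_le_fact_exp:
  fixes y :: real assumes "0 \<le> y" shows "y ^ k \<le> fact k * exp y"
proof -
  have "y ^ k /\<^sub>R fact k \<le> exp y"
    unfolding exp_def using assms summable_exp_generic[of y]
    by (intro sum_le_suminf[where I = "{k}", simplified]) auto
  then show ?thesis by (simp add: field_simps)
qed

text \<open>The exponential beats every inverse power. The bound is quadratic in \<open>t\<close>,
  not just constant, because quadratic vanishing forces the derivative at the edge of the support to
  be zero.\<close>

lemma inverse_pow_exp_bound:
  fixes t :: real assumes "0 < t"
  shows "inverse t ^ m * exp (- inverse t) \<le> fact (m + 2) * t\<^sup>2"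
proof -
  have "inverse t ^ (m + 2) * exp (- inverse t) \<le> fact (m + 2)"
    using pow_le_fact_exp[of "inverse t" "m + 2"] assms by (simp add: exp_minus field_simps)
  then have "inverse t ^ (m + 2) * exp (- inverse t) * t\<^sup>2 \<le> fact (m + 2) * t\<^sup>2"
    by (intro mult_right_mono) auto
  moreover have "inverse t ^ (m + 2) * t\<^sup>2 = inverse t ^ m"
    using assms by (simp add: power_add field_simps power2_eq_square)
  moreover have "inverse t ^ (m + 2) * exp (- inverse t) * t\<^sup>2
      = (inverse t ^ (m + 2) * t\<^sup>2) * exp (- inverse t)"
    by (simp only: mult_ac)
  ultimately show ?thesis by (simp only:)
qed

text \<open>The family generated from the classical \<open>exp (- 1 / q)\<close> by differentiation:
  derivatives produce powers of \<open>1 / q\<close> and smooth factors, which \<open>m\<close> and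
  \<open>s\<close> record.\<close>

definition flat ::
  "(real^'n::finite \<Rightarrow> real) \<Rightarrow> (real^'n \<Rightarrow> complex) \<Rightarrow> nat \<Rightarrow> real^'n \<Rightarrow> complex" where
  "flat q s m x =
     (if 0 < q x then s x * complex_of_real (inverse (q x) ^ m * exp (- inverse (q x))) else 0)"

lemma has_derivative_flat_pos:
  assumes q: "(q has_derivative q') (at x)" and s: "(s has_derivative s') (at x)" and pos: "0 < q x"
  shows "(flat q s m has_derivative (\<lambda>v. (s' v * complex_of_real ((q x)\<^sup>2)
      + s x * complex_of_real (q' v) * (1 - of_nat m * complex_of_real (q x)))
      * complex_of_real (inverse (q x) ^ (m + 2) * exp (- inverse (q x))))) (at x)"
proof -
  let ?r = "\<lambda>x. inverse (q x) ^ m * exp (- inverse (q x))"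
  let ?r' = "\<lambda>v. q' v * (1 - real m * q x) * (inverse (q x) ^ (m + 2) * exp (- inverse (q x)))"
  have i: "((\<lambda>x. inverse (q x)) has_derivative (\<lambda>v. - (inverse (q x) * q' v * inverse (q x)))) (at x)"
    using pos by (intro Deriv.has_derivative_inverse q) auto
  have "(?r has_derivative ?r') (at x)"
    by (rule has_derivative_eq_rhs[OF has_derivative_mult[OF has_derivative_power[OF i]
          has_derivative_exp[OF has_derivative_minus[OF i]]]])
      (use pos in \<open>cases m; auto simp: fun_eq_iff field_simps power2_eq_square\<close>)
  then have "((\<lambda>x. s x * complex_of_real (?r x)) has_derivative
      (\<lambda>v. s x * complex_of_real (?r' v) + s' v * complex_of_real (?r x))) (at x)"
    by (intro has_derivative_mult s has_derivative_of_real)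
  then have D: "((\<lambda>x. s x * complex_of_real (?r x)) has_derivative
      (\<lambda>v. (s' v * complex_of_real ((q x)\<^sup>2)
      + s x * complex_of_real (q' v) * (1 - of_nat m * complex_of_real (q x)))
      * complex_of_real (inverse (q x) ^ (m + 2) * exp (- inverse (q x))))) (at x)"
    by (rule has_derivative_eq_rhs)
      (use pos in \<open>auto simp: fun_eq_iff field_simps power2_eq_square power_add\<close>)
  have "\<forall>\<^sub>F y in at x. 0 < q y"
    using has_derivative_continuous[OF q] pos
    by (auto simp: continuous_within intro: order_tendstoD)
  then have "\<forall>\<^sub>F y in at x. s y * complex_of_real (?r y) = flat q s m y"
    by eventually_elim (simp add: flat_def)
  then show ?thesis using pos
    by (intro has_derivative_transform_eventually[OF D]) (auto simp: flat_def)
qed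

text \<open>Where \<open>q\<close> vanishes the function is dominated by a multiple of
  \<open>q^2\<close>, whose derivative \<open>2 q q'\<close> is zero there; where \<open>q\<close>
  is negative the function is locally zero.\<close>

lemma has_derivative_flat_nonpos:
  assumes q: "(q has_derivative q') (at x)" and s: "(s has_derivative s') (at x)" and pos: "q x \<le> 0"
  shows "(flat q s m has_derivative (\<lambda>v. 0)) (at x)"
proof (cases "q x = 0")
  case False
  have "\<forall>\<^sub>F y in at x. q y < 0"
    using has_derivative_continuous[OF q] pos False
    by (auto simp: continuous_within intro!: order_tendstoD)
  then have "\<forall>\<^sub>F y in at x. 0 = flat q s m y"
    by eventually_elim (simp add: flat_def)
  then show ?thesis using pos
    by (intro has_derivative_transform_eventually[OF has_derivative_const[of 0]]) (auto simp: flat_def)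
next
  case True
  have "\<forall>\<^sub>F y in at x. cmod (s y) < cmod (s x) + 1"
    using tendsto_norm[OF has_derivative_continuous[OF s, unfolded continuous_within]]
    by (rule order_tendstoD) simp
  then have ev: "\<forall>\<^sub>F y in at x. cmod (flat q s m y) / norm (y - x)
      \<le> ((cmod (s x) + 1) * fact (m + 2)) * (norm ((q y)\<^sup>2) / norm (y - x))"
  proof eventually_elim
    case (elim y)
    have "cmod (flat q s m y) \<le> (cmod (s x) + 1) * (fact (m + 2) * (q y)\<^sup>2)"
    proof (cases "0 < q y")
      case True
      have "cmod (flat q s m y) = cmod (s y) * (inverse (q y) ^ m * exp (- inverse (q y)))"
        using True by (simp add: flat_def norm_mult norm_power norm_inverse flip: of_real_exp)
      also have "\<dots> \<le> (cmod (s x) + 1) * (fact (m + 2) * (q y)\<^sup>2)"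
        using elim inverse_pow_exp_bound[OF True, of m] True by (rule_tac mult_mono) auto
      finally show ?thesis .
    qed (simp add: flat_def)
    then have "cmod (flat q s m y) / norm (y - x) \<le> (cmod (s x) + 1) * (fact (m + 2) * (q y)\<^sup>2) / norm (y - x)"
      by (rule divide_right_mono) simp
    then show ?case by (simp add: mult_ac)
  qed
  have "((\<lambda>y. (q y)\<^sup>2) has_derivative (\<lambda>v. 0)) (at x)"
    by (rule has_derivative_eq_rhs[OF has_derivative_power[OF q, of 2]]) (simp add: True)
  then have "((\<lambda>y. norm ((q y)\<^sup>2) / norm (y - x)) \<longlongrightarrow> 0) (at x)"
    unfolding has_derivative_iff_norm using True by simp
  from tendsto_mult_right_zero[OF this]
  have "((\<lambda>y. (cmod (s x) + 1) * fact (m + 2) * (norm ((q y)\<^sup>2) / norm (y - x))) \<longlongrightarrow> 0) (at x)" .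
  then have "((\<lambda>y. cmod (flat q s m y) / norm (y - x)) \<longlongrightarrow> 0) (at x)"
    by (rule Lim_null_comparison[rotated]) (use ev in simp)
  then show ?thesis unfolding has_derivative_iff_norm using True by (simp add: flat_def)
qed

lemma smooth_on_flat:
  assumes Q: "smooth_on UNIV (\<lambda>x. complex_of_real (q x))" and s: "smooth_on UNIV s"
  shows "smooth_on UNIV (flat q s m)"
proof (rule smooth_on_coinduct[where F = "{f. \<exists>s m. smooth_on UNIV s \<and> f = flat q s m}"])
  let ?Q = "\<lambda>x. complex_of_real (q x)"
  have q: "(q has_derivative (\<lambda>v. Re (frechet_derivative ?Q (at x) v))) (at x)" for x
    using has_derivative_Re[OF smooth_on_differentiable[OF Q UNIV_I, unfolded frechet_derivative_works]] by simp
  \<comment> \<open>The complexified \<open>q\<close> has a real-valued derivative, so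
    \<open>partial_deriv i ?Q\<close> can take the place of the real derivative of \<open>q\<close>
    in the new coefficient \<open>?s\<close>.\<close>
  have q': "frechet_derivative ?Q (at x) v = complex_of_real (Re (frechet_derivative ?Q (at x) v))" for x v
    using frechet_derivative_at[OF has_derivative_of_real[OF q[of x], where 'a = complex]] by metis
  fix f assume "f \<in> {f. \<exists>s m. smooth_on UNIV s \<and> f = flat q s m}"
  then obtain s m where s: "smooth_on UNIV s" and f: "f = flat q s m" by auto
  have sd: "(s has_derivative frechet_derivative s (at x)) (at x)" for x
    using smooth_on_differentiable[OF s] frechet_derivative_works by auto
  show "f differentiable at x" for x
    unfolding f differentiable_def
    using has_derivative_flat_pos[OF q sd, of x] has_derivative_flat_nonpos[OF q sd, of x]
    by (meson linorder_not_less)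
  fix i
  let ?s = "\<lambda>x. partial_deriv i s x * (?Q x * ?Q x) + s x * partial_deriv i ?Q x * (1 - of_nat m * ?Q x)"
  have "smooth_on UNIV ?s"
    by (intro smooth_on_add smooth_on_diff smooth_on_mult smooth_on_const smooth_on_partial_deriv s Q open_UNIV)
  moreover have "partial_deriv i f x = flat q ?s (m + 2) x" for x
  proof (cases "0 < q x")
    case True
    then show ?thesis unfolding f partial_deriv_eq[OF has_derivative_flat_pos[OF q sd True]]
      using q'[of x "axis i 1"]
      by (simp add: flat_def partial_deriv_def power2_eq_square)
  next
    case False
    then show ?thesis unfolding f
      using partial_deriv_eq[OF has_derivative_flat_nonpos[OF q sd, of x]] by (simp add: flat_def)
  qed
  ultimately show "\<exists>g\<in>{f. \<exists>s m. smooth_on UNIV s \<and> f = flat q s m}. \<forall>x\<in>UNIV. partial_deriv i f x = g x"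
    by (intro bexI[of _ "flat q ?s (m + 2)"] CollectI exI[of _ ?s] exI[of _ "m + 2"]) auto
qed (use s in auto)

lemma smooth_on_coordinate: "smooth_on U (\<lambda>x::real^'n::finite. complex_of_real (x $ i))"
proof -
  let ?F = "{f. \<exists>c d. f = (\<lambda>x::real^'n. c * complex_of_real (x $ i) + d)}"
  have "smooth_on UNIV (\<lambda>x::real^'n. complex_of_real (x $ i))"
  proof (rule smooth_on_coinduct[where F = ?F])
    show "(\<lambda>x::real^'n. complex_of_real (x $ i)) \<in> ?F" by (intro CollectI exI[of _ 1] exI[of _ 0]) simp
  next
    fix f assume "f \<in> ?F"
    then obtain c d where f: "f = (\<lambda>x::real^'n. c * complex_of_real (x $ i) + d)" by auto
    have D: "(f has_derivative (\<lambda>v. c * complex_of_real (v $ i))) (at x)" for x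
      unfolding f by (auto intro!: derivative_eq_intros bounded_linear_imp_has_derivative bounded_linear_vec_nth)
    then show "f differentiable at x" for x using differentiable_def by blast
    show "\<exists>g\<in>?F. \<forall>x\<in>UNIV. partial_deriv j f x = g x" for j
      unfolding partial_deriv_eq[OF D]
      by (intro bexI[of _ "\<lambda>x. c * complex_of_real (axis j 1 $ i)"] ballI refl CollectI
          exI[of _ 0] exI[of _ "c * complex_of_real (axis j 1 $ i)"]) simp
  qed simp
  then show ?thesis using smooth_on_subset by blast
qed

lemma smooth_on_norm_squared:
  "smooth_on U (\<lambda>x::real^'n::finite. complex_of_real ((norm (x - a))\<^sup>2))"
proof -
  have "smooth_on UNIV (\<lambda>x::real^'n. \<Sum>i\<in>UNIV.
      (complex_of_real (x $ i) - complex_of_real (a $ i)) * (complex_of_real (x $ i) - complex_of_real (a $ i)))"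
    by (intro smooth_on_sum smooth_on_mult smooth_on_diff smooth_on_coordinate smooth_on_const open_UNIV)
  moreover have "complex_of_real ((norm (x - a))\<^sup>2) = (\<Sum>i\<in>UNIV.
      (complex_of_real (x $ i) - complex_of_real (a $ i)) * (complex_of_real (x $ i) - complex_of_real (a $ i)))" for x
    unfolding power2_norm_eq_inner by (simp add: inner_vec_def)
  ultimately show ?thesis using smooth_on_subset[OF _ subset_UNIV] by simp
qed

text \<open>The quotient \<open>A / (A + B)\<close>, where \<open>A = exp (- 1 / q1)\<close> lives
  in the open ball of radius \<open>R\<close> and \<open>B = exp (- 1 / q2)\<close> outside the
  closed ball of radius \<open>r\<close>. As \<open>r < R\<close>, these regions cover the space and
  the denominator is positive.\<close>

lemma cutoff_exists:
  fixes a :: "real^'n::finite"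
  assumes "0 < r" "r < R"
  obtains \<eta> :: "real^'n \<Rightarrow> real" where "smooth_on UNIV (\<lambda>x. complex_of_real (\<eta> x))"
    "\<And>x. 0 \<le> \<eta> x" "\<And>x. x \<in> cball a r \<Longrightarrow> \<eta> x = 1" "\<And>x. x \<notin> cball a R \<Longrightarrow> \<eta> x = 0"
proof -
  define q1 where "q1 x = R\<^sup>2 - (norm (x - a))\<^sup>2" for x
  define q2 where "q2 x = (norm (x - a))\<^sup>2 - r\<^sup>2" for x
  let ?A = "flat q1 (\<lambda>x. 1) 0" and ?B = "flat q2 (\<lambda>x. 1) 0"
  have "smooth_on UNIV (\<lambda>x. complex_of_real (q1 x))" "smooth_on UNIV (\<lambda>x. complex_of_real (q2 x))"
    unfolding q1_def q2_def of_real_diff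
    by (intro smooth_on_diff smooth_on_norm_squared smooth_on_const open_UNIV)+
  then have A: "smooth_on UNIV ?A" and B: "smooth_on UNIV ?B"
    by (auto intro: smooth_on_flat)
  define fA where "fA x = (if 0 < q1 x then exp (- inverse (q1 x)) else 0)" for x
  define fB where "fB x = (if 0 < q2 x then exp (- inverse (q2 x)) else 0)" for x
  have fA: "?A x = complex_of_real (fA x)" and fB: "?B x = complex_of_real (fB x)" for x
    by (auto simp: flat_def fA_def fB_def)
  have nn: "0 \<le> fA x" "0 \<le> fB x" for x by (auto simp: fA_def fB_def)
  have "r\<^sup>2 < R\<^sup>2" using assms by (intro power_strict_mono) auto
  then have "0 < q1 x \<or> 0 < q2 x" for x by (auto simp: q1_def q2_def)
  then have pos: "0 < fA x + fB x" for x
    using nn[of x] by (auto simp: fA_def fB_def intro: add_pos_nonneg add_nonneg_pos)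
  have "smooth_on UNIV (\<lambda>x. ?A x * inverse (?A x + ?B x))"
  proof (intro smooth_on_mult smooth_on_inverse smooth_on_add A B open_UNIV)
    show "?A x + ?B x \<noteq> 0" for x
      using pos[of x] unfolding fA fB of_real_add[symmetric] of_real_eq_0_iff by simp
  qed
  moreover have "?A x * inverse (?A x + ?B x) = complex_of_real (fA x * inverse (fA x + fB x))" for x
    by (simp add: fA fB)
  ultimately show ?thesis
  proof (intro that[of "\<lambda>x. fA x * inverse (fA x + fB x)"], goal_cases)
    case 1 then show ?case by simp
  next
    case (2 x) then show ?case using nn[of x] by simp
  next
    case (3 x)
    then have "(norm (x - a))\<^sup>2 \<le> r\<^sup>2" by (intro power_mono) (auto simp: dist_norm norm_minus_commute)
    then have "fB x = 0" by (simp add: fB_def q2_def)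
    then show ?case using pos[of x] by simp
  next
    case (4 x)
    then have "R\<^sup>2 \<le> (norm (x - a))\<^sup>2" using assms by (intro power_mono) (auto simp: dist_norm norm_minus_commute)
    then show ?case by (simp add: fA_def q1_def)
  qed
qed

section \<open>Test functions\<close>

lemma partial_derivs_outside:
  assumes "closed K" "\<And>x. x \<notin> K \<Longrightarrow> f x = 0" "x \<notin> K"
  shows "partial_derivs \<alpha> f x = 0"
  using partial_derivs_cong[of "- K" f "\<lambda>x. 0" x \<alpha>] assms by auto

lemma smooth_on_outside: "closed K \<Longrightarrow> (\<And>x. x \<notin> K \<Longrightarrow> f x = 0) \<Longrightarrow> smooth_on (- K) f"
  using smooth_on_cong[of "- K" f "\<lambda>x. 0"] by auto

lemma smooth_functions_iff: "f \<in> smooth_functions X \<longleftrightarrow> smooth_on X f \<and> (\<forall>x. x \<notin> X \<longrightarrow> f x = 0)"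
  by (simp add: smooth_functions_def smooth_on_def)

lemma supp_subset_iff: "closed K \<Longrightarrow> supp f \<subseteq> K \<longleftrightarrow> (\<forall>x. x \<notin> K \<longrightarrow> f x = 0)"
  unfolding supp_def using closure_minimal[of "{x. f x \<noteq> 0}" K] closure_subset[of "{x. f x \<noteq> 0}"]
  by auto

lemma supp_outside: "x \<notin> supp f \<Longrightarrow> f x = 0"
  unfolding supp_def using closure_subset[of "{x. f x \<noteq> 0}"] by auto

text \<open>\<open>X\<close> and \<open>- K\<close> cover the space, and off the closed set
  \<open>K\<close> the function is locally zero.\<close>

lemma smooth_on_extend:
  assumes "smooth_on X f" "closed K" "K \<subseteq> X" "\<And>x. x \<notin> K \<Longrightarrow> f x = 0"
  shows "smooth_on UNIV f"
  using smooth_on_subset[OF smooth_on_Un[OF assms(1) smooth_on_outside[OF assms(2,4)]], of UNIV] assms(3)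
  by auto

lemma test_functions_in_iff:
  assumes "compact K" "K \<subseteq> X"
  shows "f \<in> test_functions_in X K \<longleftrightarrow> smooth_on UNIV f \<and> (\<forall>x. x \<notin> K \<longrightarrow> f x = 0)"
  using assms smooth_on_extend[of X f K] smooth_on_subset[of UNIV f X] compact_imp_closed[OF assms(1)]
  by (auto simp: test_functions_in_def smooth_functions_iff supp_subset_iff)

lemma test_functions_eq_Union:
  "test_functions X = (\<Union>K\<in>{K. compact K \<and> K \<subseteq> X}. test_functions_in X K)"
proof -
  have "compact (supp f)" if "supp f \<subseteq> K" "compact K" for f :: "real^'n \<Rightarrow> complex" and K
    using that compact_Int_closed[of K "supp f"] by (auto simp: supp_def Int_absorb1)
  then show ?thesis
    by (auto simp: test_functions_def test_functions_in_def)
qed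

text \<open>Any compact set that carries the function is accepted in place of \<open>supp f\<close>,
  and smoothness is global; closure properties then only have to exhibit such a set, for sums a
  union.\<close>

lemma test_functions_iff:
  "f \<in> test_functions X \<longleftrightarrow> smooth_on UNIV f \<and> (\<exists>K. compact K \<and> K \<subseteq> X \<and> (\<forall>x. x \<notin> K \<longrightarrow> f x = 0))"
  unfolding test_functions_eq_Union using test_functions_in_iff[of _ X f] by auto

lemma test_functions_in_subset: "compact K \<Longrightarrow> K \<subseteq> X \<Longrightarrow> test_functions_in X K \<subseteq> test_functions X"
  unfolding test_functions_eq_Union by auto

lemma test_functionsE:
  assumes "f \<in> test_functions X"
  obtains K where "compact K" "K \<subseteq> X" "smooth_on UNIV f" "\<And>x. x \<notin> K \<Longrightarrow> f x = 0"
  using assms test_functions_iff by metis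

lemma test_functions_smooth: "f \<in> test_functions X \<Longrightarrow> smooth_on U f"
  using test_functions_iff[of f X] smooth_on_subset[of UNIV f U] by simp

lemma test_functions_supp:
  assumes "f \<in> test_functions X" shows "compact (supp f)" "supp f \<subseteq> X" "f \<in> test_functions_in X (supp f)"
  using assms by (auto simp: test_functions_def test_functions_in_def)

text \<open>\<open>f\<close> may behave arbitrarily badly at the boundary of \<open>X\<close>; the
  product vanishes off a compact subset of \<open>X\<close> and is therefore smooth on the whole
  space.\<close>

lemma test_functions_mult_left:
  assumes X: "open X" and f: "smooth_on X f" and \<phi>: "\<phi> \<in> test_functions X"
  shows "(\<lambda>x. f x * \<phi> x) \<in> test_functions X"
proof -
  obtain K where K: "compact K" "K \<subseteq> X" "\<And>x. x \<notin> K \<Longrightarrow> \<phi> x = 0"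
    using \<phi> test_functionsE by metis
  have "smooth_on X (\<lambda>x. f x * \<phi> x)"
    by (intro smooth_on_mult X f test_functions_smooth[OF \<phi>])
  then have "smooth_on UNIV (\<lambda>x. f x * \<phi> x)"
    using K by (intro smooth_on_extend[of X _ K]) (auto intro: compact_imp_closed)
  then show ?thesis unfolding test_functions_iff using K by auto
qed

lemma test_functions_mult_right:
  assumes "open X" "smooth_on X f" "\<phi> \<in> test_functions X"
  shows "(\<lambda>x. \<phi> x * f x) \<in> test_functions X"
  using test_functions_mult_left[OF assms] by (simp add: mult.commute)

lemma test_functions_mult:
  "open X \<Longrightarrow> f \<in> test_functions X \<Longrightarrow> g \<in> test_functions X \<Longrightarrow> (\<lambda>x. f x * g x) \<in> test_functions X"
  by (intro test_functions_mult_left test_functions_smooth)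

lemma test_functions_expi:
  assumes "\<phi> \<in> test_functions X" shows "(\<lambda>x. \<phi> x * expi l x) \<in> test_functions X"
proof -
  obtain K where K: "compact K" "K \<subseteq> X" "smooth_on UNIV \<phi>" "\<And>x. x \<notin> K \<Longrightarrow> \<phi> x = 0"
    using test_functionsE[OF assms] by metis
  then show ?thesis unfolding test_functions_iff
    by (auto intro!: smooth_on_mult smooth_on_expi exI[of _ K])
qed

lemma test_functions_add:
  assumes "f \<in> test_functions X" "g \<in> test_functions X"
  shows "(\<lambda>x. f x + g x) \<in> test_functions X"
proof -
  obtain K where K: "compact K" "K \<subseteq> X" "smooth_on UNIV f" "\<And>x. x \<notin> K \<Longrightarrow> f x = 0"
    using test_functionsE[OF assms(1)] by metis
  obtain L where L: "compact L" "L \<subseteq> X" "smooth_on UNIV g" "\<And>x. x \<notin> L \<Longrightarrow> g x = 0"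
    using test_functionsE[OF assms(2)] by metis
  have "f x + g x = 0" if "x \<notin> K \<union> L" for x using K(4)[of x] L(4)[of x] that by simp
  then show ?thesis unfolding test_functions_iff using K(1-3) L(1-3)
    by (auto intro!: smooth_on_add exI[of _ "K \<union> L"])
qed

lemma test_functions_cmult: "f \<in> test_functions X \<Longrightarrow> (\<lambda>x. c * f x) \<in> test_functions X"
  unfolding test_functions_iff by (auto intro!: smooth_on_mult)

lemma test_functions_diff:
  assumes "f \<in> test_functions X" "g \<in> test_functions X"
  shows "(\<lambda>x. f x - g x) \<in> test_functions X"
  using test_functions_add[OF assms(1) test_functions_cmult[OF assms(2), of "-1"]] by simp

lemma test_functions_zero: "(\<lambda>x. 0) \<in> test_functions X"
  unfolding test_functions_iff by auto

lemma test_functions_sum: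
  assumes "\<And>j. j \<in> J \<Longrightarrow> f j \<in> test_functions X"
  shows "(\<lambda>x. \<Sum>j\<in>J. f j x) \<in> test_functions X"
proof (cases "finite J")
  case True
  then show ?thesis using assms
    by (induction J) (auto intro!: test_functions_add test_functions_zero)
qed (simp add: test_functions_zero)

lemma test_functions_cnj: "f \<in> test_functions X \<Longrightarrow> (\<lambda>x. cnj (f x)) \<in> test_functions X"
  unfolding test_functions_iff by (auto intro!: smooth_on_cnj)

lemma test_functions_partial_derivs:
  assumes "f \<in> test_functions X" shows "partial_derivs \<alpha> f \<in> test_functions X"
proof -
  obtain K where K: "compact K" "K \<subseteq> X" "smooth_on UNIV f" "\<And>x. x \<notin> K \<Longrightarrow> f x = 0"
    using test_functionsE[OF assms] by metis
  then show ?thesis unfolding test_functions_iff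
    using partial_derivs_outside[of K f] compact_imp_closed smooth_on_partial_derivs by metis
qed

lemma test_functions_continuous: "f \<in> test_functions X \<Longrightarrow> continuous_on S f"
  using smooth_on_continuous_on test_functions_smooth by blast

lemma test_cutoff_exists:
  fixes a :: "real^'n::finite"
  assumes "open X" "a \<in> X"
  obtains \<eta> :: "real^'n \<Rightarrow> real" and r where "0 < r" "cball a r \<subseteq> X"
    "(\<lambda>x. complex_of_real (\<eta> x)) \<in> test_functions X"
    "\<And>x. 0 \<le> \<eta> x" "\<And>x. x \<in> cball a r \<Longrightarrow> \<eta> x = 1"
proof -
  obtain R where R: "0 < R" "cball a R \<subseteq> X" using assms open_contains_cball by blast
  obtain \<eta> :: "real^'n \<Rightarrow> real" where \<eta>: "smooth_on UNIV (\<lambda>x. complex_of_real (\<eta> x))"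
    "\<And>x. 0 \<le> \<eta> x" "\<And>x. x \<in> cball a (R/2) \<Longrightarrow> \<eta> x = 1" "\<And>x. x \<notin> cball a R \<Longrightarrow> \<eta> x = 0"
    using cutoff_exists[of "R/2" R a] R by auto
  then have "(\<lambda>x. complex_of_real (\<eta> x)) \<in> test_functions X"
    unfolding test_functions_iff using R by (auto intro!: exI[of _ "cball a R"])
  moreover have "cball a (R/2) \<subseteq> X" using R by (force simp: subset_iff)
  ultimately show ?thesis using R \<eta> by (intro that[of "R/2" \<eta>]) auto
qed

section \<open>Integrals of test functions\<close>

lemma integrable_compact_support:
  fixes f :: "'a::euclidean_space \<Rightarrow> 'b::{banach, second_countable_topology}"
  assumes "compact K" "continuous_on K f" "\<And>x. x \<notin> K \<Longrightarrow> f x = 0"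
  shows "integrable lborel f"
proof -
  have "(\<lambda>x. indicator K x *\<^sub>R f x) = f" using assms(3) by (auto simp: indicator_def)
  then show ?thesis using borel_integrable_compact[OF assms(1,2)] by simp
qed

lemma integrable_test_function: "\<phi> \<in> test_functions X \<Longrightarrow> integrable lborel \<phi>"
  by (metis integrable_compact_support test_functionsE test_functions_continuous)

lemma norm_integral_le_measure:
  fixes f :: "'a::euclidean_space \<Rightarrow> complex"
  assumes K: "compact K" and "\<And>x. x \<notin> K \<Longrightarrow> f x = 0" "\<And>x. x \<in> K \<Longrightarrow> cmod (f x) \<le> A"
  shows "cmod (integral\<^sup>L lborel f) \<le> A * measure lborel K"
proof (cases "integrable lborel f")
  case True
  have "cmod (integral\<^sup>L lborel f) \<le> (\<integral>x. cmod (f x) \<partial>lborel)" by simp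
  also have "\<dots> \<le> (\<integral>x. indicator K x * A \<partial>lborel)"
    using assms True emeasure_compact_finite[OF K] compact_imp_closed[OF K]
    by (intro integral_mono integrable_mult_left integrable_real_indicator) (auto simp: indicator_def)
  also have "\<dots> = A * measure lborel K"
    using emeasure_compact_finite[OF K] compact_imp_closed[OF K] by simp
  finally show ?thesis .
next
  \<comment> \<open>The integral of a non-integrable function is \<open>0\<close> by convention, so
    the right-hand side only has to be nonnegative: either \<open>A\<close> bounds a norm at some
    point of \<open>K\<close>, or \<open>K\<close> is empty and has measure
    \<open>0\<close>.\<close>
  case False
  show ?thesis
  proof (cases "K = {}")
    case False
    then have "0 \<le> A" using assms(3) norm_ge_zero order_trans by blast
    then show ?thesis using \<open>\<not> integrable lborel f\<close> by (simp add: not_integrable_integral_eq)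
  qed (use \<open>\<not> integrable lborel f\<close> in \<open>simp add: not_integrable_integral_eq\<close>)
qed

lemma distribution_of_eq:
  assumes "\<And>x. x \<notin> X \<Longrightarrow> f x = 0" "\<phi> \<in> test_functions X"
  shows "distribution_of X f \<phi> = (LINT x|lborel. f x * \<phi> x)"
proof -
  have "(\<lambda>x. indicator X x *\<^sub>R (f x * \<phi> x)) = (\<lambda>x. f x * \<phi> x)"
    using assms(1) by (auto simp: indicator_def)
  then show ?thesis using assms(2) by (simp add: distribution_of_def set_lebesgue_integral_def)
qed

text \<open>A point where \<open>f\<close> is nonzero would have a closed ball around it on which
  \<open>f\<close> is nonzero, and balls have positive Lebesgue measure.\<close>

lemma continuous_nonneg_integral_zero:
  fixes f :: "'a::euclidean_space \<Rightarrow> real"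
  assumes f: "continuous_on UNIV f" "integrable lborel f" "\<And>x. 0 \<le> f x" "integral\<^sup>L lborel f = 0"
  shows "f x = 0"
proof (rule ccontr)
  assume "f x \<noteq> 0"
  have "AE x in lborel. f x = 0" using integral_nonneg_eq_0_iff_AE[of lborel f] f by simp
  then have "AE x in lborel. x \<notin> {x. f x \<noteq> 0}" by simp
  moreover have op: "open {x. f x \<noteq> 0}"
    using f(1) by (intro open_Collect_neq continuous_intros)
  ultimately have z: "{x. f x \<noteq> 0} \<in> null_sets lborel"
    by (subst AE_iff_null_sets) auto
  obtain r where r: "0 < r" "cball x r \<subseteq> {x. f x \<noteq> 0}"
    using op[unfolded open_contains_cball] \<open>f x \<noteq> 0\<close> by auto
  then have "cball x r \<in> null_sets lborel"
    using z by (intro null_sets_subset[OF z]) auto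
  then show False using r unit_ball_vol_pos[of "real DIM('a)"] by (auto simp: null_sets_def emeasure_cball)
qed

lemma lborel_integral_affine:
  fixes f :: "'a::euclidean_space \<Rightarrow> complex"
  assumes [measurable]: "f \<in> borel_measurable borel" and c: "0 < c"
  shows "integral\<^sup>L lborel f = complex_of_real (c ^ DIM('a)) * (\<integral>x. f (t + c *\<^sub>R x) \<partial>lborel)"
proof -
  have "integral\<^sup>L lborel f
      = integral\<^sup>L (density (distr lborel borel (\<lambda>x. t + c *\<^sub>R x)) (\<lambda>_. \<bar>c\<bar> ^ DIM('a))) f"
    using lborel_affine[of c t] c by simp
  also have "\<dots> = (\<integral>x. \<bar>c\<bar> ^ DIM('a) *\<^sub>R f (t + c *\<^sub>R x) \<partial>lborel)"
    by (subst integral_density) (auto simp: integral_distr)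
  finally show ?thesis using c by (simp add: scaleR_conv_of_real)
qed

lemma lborel_integrable_affine:
  fixes f :: "'a::euclidean_space \<Rightarrow> complex"
  assumes f: "integrable lborel f" and c: "0 < c"
  shows "integrable lborel (\<lambda>x. f (t + c *\<^sub>R x))"
proof -
  have [measurable]: "f \<in> borel_measurable borel" using f by auto
  have "integrable (density (distr lborel borel (\<lambda>x. t + c *\<^sub>R x)) (\<lambda>_. \<bar>c\<bar> ^ DIM('a))) f"
    using lborel_affine[of c t] c f by simp
  then have "integrable lborel (\<lambda>x. \<bar>c\<bar> ^ DIM('a) *\<^sub>R f (t + c *\<^sub>R x))"
    by (subst (asm) integrable_density) (auto simp: integrable_distr_eq)
  from integrable_scaleR_right[OF this, of "inverse (c ^ DIM('a))"]
  show ?thesis using c by simp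
qed

lemma lborel_integral_translate:
  fixes f :: "'a::euclidean_space \<Rightarrow> complex"
  assumes "f \<in> borel_measurable borel"
  shows "(\<integral>x. f (x + t) \<partial>lborel) = integral\<^sup>L lborel f"
  using lborel_integral_affine[OF assms, of 1 t] by (simp add: add.commute)

text \<open>By translation invariance, \<open>t \<mapsto> \<integral> \<phi> (x + t e\<^sub>i) dx\<close> is constant; its derivative at \<open>0\<close> is
  the integral of the partial derivative.\<close>

lemma integral_partial_deriv:
  fixes \<phi> :: "real^'n::finite \<Rightarrow> complex"
  assumes "\<phi> \<in> test_functions X"
  shows "integral\<^sup>L lborel (partial_deriv i \<phi>) = 0"
proof -
  obtain K where K: "compact K" "smooth_on UNIV \<phi>" "\<And>x. x \<notin> K \<Longrightarrow> \<phi> x = 0"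
    using test_functionsE[OF assms] by metis
  let ?e = "axis i 1 :: real^'n"
  let ?t = "\<lambda>n. 1 / real (Suc n)"
  let ?F = "\<lambda>n x. (\<phi> (x + ?t n *\<^sub>R ?e) - \<phi> x) / complex_of_real (?t n)"
  have d: "\<phi> differentiable (at x)" for x using smooth_on_differentiable[OF K(2)] by simp
  then have curve: "((\<lambda>s. \<phi> (x + s *\<^sub>R ?e)) has_vector_derivative partial_deriv i \<phi> (x + s *\<^sub>R ?e)) (at s)"
    for x s
  proof -
    have "(\<phi> has_derivative frechet_derivative \<phi> (at (x + s *\<^sub>R ?e))) (at (x + s *\<^sub>R ?e))"
      using d frechet_derivative_works by blast
    moreover have "((\<lambda>s. x + s *\<^sub>R ?e) has_derivative (\<lambda>h. h *\<^sub>R ?e)) (at s)"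
      by (auto intro!: derivative_eq_intros)
    ultimately have "((\<lambda>s. \<phi> (x + s *\<^sub>R ?e)) has_derivative
        (\<lambda>h. frechet_derivative \<phi> (at (x + s *\<^sub>R ?e)) (h *\<^sub>R ?e))) (at s)"
      by (rule has_derivative_compose[rotated])
    moreover have "frechet_derivative \<phi> (at (x + s *\<^sub>R ?e)) (h *\<^sub>R ?e) = h *\<^sub>R partial_deriv i \<phi> (x + s *\<^sub>R ?e)" for h
      using linear_frechet_derivative[OF d] by (simp add: partial_deriv_def linear_scale)
    ultimately show ?thesis unfolding has_vector_derivative_def by simp
  qed
  have cont: "continuous_on UNIV \<phi>" using K(2) smooth_on_continuous_on by blast
  then have [measurable]: "\<phi> \<in> borel_measurable borel" by (rule borel_measurable_continuous_onI)
  have int: "integrable lborel \<phi>" using assms by (rule integrable_test_function)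
  obtain A where A: "0 \<le> A" "deriv_bound 1 K \<phi> A" using deriv_bound_exists[OF K(2,1)] by auto
  have bd: "cmod (partial_deriv i \<phi> x) \<le> A" for x
  proof (cases "x \<in> K")
    case True
    then have "cmod (partial_derivs [i] \<phi> x) \<le> A" using A(2) unfolding deriv_bound_def by auto
    then show ?thesis by (simp add: partial_derivs_Cons)
  next
    case False
    then show ?thesis
      using partial_derivs_outside[OF compact_imp_closed[OF K(1)] _ False, of \<phi> "[i]"] K(3) A(1)
      by (simp add: partial_derivs_Cons)
  qed
  \<comment> \<open>The points that a shift by \<open>s\<close> times the unit vector, with
    \<open>s\<close> between \<open>0\<close> and \<open>1\<close>, can carry into \<open>K\<close>.
    Outside this compact set all the difference quotients \<open>?F n\<close> vanish.\<close>
  let ?L = "(\<lambda>(x, s). x - s *\<^sub>R ?e) ` (K \<times> {0..1})"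
  have L: "compact ?L"
    by (intro compact_continuous_image compact_Times K) (auto simp: case_prod_unfold intro!: continuous_intros)
  have out: "\<phi> (x + s *\<^sub>R ?e) = 0" if "x \<notin> ?L" "s \<in> {0..1}" for x s
  proof (rule K(3))
    show "x + s *\<^sub>R ?e \<notin> K"
    proof
      assume "x + s *\<^sub>R ?e \<in> K"
      then have "x \<in> ?L" using that(2) by (intro image_eqI[of _ _ "(x + s *\<^sub>R ?e, s)"]) auto
      then show False using that by simp
    qed
  qed
  \<comment> \<open>The mean value inequality bounds every difference quotient by \<open>A\<close>,
    so that \<open>A\<close> times the indicator of \<open>?L\<close> dominates.\<close>
  have lip: "cmod (\<phi> (x + t *\<^sub>R ?e) - \<phi> x) \<le> A * \<bar>t\<bar>" for x t
  proof -
    have "cmod (\<phi> (x + t *\<^sub>R ?e) - \<phi> (x + 0 *\<^sub>R ?e)) \<le> A * norm (t - 0)"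
    proof (rule differentiable_bound[of UNIV "\<lambda>s. \<phi> (x + s *\<^sub>R ?e)" "\<lambda>s h. h *\<^sub>R partial_deriv i \<phi> (x + s *\<^sub>R ?e)"])
      show "onorm (\<lambda>h. h *\<^sub>R partial_deriv i \<phi> (x + s *\<^sub>R ?e)) \<le> A" for s
      proof (rule onorm_bound)
        show "norm (h *\<^sub>R partial_deriv i \<phi> (x + s *\<^sub>R ?e)) \<le> A * norm h" for h
          using mult_right_mono[OF bd, of "\<bar>h\<bar>"] by (simp add: mult.commute)
      qed (rule A)
    qed (use curve in \<open>auto simp: has_vector_derivative_def\<close>)
    then show ?thesis by simp
  qed
  have "(\<lambda>n. integral\<^sup>L lborel (?F n)) \<longlonglongrightarrow> integral\<^sup>L lborel (partial_deriv i \<phi>)"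
  proof (rule integral_dominated_convergence[where w = "\<lambda>x. indicator ?L x * A"])
    show "partial_deriv i \<phi> \<in> borel_measurable lborel"
      using smooth_on_continuous_on[OF smooth_on_partial_deriv[OF K(2)]]
      by (simp add: borel_measurable_continuous_onI)
    show "integrable lborel (\<lambda>x. indicator ?L x * A)"
      using emeasure_compact_finite[OF L] compact_imp_closed[OF L]
      by (intro integrable_mult_left integrable_real_indicator) auto
    show "AE x in lborel. (\<lambda>n. ?F n x) \<longlonglongrightarrow> partial_deriv i \<phi> x"
    proof (intro always_eventually allI)
      fix x
      have "((\<lambda>s. (\<phi> (x + s *\<^sub>R ?e) - \<phi> x) /\<^sub>R s) \<longlongrightarrow> partial_deriv i \<phi> x) (at 0)"
      proof -
        have "((\<lambda>s. norm (\<phi> (x + s *\<^sub>R ?e) - \<phi> x - s *\<^sub>R partial_deriv i \<phi> x) / norm s) \<longlongrightarrow> 0) (at 0)"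
          using curve[of x 0] unfolding has_vector_derivative_def has_derivative_at by simp
        then have "((\<lambda>s. norm ((\<phi> (x + s *\<^sub>R ?e) - \<phi> x) /\<^sub>R s - partial_deriv i \<phi> x)) \<longlongrightarrow> 0) (at 0)"
        proof (rule Lim_transform_eventually)
          show "\<forall>\<^sub>F s in at 0. norm (\<phi> (x + s *\<^sub>R ?e) - \<phi> x - s *\<^sub>R partial_deriv i \<phi> x) / norm s
              = norm ((\<phi> (x + s *\<^sub>R ?e) - \<phi> x) /\<^sub>R s - partial_deriv i \<phi> x)"
            unfolding eventually_at_filter
          proof (intro always_eventually allI impI)
            fix s :: real assume s: "s \<noteq> 0"
            have "(\<phi> (x + s *\<^sub>R ?e) - \<phi> x) /\<^sub>R s - partial_deriv i \<phi> x
                = (\<phi> (x + s *\<^sub>R ?e) - \<phi> x - s *\<^sub>R partial_deriv i \<phi> x) /\<^sub>R s"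
              using s by (simp add: scaleR_diff_right)
            then show "norm (\<phi> (x + s *\<^sub>R ?e) - \<phi> x - s *\<^sub>R partial_deriv i \<phi> x) / norm s
              = norm ((\<phi> (x + s *\<^sub>R ?e) - \<phi> x) /\<^sub>R s - partial_deriv i \<phi> x)"
              by (simp only: norm_scaleR) (simp add: divide_inverse mult.commute)
          qed
        qed
        then show ?thesis by (simp only: tendsto_norm_zero_iff LIM_zero_iff)
      qed
      moreover have "filterlim ?t (at 0) sequentially"
        unfolding filterlim_at using LIMSEQ_inverse_real_of_nat
        by (auto simp: inverse_eq_divide)
      ultimately have "(\<lambda>n. (\<phi> (x + ?t n *\<^sub>R ?e) - \<phi> x) /\<^sub>R ?t n) \<longlonglongrightarrow> partial_deriv i \<phi> x"
        by (rule filterlim_compose)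
      then show "(\<lambda>n. ?F n x) \<longlonglongrightarrow> partial_deriv i \<phi> x"
        by (simp add: scaleR_conv_of_real divide_inverse mult.commute)
    qed
    show "AE x in lborel. cmod (?F n x) \<le> indicator ?L x * A" for n
    proof (intro always_eventually allI)
      fix x
      show "cmod (?F n x) \<le> indicator ?L x * A"
      proof (cases "x \<in> ?L")
        case True
        have "cmod (?F n x) = cmod (\<phi> (x + ?t n *\<^sub>R ?e) - \<phi> x) / ?t n"
          by (simp only: norm_divide norm_of_real) simp
        also have "\<dots> \<le> A" using lip[of x "?t n"] by (simp add: field_simps)
        finally show ?thesis using True by simp
      next
        case False
        then show ?thesis using out[OF False, of "?t n"] out[OF False, of 0] by simp
      qed
    qed
  qed auto
  moreover have "integral\<^sup>L lborel (?F n) = 0" for n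
  proof -
    have "integrable lborel (\<lambda>x. \<phi> (x + ?t n *\<^sub>R ?e))"
      using lborel_integrable_affine[OF int, of 1 "?t n *\<^sub>R ?e"] by (simp add: add.commute)
    then show ?thesis using int by (simp add: lborel_integral_translate)
  qed
  ultimately have "(\<lambda>n. 0) \<longlonglongrightarrow> integral\<^sup>L lborel (partial_deriv i \<phi>)" by (simp only:)
  then show ?thesis by (simp add: LIMSEQ_const_iff)
qed

section \<open>The Fourier transform\<close>

definition FT :: "(real^'n::finite \<Rightarrow> complex) \<Rightarrow> real^'n \<Rightarrow> complex" where
  "FT g k = (LINT x|lborel. g x * expi (- k) x)"

lemma expi_measurable [measurable]: "expi k \<in> borel_measurable borel"
  by (intro borel_measurable_continuous_onI continuous_on_expi continuous_intros)

lemma integrable_expi: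
  assumes "integrable lborel g" shows "integrable lborel (\<lambda>x. g x * expi k x)"
  by (rule Bochner_Integration.integrable_bound[OF assms]) (use assms in \<open>auto simp: norm_mult\<close>)

lemma continuous_on_FT:
  fixes g :: "real^'n::finite \<Rightarrow> complex"
  shows "integrable lborel g \<Longrightarrow> continuous_on UNIV (FT g)"
  unfolding continuous_on_sequentially comp_def
proof (intro ballI allI impI, elim conjE)
  fix k :: "real^'n" and x assume g: "integrable lborel g" and x: "x \<longlonglongrightarrow> k"
  show "(\<lambda>n. FT g (x n)) \<longlonglongrightarrow> FT g k"
    unfolding FT_def
  proof (rule integral_dominated_convergence[where w = "\<lambda>x. cmod (g x)"])
    show "AE y in lborel. (\<lambda>n. g y * expi (- x n) y) \<longlonglongrightarrow> g y * expi (- k) y"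
      unfolding expi_def by (intro always_eventually allI tendsto_intros x)
  qed (use g in \<open>auto simp: norm_mult\<close>)
qed

lemma FT_partial_deriv:
  assumes "\<phi> \<in> test_functions X"
  shows "FT (partial_deriv i \<phi>) k = \<i> * complex_of_real (k $ i) * FT \<phi> k"
proof -
  have d: "\<phi> differentiable (at x)" "expi (- k) differentiable (at x)" for x
    using smooth_on_differentiable[OF test_functions_smooth[OF assms, of UNIV]]
      smooth_on_differentiable[OF smooth_on_expi[of UNIV "- k"]] by auto
  have "0 = integral\<^sup>L lborel (partial_deriv i (\<lambda>x. \<phi> x * expi (- k) x))"
    using integral_partial_deriv[OF test_functions_expi[OF assms]] by simp
  also have "partial_deriv i (\<lambda>x. \<phi> x * expi (- k) x)
      = (\<lambda>x. - (\<i> * complex_of_real (k $ i)) * (\<phi> x * expi (- k) x) + partial_deriv i \<phi> x * expi (- k) x)"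
    using d by (simp add: fun_eq_iff partial_deriv_mult partial_deriv_expi)
  also have "integral\<^sup>L lborel \<dots> = - (\<i> * complex_of_real (k $ i)) * FT \<phi> k + FT (partial_deriv i \<phi>) k"
    unfolding FT_def using integrable_expi integrable_test_function[OF assms]
      integrable_test_function[OF test_functions_partial_derivs[OF assms, of "[i]"]]
    by (subst Bochner_Integration.integral_add) (auto simp: partial_derivs_Cons)
  finally show ?thesis by (simp add: algebra_simps)
qed

lemma FT_partial_derivs:
  "\<phi> \<in> test_functions X \<Longrightarrow> FT (partial_derivs \<alpha> \<phi>) k = moment \<alpha> k * FT \<phi> k"
  by (induction \<alpha>)
    (simp_all add: partial_derivs_Cons moment_def FT_partial_deriv[OF test_functions_partial_derivs])

text \<open>Reduces the weight to pure powers of single coordinates, which are the symbols of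
  repeated derivatives in one direction. If \<open>M\<close> is the maximum of \<open>1\<close> and
  all \<open>|k_i|\<close>, then \<open>1 + norm k <= (1 + n) * M\<close>; this is the source of the
  constant.\<close>

lemma one_plus_norm_power_le:
  fixes k :: "real^'n::finite"
  shows "(1 + norm k) ^ N \<le> (1 + real CARD('n)) ^ N * (1 + (\<Sum>i\<in>UNIV. \<bar>k $ i\<bar> ^ N))"
proof -
  define M where "M = Max (insert 1 (range (\<lambda>i. \<bar>k $ i\<bar>)))"
  have M: "1 \<le> M" "\<bar>k $ i\<bar> \<le> M" for i unfolding M_def by (rule Max_ge; simp)+
  have "norm k \<le> (\<Sum>i\<in>UNIV. \<bar>k $ i\<bar>)" by (rule norm_le_l1_cart)
  also have "\<dots> \<le> real CARD('n) * M" using sum_bounded_above[of UNIV "\<lambda>i. \<bar>k $ i\<bar>" M] M by simp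
  finally have "1 + norm k \<le> (1 + real CARD('n)) * M" using M by (simp add: algebra_simps)
  then have "(1 + norm k) ^ N \<le> ((1 + real CARD('n)) * M) ^ N" by (intro power_mono) auto
  also have "\<dots> = (1 + real CARD('n)) ^ N * M ^ N" by (rule power_mult_distrib)
  also have "M ^ N \<le> 1 + (\<Sum>i\<in>UNIV. \<bar>k $ i\<bar> ^ N)"
  proof -
    have "M \<in> insert 1 (range (\<lambda>i. \<bar>k $ i\<bar>))" unfolding M_def by (intro Max_in) auto
    then consider "M = 1" | i where "M = \<bar>k $ i\<bar>" by auto
    then show ?thesis
    proof cases
      case (2 i)
      then have "M ^ N \<le> (\<Sum>i\<in>UNIV. \<bar>k $ i\<bar> ^ N)" by (auto intro!: member_le_sum)
      then show ?thesis by simp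
    qed (simp add: sum_nonneg)
  qed
  finally show ?thesis by (simp add: mult_left_mono)
qed

text \<open>Repeated integration by parts in each coordinate direction. The constant is fixed before
  \<open>\<phi>\<close> and depends only on \<open>K\<close> and \<open>N\<close>; this uniformity
  turns the decay into a continuity estimate for the conic seminorms.\<close>

lemma FT_decay:
  fixes K :: "(real^'n::finite) set"
  assumes "compact K"
  obtains C where "0 \<le> C" "\<And>\<phi> A k. smooth_on UNIV \<phi> \<Longrightarrow> (\<And>x. x \<notin> K \<Longrightarrow> \<phi> x = 0) \<Longrightarrow> deriv_bound N K \<phi> A \<Longrightarrow> 0 \<le> A
    \<Longrightarrow> (1 + norm k) ^ N * cmod (FT \<phi> k) \<le> C * A"
proof -
  let ?C = "(1 + real CARD('n)) ^ N * ((1 + real CARD('n)) * measure lborel K)"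
  show ?thesis
  proof (rule that[of ?C])
    show "0 \<le> ?C" by simp
    fix \<phi> A and k :: "real^'n" assume \<phi>: "smooth_on UNIV \<phi>" "\<And>x. x \<notin> K \<Longrightarrow> \<phi> x = 0"
      and A: "deriv_bound N K \<phi> A" "0 \<le> A"
    have test: "\<phi> \<in> test_functions UNIV" unfolding test_functions_iff using \<phi> assms by auto
    have b: "cmod (moment \<alpha> k) * cmod (FT \<phi> k) \<le> A * measure lborel K" if "length \<alpha> \<le> N" for \<alpha>
    proof -
      have "cmod (FT (partial_derivs \<alpha> \<phi>) k) \<le> A * measure lborel K"
        unfolding FT_def using assms partial_derivs_outside[OF compact_imp_closed[OF assms] \<phi>(2)] A that
        by (intro norm_integral_le_measure) (auto simp: norm_mult deriv_bound_def)
      then show ?thesis unfolding FT_partial_derivs[OF test] norm_mult .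
    qed
    have b0: "cmod (FT \<phi> k) \<le> A * measure lborel K" using b[of "[]"] by (simp add: moment_def)
    have bi: "\<bar>k $ i\<bar> ^ N * cmod (FT \<phi> k) \<le> A * measure lborel K" for i
    proof -
      have "cmod (moment (replicate N i) k) = \<bar>k $ i\<bar> ^ N"
        by (simp add: moment_def norm_power norm_mult)
      then show ?thesis using b[of "replicate N i"] by simp
    qed
    have "(1 + norm k) ^ N * cmod (FT \<phi> k)
        \<le> (1 + real CARD('n)) ^ N * (1 + (\<Sum>i\<in>UNIV. \<bar>k $ i\<bar> ^ N)) * cmod (FT \<phi> k)"
      by (intro mult_right_mono one_plus_norm_power_le) auto
    also have "\<dots> = (1 + real CARD('n)) ^ N * (cmod (FT \<phi> k) + (\<Sum>i\<in>UNIV. \<bar>k $ i\<bar> ^ N * cmod (FT \<phi> k)))"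
      by (simp add: algebra_simps sum_distrib_left)
    also have "\<dots> \<le> (1 + real CARD('n)) ^ N * (A * measure lborel K + real CARD('n) * (A * measure lborel K))"
      using b0 sum_bounded_above[of UNIV "\<lambda>i. \<bar>k $ i\<bar> ^ N * cmod (FT \<phi> k)", OF bi]
      by (intro mult_left_mono add_mono) auto
    also have "\<dots> = ?C * A" by (simp add: algebra_simps)
    finally show "(1 + norm k) ^ N * cmod (FT \<phi> k) \<le> ?C * A" .
  qed
qed

section \<open>Rapidly decreasing functions\<close>

text \<open>Decay without any condition on derivatives, the frequency-side counterpart of
  smoothness: it is stable under multiplication by \<open>moment\<close>, so the Fourier transform
  may be differentiated arbitrarily often.\<close>

definition rapid :: "(real^'n::finite \<Rightarrow> complex) \<Rightarrow> bool" where
  "rapid w \<longleftrightarrow> w \<in> borel_measurable borel \<and> (\<forall>N. \<exists>C. \<forall>k. (1 + norm k) ^ N * cmod (w k) \<le> C)"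

text \<open>The shell \<open>m <= norm k < m + 1\<close> lies in a ball of volume proportional to
  \<open>(m + 1)^n\<close>, and there the weight is at most \<open>(m + 1)^(-n-2)\<close>; the
  exponent \<open>n + 2\<close> leaves the convergent series of \<open>(m + 1)^(-2)\<close>.\<close>

lemma integrable_weight:
  "integrable lborel (\<lambda>k::real^'n::finite. inverse ((1 + norm k) ^ (CARD('n) + 2)))"
proof -
  let ?n = "CARD('n)" let ?N = "?n + 2"
  let ?V = "unit_ball_vol (real ?n)"
  let ?g = "\<lambda>m (k::real^'n). ennreal (inverse (real (Suc m) ^ ?N)) * indicator (cball 0 (real (Suc m))) k"
  have "(\<integral>\<^sup>+k. ennreal (inverse ((1 + norm (k::real^'n)) ^ ?N)) \<partial>lborel) \<le> (\<integral>\<^sup>+k. (\<Sum>m. ?g m k) \<partial>lborel)"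
  proof (rule nn_integral_mono)
    fix k :: "real^'n"
    define m where "m = nat \<lfloor>norm k\<rfloor>"
    have m: "real m \<le> norm k" "norm k \<le> real (Suc m)"
      unfolding m_def using floor_correct[of "norm k"] by (simp_all add: of_nat_nat add.commute less_imp_le)
    have "inverse ((1 + norm k) ^ ?N) \<le> inverse (real (Suc m) ^ ?N)"
      using m by (intro le_imp_inverse_le power_mono) auto
    then have "ennreal (inverse ((1 + norm k) ^ ?N)) \<le> ?g m k"
      using m by (auto simp: indicator_def intro!: ennreal_leI)
    also have "\<dots> \<le> (\<Sum>m. ?g m k)"
    proof -
      have le: "f m \<le> (\<Sum>m. f m)" for f :: "nat \<Rightarrow> ennreal"
        using sum_le_suminf[of f "{m}"] by simp
      show ?thesis by (rule le)
    qed
    finally show "ennreal (inverse ((1 + norm k) ^ ?N)) \<le> (\<Sum>m. ?g m k)" .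
  qed
  also have "\<dots> = (\<Sum>m. ennreal (inverse (real (Suc m) ^ ?N)) * emeasure lborel (cball (0::real^'n) (real (Suc m))))"
    by (subst nn_integral_suminf)
      (auto simp: nn_integral_cmult_indicator intro!: borel_measurable_times_ennreal borel_measurable_indicator)
  also have "\<dots> = (\<Sum>m. ennreal (?V * inverse ((real (Suc m))\<^sup>2)))"
  proof (rule suminf_cong)
    fix m
    have "inverse (real (Suc m) ^ ?N) * (?V * real (Suc m) ^ ?n) = ?V * inverse ((real (Suc m))\<^sup>2)"
      by (simp add: power_add power2_eq_square field_simps del: of_nat_Suc)
    then show "ennreal (inverse (real (Suc m) ^ ?N)) * emeasure lborel (cball (0::real^'n) (real (Suc m)))
        = ennreal (?V * inverse ((real (Suc m))\<^sup>2))"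
      by (simp add: emeasure_cball ennreal_mult[symmetric] unit_ball_vol_nonneg del: of_nat_Suc)
  qed
  also have "\<dots> < \<infinity>"
  proof -
    have "summable (\<lambda>m. inverse ((real (Suc m))\<^sup>2))"
      using inverse_power_summable[of 2, where 'a=real] summable_Suc_iff[of "\<lambda>m. inverse ((real m)\<^sup>2)"] by simp
    then have "summable (\<lambda>m. ?V * inverse ((real (Suc m))\<^sup>2))" by (rule summable_mult)
    then have "(\<Sum>m. ennreal (?V * inverse ((real (Suc m))\<^sup>2))) \<noteq> \<infinity>"
      unfolding infinity_ennreal_def by (intro ennreal_suminf_neq_top) (auto simp: unit_ball_vol_nonneg)
    then show ?thesis by (simp add: less_top)
  qed
  finally show ?thesis by (intro integrableI_nonneg) auto
qed

lemma rapid_bound: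
  assumes "rapid w" obtains C where "0 \<le> C" "\<And>k. (1 + norm k) ^ N * cmod (w k) \<le> C"
proof -
  obtain C where "\<And>k. (1 + norm k) ^ N * cmod (w k) \<le> C" using assms unfolding rapid_def by meson
  moreover from this[of 0] have "0 \<le> C" by (auto intro: order_trans[OF norm_ge_zero])
  ultimately show ?thesis using that by blast
qed

lemma rapid_measurable [measurable_dest]: "rapid w \<Longrightarrow> w \<in> borel_measurable borel"
  by (simp add: rapid_def)

lemma integrable_rapid_weight:
  fixes w :: "real^'n::finite \<Rightarrow> complex"
  assumes w: "rapid w" shows "integrable lborel (\<lambda>k. (1 + norm k) ^ m * cmod (w k))"
proof -
  let ?N = "CARD('n) + 2"
  have [measurable]: "w \<in> borel_measurable borel" using w by (rule rapid_measurable)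
  obtain C where C: "0 \<le> C" "\<And>k. (1 + norm k) ^ (m + ?N) * cmod (w k) \<le> C"
    using rapid_bound[OF w] by blast
  show ?thesis
  proof (rule Bochner_Integration.integrable_bound[OF integrable_mult_right[OF integrable_weight, of C]])
    show "AE k in lborel. norm ((1 + norm k) ^ m * cmod (w k)) \<le> norm (C * inverse ((1 + norm k) ^ ?N))"
    proof (intro always_eventually allI)
      fix k :: "real^'n"
      have p: "0 < (1 + norm k) ^ ?N" by (simp add: add_pos_nonneg)
      have "(1 + norm k) ^ m * cmod (w k) * (1 + norm k) ^ ?N \<le> C"
        using C(2)[of k] by (simp add: power_add mult_ac)
      then have "(1 + norm k) ^ m * cmod (w k) \<le> C / (1 + norm k) ^ ?N"
        using p by (simp only: pos_le_divide_eq)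
      then show "norm ((1 + norm k) ^ m * cmod (w k)) \<le> norm (C * inverse ((1 + norm k) ^ ?N))"
        using C(1) by (simp add: divide_inverse abs_mult)
    qed
  qed auto
qed

lemma integrable_rapid:
  assumes "rapid w" shows "integrable lborel w"
  using integrable_rapid_weight[OF assms, of 0] rapid_measurable[OF assms]
  by (simp add: integrable_norm_iff)

lemma rapid_moment:
  assumes w: "rapid w" shows "rapid (\<lambda>k. moment \<alpha> k * w k)"
  unfolding rapid_def
proof (intro conjI allI)
  have [measurable]: "w \<in> borel_measurable borel" "moment \<alpha> \<in> borel_measurable borel"
    using rapid_measurable[OF w] borel_measurable_continuous_onI[OF continuous_on_moment] by auto
  show "(\<lambda>k. moment \<alpha> k * w k) \<in> borel_measurable borel" by measurable
  fix N
  obtain C where C: "\<And>k. (1 + norm k) ^ (N + length \<alpha>) * cmod (w k) \<le> C"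
    using rapid_bound[OF w] by blast
  have "(1 + norm k) ^ N * cmod (moment \<alpha> k * w k) \<le> C" for k
  proof -
    have "(1 + norm k) ^ N * cmod (moment \<alpha> k * w k) \<le> (1 + norm k) ^ N * ((1 + norm k) ^ length \<alpha> * cmod (w k))"
      unfolding norm_mult by (intro mult_left_mono mult_right_mono norm_moment_le) auto
    then show ?thesis using C[of k] by (simp add: power_add mult_ac)
  qed
  then show "\<exists>C. \<forall>k. (1 + norm k) ^ N * cmod (moment \<alpha> k * w k) \<le> C" by blast
qed

lemma rapid_FT:
  fixes \<phi> :: "real^'n::finite \<Rightarrow> complex"
  assumes "\<phi> \<in> test_functions X" shows "rapid (FT \<phi>)"
  unfolding rapid_def
proof (intro conjI allI)
  show "FT \<phi> \<in> borel_measurable borel"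
    by (intro borel_measurable_continuous_onI continuous_on_FT integrable_test_function[OF assms])
  fix N
  obtain K where K: "compact K" "smooth_on UNIV \<phi>" "\<And>x. x \<notin> K \<Longrightarrow> \<phi> x = 0"
    using test_functionsE[OF assms] by metis
  obtain A where A: "0 \<le> A" "deriv_bound N K \<phi> A" using deriv_bound_exists[OF K(2,1)] by auto
  obtain C where "\<And>\<phi> A k. smooth_on UNIV \<phi> \<Longrightarrow> (\<And>x. x \<notin> K \<Longrightarrow> \<phi> x = 0) \<Longrightarrow> deriv_bound N K \<phi> A \<Longrightarrow> 0 \<le> A
    \<Longrightarrow> (1 + norm k) ^ N * cmod (FT \<phi> k) \<le> C * A"
    using FT_decay[OF K(1), where N = N] by metis
  from this[OF K(2,3) A(2,1)]
  show "\<exists>C. \<forall>k. (1 + norm k) ^ N * cmod (FT \<phi> k) \<le> C" by blast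
qed

lemma integrable_FT: "\<phi> \<in> test_functions X \<Longrightarrow> integrable lborel (FT \<phi>)"
  by (rule integrable_rapid[OF rapid_FT])

section \<open>Fourier inversion\<close>

text \<open>Fubini with \<open>|g y| * |p k|\<close> as dominating function. It serves the inversion
  formula, the identity that shows the inversion constant to be nonzero, and the passage from a
  rapid transform to a density.\<close>

lemma integral_swap_bounded_kernel:
  fixes g p :: "real^'n::finite \<Rightarrow> complex" and e :: "real^'n \<Rightarrow> real^'n \<Rightarrow> complex"
  assumes g: "integrable lborel g" and p: "integrable lborel p"
    and e: "continuous_on UNIV (\<lambda>z. e (fst z) (snd z))" "\<And>x y. cmod (e x y) \<le> 1"
  shows "(\<integral>k. (\<integral>y. g y * e y k \<partial>lborel) * p k \<partial>lborel)
       = (\<integral>y. g y * (\<integral>k. p k * e y k \<partial>lborel) \<partial>lborel)"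
proof -
  have [measurable]: "g \<in> borel_measurable borel" "p \<in> borel_measurable borel" using g p by auto
  have "(\<lambda>z. e (fst z) (snd z)) \<in> borel_measurable (borel :: ((real^'n) \<times> (real^'n)) measure)"
    using e(1) by (rule borel_measurable_continuous_onI)
  then have em[measurable]: "(\<lambda>z. e (fst z) (snd z)) \<in> borel_measurable (lborel \<Otimes>\<^sub>M lborel)"
    by (simp add: lborel_prod)
  have es[measurable]: "e y \<in> borel_measurable borel" for y
    by (intro borel_measurable_continuous_onI continuous_on_compose2[OF e(1), of UNIV "\<lambda>k. (y, k)", simplified]
        continuous_intros)
  let ?F = "\<lambda>y k. g y * (p k * e y k)"
  have b: "integrable lborel (\<lambda>k. p k * e y k)" for y
    by (rule Bochner_Integration.integrable_bound[OF p])
      (auto simp: norm_mult intro!: mult_left_le e)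
  have F: "integrable (lborel \<Otimes>\<^sub>M lborel) (case_prod ?F)"
  proof (rule lborel_pair.Fubini_integrable)
    show "(case_prod ?F) \<in> borel_measurable (lborel \<Otimes>\<^sub>M lborel)"
      unfolding case_prod_unfold by measurable
    show "AE y in lborel. integrable lborel (\<lambda>k. case_prod ?F (y, k))" using b by simp
    let ?P = "\<integral>k. cmod (p k) \<partial>lborel"
    have I: "0 \<le> (\<integral>k. cmod (p k * e y k) \<partial>lborel)" "(\<integral>k. cmod (p k * e y k) \<partial>lborel) \<le> ?P" for y
      using integrable_norm[OF b[of y]] integrable_norm[OF p]
      by (auto intro!: integral_mono mult_left_le e simp: norm_mult)
    show "integrable lborel (\<lambda>y. \<integral>k. norm (case_prod ?F (y, k)) \<partial>lborel)"
    proof (rule Bochner_Integration.integrable_bound)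
      show "integrable lborel (\<lambda>y. cmod (g y) * ?P)" using g by simp
      show "AE y in lborel. norm (\<integral>k. norm (case_prod ?F (y, k)) \<partial>lborel) \<le> norm (cmod (g y) * ?P)"
      proof (intro always_eventually allI)
        fix y
        have "(\<integral>k. norm (case_prod ?F (y, k)) \<partial>lborel) = cmod (g y) * (\<integral>k. cmod (p k * e y k) \<partial>lborel)"
          by (simp add: norm_mult[of "g _"] del: norm_mult)
        then show "norm (\<integral>k. norm (case_prod ?F (y, k)) \<partial>lborel) \<le> norm (cmod (g y) * ?P)"
          using I[of y] by (simp add: abs_mult mult_left_mono)
      qed
    qed measurable
  qed
  have "(\<integral>k. (\<integral>y. g y * e y k \<partial>lborel) * p k \<partial>lborel) = (\<integral>k. (\<integral>y. ?F y k \<partial>lborel) \<partial>lborel)"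
    by (simp add: mult_ac flip: integral_mult_right_zero)
  also have "\<dots> = (\<integral>y. (\<integral>k. ?F y k \<partial>lborel) \<partial>lborel)"
    by (rule lborel_pair.Fubini_integral[OF F])
  finally show ?thesis by simp
qed

lemma FT_expi: "FT g k * expi k x = (\<integral>y. g y * expi (- k) (y - x) \<partial>lborel)"
proof -
  have "expi (- k) (y - x) = expi (- k) y * expi k x" for y
    using expi_add_right[of "- k" y "- x"] by (simp add: expi_minus_left expi_minus_right)
  then show ?thesis unfolding FT_def by (simp add: mult.assoc[symmetric])
qed

text \<open>Both sides of the identity are limits as \<open>\<epsilon> \<rightarrow> 0\<close> of
  \<open>\<integral> FT g(k) e\<^sup>i\<^sup>k\<^sup>x \<psi>(\<epsilon> k) dk = \<integral> g(x + \<epsilon> z) FT \<psi>(z) dz\<close>.\<close>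

lemma fourier_inversion_aux:
  fixes g \<psi> :: "real^'n::finite \<Rightarrow> complex"
  assumes g: "g \<in> test_functions X" and \<psi>: "\<psi> \<in> test_functions Y"
  shows "\<psi> 0 * (\<integral>k. FT g k * expi k x \<partial>lborel) = g x * integral\<^sup>L lborel (FT \<psi>)"
proof -
  let ?t = "\<lambda>n. 1 / real (Suc n)"
  have ig: "integrable lborel g" "integrable lborel (FT g)" and ip: "integrable lborel \<psi>" "integrable lborel (FT \<psi>)"
    using integrable_test_function integrable_FT g \<psi> by auto
  have gc: "continuous_on UNIV g" and pc: "continuous_on UNIV \<psi>"
    using test_functions_continuous g \<psi> by auto
  have [measurable]: "g \<in> borel_measurable borel" "\<psi> \<in> borel_measurable borel"
    "FT g \<in> borel_measurable borel" "FT \<psi> \<in> borel_measurable borel"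
    using ig ip by auto
  have bounded: "\<exists>M. \<forall>x. cmod (f x) \<le> M" if ft: "f \<in> test_functions Z" for f :: "real^'n \<Rightarrow> complex" and Z
  proof -
    obtain K where K: "compact K" "smooth_on UNIV f" "\<And>x. x \<notin> K \<Longrightarrow> f x = 0"
      using test_functionsE[OF ft] by metis
    obtain A where A: "0 \<le> A" "deriv_bound 0 K f A" using deriv_bound_exists[OF K(2,1)] by auto
    then have "cmod (f x) \<le> A" for x using K(3) by (cases "x \<in> K") (auto simp: deriv_bound_def)
    then show ?thesis by blast
  qed
  obtain G P where G: "\<And>x. cmod (g x) \<le> G" and P: "\<And>x. cmod (\<psi> x) \<le> P" using bounded g \<psi> by metis
  have t0: "?t \<longlonglongrightarrow> 0" using LIMSEQ_inverse_real_of_nat by (simp add: inverse_eq_divide)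
  have id: "(\<integral>k. FT g k * expi k x * \<psi> (?t n *\<^sub>R k) \<partial>lborel) = (\<integral>z. g (x + ?t n *\<^sub>R z) * FT \<psi> z \<partial>lborel)" for n
  proof -
    define \<epsilon> where "\<epsilon> = ?t n"
    have pos: "0 < \<epsilon>" by (simp add: \<epsilon>_def)
    let ?c = "complex_of_real (\<epsilon> ^ CARD('n))"
    have ips: "integrable lborel (\<lambda>k. \<psi> (\<epsilon> *\<^sub>R k))"
      using lborel_integrable_affine[OF ip(1) pos, of 0] by simp
    have "(\<integral>k. FT g k * expi k x * \<psi> (\<epsilon> *\<^sub>R k) \<partial>lborel)
        = (\<integral>y. g y * (\<integral>k. \<psi> (\<epsilon> *\<^sub>R k) * expi (- k) (y - x) \<partial>lborel) \<partial>lborel)"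
      unfolding FT_expi
      by (rule integral_swap_bounded_kernel[OF ig(1) ips]) (auto intro!: continuous_intros)
    also have "\<dots> = ?c * (\<integral>z. g (x + \<epsilon> *\<^sub>R z) * (\<integral>k. \<psi> (\<epsilon> *\<^sub>R k) * expi (- k) (\<epsilon> *\<^sub>R z) \<partial>lborel) \<partial>lborel)"
    proof (subst lborel_integral_affine[OF _ pos, of _ x])
      have "continuous_on UNIV (FT (\<lambda>k. \<psi> (\<epsilon> *\<^sub>R k)))" by (rule continuous_on_FT[OF ips])
      then have "continuous_on UNIV (\<lambda>y. FT (\<lambda>k. \<psi> (\<epsilon> *\<^sub>R k)) (y - x))"
        by (rule continuous_on_compose2) (auto intro!: continuous_intros)
      moreover have "FT (\<lambda>k. \<psi> (\<epsilon> *\<^sub>R k)) (y - x) = (\<integral>k. \<psi> (\<epsilon> *\<^sub>R k) * expi (- k) (y - x) \<partial>lborel)" for y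
        unfolding FT_def expi_minus_left by (simp add: expi_commute)
      ultimately have "continuous_on UNIV (\<lambda>y. \<integral>k. \<psi> (\<epsilon> *\<^sub>R k) * expi (- k) (y - x) \<partial>lborel)" by simp
      then show "(\<lambda>y. g y * (\<integral>k. \<psi> (\<epsilon> *\<^sub>R k) * expi (- k) (y - x) \<partial>lborel)) \<in> borel_measurable borel"
        by (intro borel_measurable_times borel_measurable_continuous_onI gc)
    qed simp
    also have "\<dots> = (\<integral>z. g (x + \<epsilon> *\<^sub>R z) * FT \<psi> z \<partial>lborel)"
    proof -
      \<comment> \<open>The factor \<open>\<epsilon>^n\<close> from the substitution
        \<open>y = x + \<epsilon> z\<close> is exactly the one produced by undoing the dilation of
        \<open>\<psi>\<close>, so that no power of \<open>\<epsilon>\<close> survives.\<close>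
      have *: "?c * (\<integral>k. \<psi> (\<epsilon> *\<^sub>R k) * expi (- k) (\<epsilon> *\<^sub>R z) \<partial>lborel) = FT \<psi> z" for z
      proof -
        have "FT \<psi> z = ?c * (\<integral>k. \<psi> (0 + \<epsilon> *\<^sub>R k) * expi (- z) (0 + \<epsilon> *\<^sub>R k) \<partial>lborel)"
          unfolding FT_def by (subst lborel_integral_affine[OF _ pos, of _ 0]) auto
        moreover have "expi (- z) (\<epsilon> *\<^sub>R k) = expi (- k) (\<epsilon> *\<^sub>R z)" for k
          by (simp add: expi_def inner_commute)
        ultimately show ?thesis by simp
      qed
      then have "?c * (g y * (\<integral>k. \<psi> (\<epsilon> *\<^sub>R k) * expi (- k) (\<epsilon> *\<^sub>R z) \<partial>lborel)) = g y * FT \<psi> z" for y z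
        by (simp only: mult.left_commute[of ?c] *)
      then show ?thesis by (simp only: integral_mult_right_zero[symmetric])
    qed
    finally show ?thesis unfolding \<epsilon>_def .
  qed
  have "(\<lambda>n. \<integral>k. FT g k * expi k x * \<psi> (?t n *\<^sub>R k) \<partial>lborel) \<longlonglongrightarrow> (\<integral>k. FT g k * expi k x * \<psi> 0 \<partial>lborel)"
  proof (rule integral_dominated_convergence[where w = "\<lambda>k. cmod (FT g k) * P"])
    show "AE k in lborel. (\<lambda>n. FT g k * expi k x * \<psi> (?t n *\<^sub>R k)) \<longlonglongrightarrow> FT g k * expi k x * \<psi> 0"
    proof (intro always_eventually allI tendsto_mult tendsto_const)
      fix k :: "real^'n"
      have "(\<lambda>n. ?t n *\<^sub>R k) \<longlonglongrightarrow> 0" using tendsto_scaleR[OF t0 tendsto_const[of k]] by simp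
      then show "(\<lambda>n. \<psi> (?t n *\<^sub>R k)) \<longlonglongrightarrow> \<psi> 0"
        using pc continuous_on_tendsto_compose by fastforce
    qed
    show "(\<lambda>k. FT g k * expi k x * \<psi> 0) \<in> borel_measurable lborel"
      "(\<lambda>k. FT g k * expi k x * \<psi> (?t n *\<^sub>R k)) \<in> borel_measurable lborel" for n
      unfolding expi_commute[of _ x] by simp_all
  qed (use ig P in \<open>auto simp: norm_mult intro!: mult_left_mono\<close>)
  moreover have "(\<lambda>n. \<integral>z. g (x + ?t n *\<^sub>R z) * FT \<psi> z \<partial>lborel) \<longlonglongrightarrow> (\<integral>z. g x * FT \<psi> z \<partial>lborel)"
  proof (rule integral_dominated_convergence[where w = "\<lambda>z. G * cmod (FT \<psi> z)"])
    show "AE z in lborel. (\<lambda>n. g (x + ?t n *\<^sub>R z) * FT \<psi> z) \<longlonglongrightarrow> g x * FT \<psi> z"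
    proof (intro always_eventually allI tendsto_mult tendsto_const)
      fix z :: "real^'n"
      have "(\<lambda>n. x + ?t n *\<^sub>R z) \<longlonglongrightarrow> x"
        using tendsto_add[OF tendsto_const[of x] tendsto_scaleR[OF t0 tendsto_const[of z]]] by simp
      then show "(\<lambda>n. g (x + ?t n *\<^sub>R z)) \<longlonglongrightarrow> g x"
        using gc continuous_on_tendsto_compose by fastforce
    qed
  qed (use ip G in \<open>auto simp: norm_mult intro!: mult_right_mono\<close>)
  ultimately have "(\<integral>k. FT g k * expi k x * \<psi> 0 \<partial>lborel) = (\<integral>z. g x * FT \<psi> z \<partial>lborel)"
    unfolding id by (rule LIMSEQ_unique)
  then show ?thesis by (simp add: mult.commute)
qed

text \<open>The constant (which is \<open>(2\<pi>)\<^sup>n\<close>) need not be computed: if it were \<open>0\<close>, then \<open>\<integral> |FT g|\<^sup>2\<close> would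
  vanish for every test function \<open>g\<close>.\<close>

lemma fourier_inversion:
  "\<exists>c :: complex. \<forall>(g :: real^'n::finite \<Rightarrow> complex) X x. g \<in> test_functions X \<longrightarrow>
     g x = c * (\<integral>k. FT g k * expi k x \<partial>lborel)"
proof -
  obtain \<eta> :: "real^'n \<Rightarrow> real" and r where \<eta>: "0 < r"
    "(\<lambda>x. complex_of_real (\<eta> x)) \<in> test_functions UNIV"
    "\<And>x. 0 \<le> \<eta> x" "\<And>x. x \<in> cball 0 r \<Longrightarrow> \<eta> x = 1"
    using test_cutoff_exists[of UNIV 0] by (metis UNIV_I open_UNIV)
  define b where "b x = complex_of_real (\<eta> x)" for x
  have b: "b \<in> test_functions UNIV" using \<eta>(2) unfolding b_def .
  have b0: "b 0 = 1" using \<eta>(1) \<eta>(4)[of 0] by (simp add: b_def)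
  have ib: "integrable lborel b" "integrable lborel (FT b)"
    using b integrable_test_function integrable_FT by auto
  define C where "C = integral\<^sup>L lborel (FT b)"
  have inv: "(\<integral>k. FT g k * expi k x \<partial>lborel) = g x * C" if "g \<in> test_functions X" for g :: "real^'n \<Rightarrow> complex" and X x
    using fourier_inversion_aux[OF that b, of x] by (simp add: b0 C_def)
  have "C \<noteq> 0"
  proof
    assume "C = 0"
    then have "0 = (\<integral>x. cnj (b x) * (\<integral>k. FT b k * expi k x \<partial>lborel) \<partial>lborel)"
      by (simp add: inv[OF b])
    also have "\<dots> = (\<integral>k. (\<integral>x. cnj (b x) * expi k x \<partial>lborel) * FT b k \<partial>lborel)"
      using ib by (intro integral_swap_bounded_kernel[symmetric]) (auto intro!: continuous_intros)
    also have "\<dots> = (\<integral>k. complex_of_real ((cmod (FT b k))\<^sup>2) \<partial>lborel)"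
    proof -
      have *: "(\<integral>x. cnj (b x) * expi k x \<partial>lborel) = cnj (FT b k)" for k
        unfolding FT_def Bochner_Integration.integral_cnj[symmetric] by (simp add: expi_minus_left)
      then show ?thesis by (simp only: * complex_norm_square mult.commute[of "cnj _"])
    qed
    also have "\<dots> = complex_of_real (\<integral>k. (cmod (FT b k))\<^sup>2 \<partial>lborel)"
      by (rule integral_complex_of_real)
    finally have z: "(\<integral>k. (cmod (FT b k))\<^sup>2 \<partial>lborel) = 0" by (metis of_real_eq_0_iff)
    have cont: "continuous_on UNIV (FT b)" by (rule continuous_on_FT[OF ib(1)])
    obtain M where M: "\<And>k. cmod (FT b k) \<le> M" using rapid_bound[OF rapid_FT[OF b], of 0] by auto
    have "(cmod (FT b 0))\<^sup>2 = 0"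
    proof (rule continuous_nonneg_integral_zero[where f = "\<lambda>k. (cmod (FT b k))\<^sup>2"])
      show "integrable lborel (\<lambda>k. (cmod (FT b k))\<^sup>2)"
        by (rule Bochner_Integration.integrable_bound[OF integrable_mult_right[OF integrable_norm[OF ib(2)], of M]])
          (use ib M in \<open>auto simp: power2_eq_square norm_mult abs_mult intro!: mult_right_mono order_trans[OF M abs_ge_self]\<close>)
    qed (use cont z in \<open>auto intro!: continuous_intros\<close>)
    \<comment> \<open>At frequency \<open>0\<close> the transform of the bump is its integral, which
      cannot vanish because \<open>\<eta>\<close> is continuous, nonnegative and equal to
      \<open>1\<close> at the centre.\<close>
    then have "complex_of_real (integral\<^sup>L lborel \<eta>) = 0" by (simp add: FT_def b_def)
    then have i0: "integral\<^sup>L lborel \<eta> = 0" by simp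
    have c\<eta>: "continuous_on UNIV \<eta>"
      using continuous_on_Re[OF test_functions_continuous[OF b]] by (simp add: b_def)
    have "integrable lborel \<eta>" using integrable_Re[OF ib(1)] by (simp add: b_def)
    then have "\<eta> 0 = 0" by (rule continuous_nonneg_integral_zero[OF c\<eta> _ \<eta>(3) i0])
    then show False using \<eta>(1) \<eta>(4)[of 0] by simp
  qed
  then show ?thesis
    using inv by (intro exI[of _ "inverse C"]) (simp add: field_simps)
qed

section \<open>Topologies defined by seminorms\<close>

lemma openin_seminorm_ball:
  assumes "f \<in> S" "finite Q" "Q \<subseteq> P" "0 < e"
  shows "openin (seminorm_topology S P) {g \<in> S. \<forall>p\<in>Q. p (\<lambda>x. g x - f x) < ennreal e}"
  using assms(2,3)
proof (induction Q)
  case empty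
  have "openin (seminorm_topology S P) S"
    using openin_topspace[of "seminorm_topology S P"] by simp
  then show ?case by simp
next
  case (insert p Q)
  have "openin (seminorm_topology S P) {g \<in> S. p (\<lambda>x. g x - f x) < ennreal e}"
    unfolding seminorm_topology_def using insert assms
    by (intro topology_generated_by_Basis) auto
  then have "openin (seminorm_topology S P)
      ({g \<in> S. p (\<lambda>x. g x - f x) < ennreal e} \<inter> {g \<in> S. \<forall>p\<in>Q. p (\<lambda>x. g x - f x) < ennreal e})"
    using insert by (intro openin_Int) auto
  moreover have "{g \<in> S. p (\<lambda>x. g x - f x) < ennreal e} \<inter> {g \<in> S. \<forall>p\<in>Q. p (\<lambda>x. g x - f x) < ennreal e}
      = {g \<in> S. \<forall>p\<in>insert p Q. p (\<lambda>x. g x - f x) < ennreal e}" by auto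
  ultimately show ?case by simp
qed

lemma ennreal_less_add_gap:
  assumes "a < ennreal e" obtains d where "0 < d" "\<And>b. b < ennreal d \<Longrightarrow> b + a < ennreal e"
proof -
  obtain r where r: "0 \<le> r" "a = ennreal r" "r < e"
    using assms by (cases a rule: ennreal_cases) (auto simp: ennreal_less_iff)
  show ?thesis
  proof (rule that[of "e - r"])
    fix b assume "b < ennreal (e - r)"
    then obtain s where "0 \<le> s" "b = ennreal s" "s < e - r"
      by (cases b rule: ennreal_cases) (auto simp: ennreal_less_iff)
    then show "b + a < ennreal e" using r by (simp add: ennreal_less_iff flip: ennreal_plus)
  qed (use r in simp)
qed

text \<open>By the triangle inequality a subbasic semiball contains a semiball of the same seminorm
  around each of its points; a finite intersection collects finitely many seminorms and the smaller
  radius. The inequality is assumed for differences of members of \<open>S\<close>, a form that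
  holds for the smooth and the test topology alike.\<close>

lemma seminorm_topology_ball:
  assumes "openin (seminorm_topology S P) U" "f \<in> U"
    and tri: "\<And>p f g h. p \<in> P \<Longrightarrow> f \<in> S \<Longrightarrow> g \<in> S \<Longrightarrow> h \<in> S \<Longrightarrow>
      p (\<lambda>x. h x - f x) \<le> p (\<lambda>x. h x - g x) + p (\<lambda>x. g x - f x)"
  shows "\<exists>Q e. finite Q \<and> Q \<subseteq> P \<and> 0 < e \<and> {g \<in> S. \<forall>p\<in>Q. p (\<lambda>x. g x - f x) < ennreal e} \<subseteq> U"
proof -
  let ?B = "insert S {{g \<in> S. p (\<lambda>x. g x - f x) < ennreal e} | f p e. f \<in> S \<and> p \<in> P \<and> 0 < e}"
  have "generate_topology_on ?B U"
    using assms(1) by (simp add: seminorm_topology_def openin_topology_generated_by_iff)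
  then have "\<forall>f\<in>U. \<exists>Q e. finite Q \<and> Q \<subseteq> P \<and> 0 < e \<and> {g \<in> S. \<forall>p\<in>Q. p (\<lambda>x. g x - f x) < ennreal e} \<subseteq> U"
  proof (induction rule: generate_topology_on.induct)
    case Empty
    then show ?case by simp
  next
    case (Int a b)
    show ?case
    proof
      fix f assume f: "f \<in> a \<inter> b"
      obtain Q1 e1 where 1: "finite Q1" "Q1 \<subseteq> P" "0 < e1"
        "{g \<in> S. \<forall>p\<in>Q1. p (\<lambda>x. g x - f x) < ennreal e1} \<subseteq> a"
        using bspec[OF Int.IH(1) IntD1[OF f]] by (elim exE conjE) (rule that)
      obtain Q2 e2 where 2: "finite Q2" "Q2 \<subseteq> P" "0 < e2"
        "{g \<in> S. \<forall>p\<in>Q2. p (\<lambda>x. g x - f x) < ennreal e2} \<subseteq> b"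
        using bspec[OF Int.IH(2) IntD2[OF f]] by (elim exE conjE) (rule that)
      have "ennreal (min e1 e2) \<le> ennreal e1" "ennreal (min e1 e2) \<le> ennreal e2" by (auto intro: ennreal_leI)
      then have less: "x < ennreal e1" "x < ennreal e2" if "x < ennreal (min e1 e2)" for x
        using order_less_le_trans[OF that] by simp_all
      have "{g \<in> S. \<forall>p\<in>Q1 \<union> Q2. p (\<lambda>x. g x - f x) < ennreal (min e1 e2)} \<subseteq> a \<inter> b"
      proof (intro subsetI IntI)
        fix g assume "g \<in> {g \<in> S. \<forall>p\<in>Q1 \<union> Q2. p (\<lambda>x. g x - f x) < ennreal (min e1 e2)}"
        then have "g \<in> {g \<in> S. \<forall>p\<in>Q1. p (\<lambda>x. g x - f x) < ennreal e1}"
          "g \<in> {g \<in> S. \<forall>p\<in>Q2. p (\<lambda>x. g x - f x) < ennreal e2}" using less by simp_all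
        then show "g \<in> a" "g \<in> b" using 1(4) 2(4) by (simp_all only: subset_iff)
      qed
      then show "\<exists>Q e. finite Q \<and> Q \<subseteq> P \<and> 0 < e \<and> {g \<in> S. \<forall>p\<in>Q. p (\<lambda>x. g x - f x) < ennreal e} \<subseteq> a \<inter> b"
        using 1 2 by (intro exI[of _ "Q1 \<union> Q2"] exI[of _ "min e1 e2"]) auto
    qed
  next
    case (UN K)
    show ?case
    proof
      fix f assume "f \<in> \<Union>K"
      then obtain k where k: "k \<in> K" "f \<in> k" by blast
      obtain Q e where "finite Q" "Q \<subseteq> P" "0 < e"
        "{g \<in> S. \<forall>p\<in>Q. p (\<lambda>x. g x - f x) < ennreal e} \<subseteq> k"
        using bspec[OF UN.IH[OF k(1)] k(2)] by (elim exE conjE) (rule that)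
      then show "\<exists>Q e. finite Q \<and> Q \<subseteq> P \<and> 0 < e \<and> {g \<in> S. \<forall>p\<in>Q. p (\<lambda>x. g x - f x) < ennreal e} \<subseteq> \<Union>K"
        using Union_upper[OF k(1)] by (intro exI[of _ Q] exI[of _ e]) simp
    qed
  next
    case (Basis s)
    then consider "s = S" | f0 p e0 where "s = {g \<in> S. p (\<lambda>x. g x - f0 x) < ennreal e0}" "f0 \<in> S" "p \<in> P" "0 < e0"
      by auto
    then show ?case
    proof cases
      case 1
      then show ?thesis by (auto intro!: exI[of _ "{}"] exI[of _ 1])
    next
      case (2 f0 p e0)
      show ?thesis
      proof
        fix f assume f: "f \<in> s"
        then obtain d where d: "0 < d" "\<And>b. b < ennreal d \<Longrightarrow> b + p (\<lambda>x. f x - f0 x) < ennreal e0"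
          using ennreal_less_add_gap[of "p (\<lambda>x. f x - f0 x)" e0] 2 by auto
        have "{g \<in> S. \<forall>p\<in>{p}. p (\<lambda>x. g x - f x) < ennreal d} \<subseteq> s"
        proof
          fix g assume "g \<in> {g \<in> S. \<forall>p\<in>{p}. p (\<lambda>x. g x - f x) < ennreal d}"
          then have g: "g \<in> S" "p (\<lambda>x. g x - f x) < ennreal d" by auto
          have "p (\<lambda>x. g x - f0 x) \<le> p (\<lambda>x. g x - f x) + p (\<lambda>x. f x - f0 x)"
            using tri[of p f0 f g] 2 f g by auto
          then show "g \<in> s" using d(2)[OF g(2)] g 2 by auto
        qed
        then show "\<exists>Q e. finite Q \<and> Q \<subseteq> P \<and> 0 < e \<and> {g \<in> S. \<forall>p\<in>Q. p (\<lambda>x. g x - f x) < ennreal e} \<subseteq> s"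
          using d 2 by (intro exI[of _ "{p}"] exI[of _ d]) auto
      qed
    qed
  qed
  then show ?thesis using assms(2) by blast
qed

text \<open>Each target seminorm is controlled by finitely many source seminorms. The estimate
  concerns \<open>T g - T f\<close>, so that linearity enters where the estimate is checked, once
  for the embedding and once for its inverse.\<close>

lemma continuous_map_seminorm_topologies:
  fixes T :: "('a \<Rightarrow> complex) \<Rightarrow> 'b \<Rightarrow> complex"
  assumes T: "\<And>f. f \<in> S \<Longrightarrow> T f \<in> S'"
    and zero: "\<And>p. p \<in> P \<Longrightarrow> p (\<lambda>x. 0) = 0"
    and tri: "\<And>q f g h. q \<in> P' \<Longrightarrow> f \<in> S' \<Longrightarrow> g \<in> S' \<Longrightarrow> h \<in> S' \<Longrightarrow>
      q (\<lambda>x. h x - f x) \<le> q (\<lambda>x. h x - g x) + q (\<lambda>x. g x - f x)"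
    and est: "\<And>q. q \<in> P' \<Longrightarrow> \<exists>Q C. finite Q \<and> Q \<subseteq> P \<and> (\<forall>f\<in>S. \<forall>g\<in>S.
      q (\<lambda>x. T g x - T f x) \<le> ennreal C * (\<Sum>p\<in>Q. p (\<lambda>x. g x - f x)))"
  shows "continuous_map (seminorm_topology S P) (seminorm_topology S' P') T"
  unfolding seminorm_topology_def[of S' P']
proof (rule continuous_on_generated_topo)
  fix U assume "U \<in> insert S' {{g \<in> S'. p (\<lambda>x. g x - f x) < ennreal e} |f p e. f \<in> S' \<and> p \<in> P' \<and> 0 < e}"
  then consider "U = S'" | f0 q e0 where "U = {g \<in> S'. q (\<lambda>x. g x - f0 x) < ennreal e0}" "f0 \<in> S'" "q \<in> P'" "0 < e0"
    by auto
  then show "openin (seminorm_topology S P) (T -` U \<inter> topspace (seminorm_topology S P))"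
  proof cases
    case 1
    then have "T -` U \<inter> topspace (seminorm_topology S P) = topspace (seminorm_topology S P)" using T by auto
    then show ?thesis by (simp only: openin_topspace)
  next
    case (2 f0 q e0)
    obtain Q C where Q: "finite Q" "Q \<subseteq> P" and C: "\<And>f g. f \<in> S \<Longrightarrow> g \<in> S \<Longrightarrow>
        q (\<lambda>x. T g x - T f x) \<le> ennreal C * (\<Sum>p\<in>Q. p (\<lambda>x. g x - f x))"
      using est[OF 2(3)] by blast
    show ?thesis
    proof (subst openin_subopen, intro ballI)
      fix f assume "f \<in> T -` U \<inter> topspace (seminorm_topology S P)"
      then have f: "f \<in> S" "q (\<lambda>x. T f x - f0 x) < ennreal e0" using 2 by auto
      then obtain d where d: "0 < d" "\<And>b. b < ennreal d \<Longrightarrow> b + q (\<lambda>x. T f x - f0 x) < ennreal e0"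
        using ennreal_less_add_gap by metis
      \<comment> \<open>The summand \<open>1\<close> keeps \<open>D\<close> positive and makes
        \<open>|C| * card Q * (d / D) < d\<close> strict, also when \<open>Q\<close> is
        empty.\<close>
      define D where "D = \<bar>C\<bar> * real (card Q) + 1"
      have D: "0 < D" by (simp add: D_def add_nonneg_pos)
      let ?N = "{g \<in> S. \<forall>p\<in>Q. p (\<lambda>x. g x - f x) < ennreal (d / D)}"
      have "openin (seminorm_topology S P) ?N"
        using f Q d D by (intro openin_seminorm_ball) auto
      moreover have "p (\<lambda>x. f x - f x) < ennreal (d / D)" if "p \<in> Q" for p
        using zero[OF subsetD[OF Q(2) that]] d D by simp
      then have "f \<in> ?N" using f by simp
      moreover have "?N \<subseteq> T -` U \<inter> topspace (seminorm_topology S P)"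
      proof
        fix g assume g: "g \<in> ?N"
        have "(\<Sum>p\<in>Q. p (\<lambda>x. g x - f x)) \<le> (\<Sum>p\<in>Q. ennreal (d / D))"
          using g by (intro sum_mono) (auto intro: less_imp_le)
        also have "\<dots> = ennreal (real (card Q) * (d / D))"
          using d D by (subst ennreal_mult) (simp_all add: ennreal_of_nat_eq_real_of_nat)
        finally have "ennreal C * (\<Sum>p\<in>Q. p (\<lambda>x. g x - f x)) \<le> ennreal \<bar>C\<bar> * ennreal (real (card Q) * (d / D))"
          by (intro mult_mono ennreal_leI) auto
        also have "\<dots> = ennreal (\<bar>C\<bar> * real (card Q) * (d / D))"
          using d D by (simp add: mult.assoc flip: ennreal_mult)
        also have "\<dots> < ennreal d"
          using d D unfolding D_def by (simp add: ennreal_less_iff field_simps)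
        finally have "q (\<lambda>x. T g x - T f x) < ennreal d"
          using C[of f g] f g by (auto intro: order_le_less_trans)
        then have "q (\<lambda>x. T g x - T f x) + q (\<lambda>x. T f x - f0 x) < ennreal e0" by (rule d)
        moreover have "q (\<lambda>x. T g x - f0 x) \<le> q (\<lambda>x. T g x - T f x) + q (\<lambda>x. T f x - f0 x)"
          using tri[of q f0 "T f" "T g"] T f g 2 by auto
        ultimately show "g \<in> T -` U \<inter> topspace (seminorm_topology S P)"
          using g T 2 by (auto intro: order_le_less_trans)
      qed
      ultimately show "\<exists>N. openin (seminorm_topology S P) N \<and> f \<in> N \<and> N \<subseteq> T -` U \<inter> topspace (seminorm_topology S P)"
        by blast
    qed
  qed
qed (use T in auto)

lemma seminorm_onD:
  assumes "seminorm_on S p" "f \<in> S"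
  shows "0 \<le> p f" "g \<in> S \<Longrightarrow> p (\<lambda>x. f x + g x) \<le> p f + p g" "p (\<lambda>x. c * f x) = cmod c * p f"
  using assms by (simp_all add: seminorm_on_def)

section \<open>Seminorms on smooth functions and on test functions\<close>

lemma smooth_seminorm_zero [simp]: "smooth_seminorm m K (\<lambda>x. 0) = 0"
  using smooth_seminorm_le_iff[of 0 m K "\<lambda>x. 0"] by (simp add: deriv_bound_def)

lemma smooth_seminorm_mono:
  assumes "m \<le> m'" "K \<subseteq> K'" shows "smooth_seminorm m K f \<le> smooth_seminorm m' K' f"
  unfolding smooth_seminorm_def using assms by (intro SUP_subset_mono) auto

lemma smooth_functions_add:
  "open X \<Longrightarrow> f \<in> smooth_functions X \<Longrightarrow> g \<in> smooth_functions X \<Longrightarrow> (\<lambda>x. f x + g x) \<in> smooth_functions X"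
  unfolding smooth_functions_iff by (auto intro: smooth_on_add)

lemma smooth_functions_cmult:
  "open X \<Longrightarrow> f \<in> smooth_functions X \<Longrightarrow> (\<lambda>x. c * f x) \<in> smooth_functions X"
  unfolding smooth_functions_iff by (auto intro: smooth_on_mult)

lemma smooth_functions_diff:
  "open X \<Longrightarrow> f \<in> smooth_functions X \<Longrightarrow> g \<in> smooth_functions X \<Longrightarrow> (\<lambda>x. f x - g x) \<in> smooth_functions X"
  unfolding smooth_functions_iff by (auto intro: smooth_on_diff)

lemma smooth_seminorm_triangle:
  assumes X: "open X" "K \<subseteq> X" and "f \<in> smooth_functions X" "g \<in> smooth_functions X" "h \<in> smooth_functions X"
  shows "smooth_seminorm m K (\<lambda>x. h x - f x)
       \<le> smooth_seminorm m K (\<lambda>x. h x - g x) + smooth_seminorm m K (\<lambda>x. g x - f x)"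
  unfolding smooth_seminorm_def
proof (intro SUP_least)
  fix x \<alpha> assume x: "x \<in> K" and \<alpha>: "\<alpha> \<in> {\<alpha> :: 'a list. length \<alpha> \<le> m}"
  have s: "smooth_on X f" "smooth_on X g" "smooth_on X h" using assms by (auto simp: smooth_functions_iff)
  have eq: "partial_derivs \<alpha> (\<lambda>x. h x - f x) x
      = partial_derivs \<alpha> (\<lambda>x. h x - g x) x + partial_derivs \<alpha> (\<lambda>x. g x - f x) x"
    using s x X by (simp add: partial_derivs_diff[OF X(1)] subset_iff)
  have "ennreal (cmod (partial_derivs \<alpha> (\<lambda>x. h x - f x) x))
      \<le> ennreal (cmod (partial_derivs \<alpha> (\<lambda>x. h x - g x) x)) + ennreal (cmod (partial_derivs \<alpha> (\<lambda>x. g x - f x) x))"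
    unfolding eq by (simp add: norm_triangle_ineq flip: ennreal_plus)
  also have "\<dots> \<le> (SUP x\<in>K. SUP \<alpha>\<in>{\<alpha>. length \<alpha> \<le> m}. ennreal (cmod (partial_derivs \<alpha> (\<lambda>x. h x - g x) x)))
      + (SUP x\<in>K. SUP \<alpha>\<in>{\<alpha>. length \<alpha> \<le> m}. ennreal (cmod (partial_derivs \<alpha> (\<lambda>x. g x - f x) x)))"
    by (intro add_mono SUP_upper2[OF x] SUP_upper[OF \<alpha>])
  finally show "ennreal (cmod (partial_derivs \<alpha> (\<lambda>x. h x - f x) x)) \<le> \<dots>" .
qed

lemma smooth_seminorm_finite:
  assumes "open X" "compact K" "K \<subseteq> X" "f \<in> smooth_functions X"
  obtains A where "0 \<le> A" "smooth_seminorm m K f = ennreal A" "deriv_bound m K f A"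
proof -
  obtain B where "0 \<le> B" "deriv_bound m K f B"
    using deriv_bound_exists[of X f K] assms by (auto simp: smooth_functions_iff)
  then have "smooth_seminorm m K f \<le> ennreal B" by (simp add: smooth_seminorm_le_iff)
  then obtain A where A: "0 \<le> A" "smooth_seminorm m K f = ennreal A"
    by (cases "smooth_seminorm m K f" rule: ennreal_cases) (auto simp: top_unique)
  then show ?thesis using that smooth_seminorm_le_iff[of A m K f] by simp
qed

text \<open>For seminorms this is equivalent to continuity on \<open>\<D>\<^sub>K\<close>.\<close>

definition bounded_on_compact ::
  "(real^'n::finite) set \<Rightarrow> ((real^'n \<Rightarrow> complex) \<Rightarrow> real) \<Rightarrow> (real^'n) set \<Rightarrow> bool" where
  "bounded_on_compact X p K \<longleftrightarrow> (\<exists>m L C. compact L \<and> L \<subseteq> X \<and> 0 \<le> C \<and>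
     (\<forall>\<phi>\<in>test_functions_in X K. \<forall>A\<ge>0. deriv_bound m L \<phi> A \<longrightarrow> p \<phi> \<le> C * A))"

lemma deriv_bound_cmult:
  assumes "smooth_on UNIV \<phi>" "deriv_bound m L \<phi> A"
  shows "deriv_bound m L (\<lambda>x. c * \<phi> x) (cmod c * A)"
  using assms by (auto simp: deriv_bound_def partial_derivs_cmult[OF open_UNIV] norm_mult intro!: mult_left_mono)

text \<open>Scaling by \<open>d / B\<close> moves \<open>\<phi>\<close> into the region where
  \<open>p < 1\<close>. The scale uses some \<open>B > A\<close> because \<open>A\<close> may be
  \<open>0\<close>; letting \<open>B\<close> approach \<open>A\<close> gives the bound.\<close>

lemma homogeneous_bound:
  assumes K: "compact K" "K \<subseteq> X" and d: "0 < d"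
    and hom: "\<And>c \<phi>. \<phi> \<in> test_functions_in X K \<Longrightarrow> p (\<lambda>x. c * \<phi> x) = cmod c * p \<phi>"
    and less: "\<And>\<phi>. \<phi> \<in> test_functions_in X K \<Longrightarrow> deriv_bound m L \<phi> d \<Longrightarrow> p \<phi> < 1"
    and \<phi>: "\<phi> \<in> test_functions_in X K" and A: "0 \<le> A" "deriv_bound m L \<phi> A"
  shows "p \<phi> \<le> (1 / d) * A"
proof -
  have sm: "smooth_on UNIV \<phi>" using \<phi> test_functions_in_iff[OF K] by auto
  have "p \<phi> \<le> (1 / d) * B" if B: "A < B" for B
  proof -
    let ?c = "complex_of_real (d / B)"
    have "0 < B" using A B by simp
    then have c: "cmod ?c = d / B" using d by (simp add: norm_divide)
    have "deriv_bound m L \<phi> B" using A(2) B by (auto intro: deriv_bound_mono)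
    from deriv_bound_cmult[OF sm this, of ?c]
    have "deriv_bound m L (\<lambda>x. ?c * \<phi> x) d" using c \<open>0 < B\<close> by simp
    moreover have "(\<lambda>x. ?c * \<phi> x) \<in> test_functions_in X K"
      using \<phi> smooth_on_mult[OF open_UNIV smooth_on_const sm, of ?c] by (simp add: test_functions_in_iff[OF K])
    ultimately have "p (\<lambda>x. ?c * \<phi> x) < 1" using less by blast
    then have "(d / B) * p \<phi> < 1" unfolding hom[OF \<phi>] c .
    then show ?thesis using d \<open>0 < B\<close> by (simp add: field_simps)
  qed
  then have "d * p \<phi> \<le> B" if "A < B" for B using that d by (fastforce simp: field_simps)
  then have "d * p \<phi> \<le> A" by (rule dense_ge)
  then show ?thesis using d by (simp add: field_simps)
qed

text \<open>The family of seminorms is directed: larger orders and unions of compact sets give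
  larger seminorms.\<close>

lemma smooth_seminorms_common:
  assumes "finite Q" "Q \<subseteq> {smooth_seminorm m K | m K. compact K \<and> K \<subseteq> X}"
  obtains m L where "compact L" "L \<subseteq> X" "\<And>q f. q \<in> Q \<Longrightarrow> q f \<le> smooth_seminorm m L f"
proof -
  have "\<exists>m L. compact L \<and> L \<subseteq> X \<and> (\<forall>q\<in>Q. \<forall>f. q f \<le> smooth_seminorm m L f)"
    using assms
  proof (induction Q)
    case empty
    then show ?case by (auto intro!: exI[of _ "{}"])
  next
    case (insert q Q)
    then obtain m L where 1: "compact L" "L \<subseteq> X" "\<forall>q\<in>Q. \<forall>f. q f \<le> smooth_seminorm m L f" by auto
    from insert obtain m' L' where 2: "compact L'" "L' \<subseteq> X" "q = smooth_seminorm m' L'" by auto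
    have "smooth_seminorm m L f \<le> smooth_seminorm (max m m') (L \<union> L') f"
      "smooth_seminorm m' L' f \<le> smooth_seminorm (max m m') (L \<union> L') f" for f
      by (auto intro!: smooth_seminorm_mono)
    then show ?case using 1 2
      by (intro exI[of _ "max m m'"] exI[of _ "L \<union> L'"]) (auto, meson order_trans)
  qed
  then show ?thesis using that by blast
qed

text \<open>On functions supported in \<open>K\<close> the set \<open>p < 1\<close> is a
  neighbourhood of \<open>0\<close>, so it contains a semiball of a single
  \<open>smooth_seminorm\<close>; homogeneity converts this into a linear bound.\<close>

lemma test_seminorm_bounded_on_compact:
  fixes X :: "(real^'n::finite) set"
  assumes X: "open X" and p: "test_seminorm X p" and K: "compact K" "K \<subseteq> X"
  shows "bounded_on_compact X p K"
proof -
  let ?z = "\<lambda>x::real^'n. 0::complex"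
  have sub: "test_functions_in X K \<subseteq> smooth_functions X" by (auto simp: test_functions_in_def)
  have z: "?z \<in> test_functions_in X K" by (simp add: test_functions_in_iff[OF K])
  have hom: "p (\<lambda>x. c * \<phi> x) = cmod c * p \<phi>" if "\<phi> \<in> test_functions_in X K" for c \<phi>
    using p that test_functions_in_subset[OF K] by (auto simp: test_seminorm_def seminorm_on_def)
  have "continuous_map (subtopology (smooth_topology X) (test_functions_in X K)) euclideanreal p"
    using p K by (auto simp: test_seminorm_def)
  then have "openin (subtopology (smooth_topology X) (test_functions_in X K))
      {\<phi> \<in> topspace (subtopology (smooth_topology X) (test_functions_in X K)). p \<phi> \<in> {..<1}}"
    by (rule openin_continuous_map_preimage) auto
  then obtain U where U: "openin (smooth_topology X) U" and
    Ueq: "{\<phi> \<in> smooth_functions X \<inter> test_functions_in X K. p \<phi> \<in> {..<1}} = U \<inter> test_functions_in X K"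
    by (auto simp: openin_subtopology smooth_topology_def)
  have "p ?z = 0" using hom[OF z, of 0] by simp
  then have "?z \<in> U" using Ueq z sub by auto
  have tri: "q (\<lambda>x. h x - f x) \<le> q (\<lambda>x. h x - g x) + q (\<lambda>x. g x - f x)"
    if q: "q \<in> {smooth_seminorm m K | m K. compact K \<and> K \<subseteq> X}"
      and fgh: "f \<in> smooth_functions X" "g \<in> smooth_functions X" "h \<in> smooth_functions X" for q f g h
  proof -
    obtain m K where K: "K \<subseteq> X" and eq: "q = smooth_seminorm m K" using q by blast
    show ?thesis unfolding eq by (rule smooth_seminorm_triangle[OF X K fgh])
  qed
  have ex: "\<exists>Q e. finite Q \<and> Q \<subseteq> {smooth_seminorm m K | m K. compact K \<and> K \<subseteq> X} \<and> 0 < e \<and>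
      {g \<in> smooth_functions X. \<forall>q\<in>Q. q (\<lambda>x. g x - 0) < ennreal e} \<subseteq> U"
    by (rule seminorm_topology_ball[OF U[unfolded smooth_topology_def] \<open>?z \<in> U\<close>]) (rule tri)
  obtain Q e where Q: "finite Q" "Q \<subseteq> {smooth_seminorm m K | m K. compact K \<and> K \<subseteq> X}" "0 < e"
    and QU: "{g \<in> smooth_functions X. \<forall>q\<in>Q. q (\<lambda>x. g x - 0) < ennreal e} \<subseteq> U"
    using ex by (elim exE conjE) (rule that)
  obtain m L where L: "compact L" "L \<subseteq> X" "\<And>q f. q \<in> Q \<Longrightarrow> q f \<le> smooth_seminorm m L f"
    using smooth_seminorms_common[OF Q(1,2)] by metis
  \<comment> \<open>Half of \<open>e\<close>, since \<open>deriv_bound\<close> is a weak inequality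
    and the semiball a strict one.\<close>
  have "p \<phi> \<le> (1 / (e / 2)) * A" if "\<phi> \<in> test_functions_in X K" "0 \<le> A" "deriv_bound m L \<phi> A" for \<phi> A
  proof (rule homogeneous_bound[OF K _ hom _ that(1,2,3)])
    fix \<phi> assume \<phi>: "\<phi> \<in> test_functions_in X K" and b: "deriv_bound m L \<phi> (e / 2)"
    have "q \<phi> < ennreal e" if "q \<in> Q" for q
    proof -
      have "q \<phi> \<le> smooth_seminorm m L \<phi>" by (rule L(3)[OF that])
      also have "\<dots> \<le> ennreal (e / 2)" using b Q(3) by (simp add: smooth_seminorm_le_iff)
      also have "\<dots> < ennreal e" using Q(3) by (simp add: ennreal_less_iff)
      finally show ?thesis .
    qed
    then have "\<phi> \<in> U" using QU \<phi> sub by auto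
    then show "p \<phi> < 1" using Ueq \<phi> by blast
  qed (use Q in auto)
  then show ?thesis unfolding bounded_on_compact_def using L Q(3)
    by (intro exI[of _ m] exI[of _ L] exI[of _ "1 / (e / 2)"]) auto
qed

text \<open>The reverse triangle inequality and the bound make \<open>p\<close> Lipschitz for one
  \<open>smooth_seminorm\<close> on the functions supported in \<open>K\<close>, hence continuous
  there. In this way the concrete seminorms used below are recognised as continuous.\<close>

lemma test_seminormI:
  fixes X :: "(real^'n::finite) set"
  assumes X: "open X" and p: "seminorm_on (test_functions X) p"
    and b: "\<And>K. compact K \<Longrightarrow> K \<subseteq> X \<Longrightarrow> bounded_on_compact X p K"
  shows "test_seminorm X p"
  unfolding test_seminorm_def
proof (intro conjI allI impI p, elim conjE)
  fix K :: "(real^'n) set" assume K: "compact K" "K \<subseteq> X"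
  have sub: "test_functions_in X K \<subseteq> smooth_functions X" by (auto simp: test_functions_in_def)
  obtain m L C where L: "compact L" "L \<subseteq> X" "0 \<le> C"
    and C: "\<And>\<phi> A. \<phi> \<in> test_functions_in X K \<Longrightarrow> 0 \<le> A \<Longrightarrow> deriv_bound m L \<phi> A \<Longrightarrow> p \<phi> \<le> C * A"
    using b[OF K] unfolding bounded_on_compact_def by blast
  have tri: "p \<phi> \<le> p \<psi> + p (\<lambda>x. \<phi> x - \<psi> x)"
    if "\<phi> \<in> test_functions X" "\<psi> \<in> test_functions X" for \<phi> \<psi>
  proof -
    have "p (\<lambda>x. \<psi> x + (\<phi> x - \<psi> x)) \<le> p \<psi> + p (\<lambda>x. \<phi> x - \<psi> x)"
      by (rule seminorm_onD(2)[OF p that(2) test_functions_diff[OF that]])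
    then show ?thesis by simp
  qed
  have sym: "p (\<lambda>x. \<phi> x - \<psi> x) = p (\<lambda>x. \<psi> x - \<phi> x)"
    if "\<phi> \<in> test_functions X" "\<psi> \<in> test_functions X" for \<phi> \<psi>
  proof -
    have "p (\<lambda>x. - 1 * (\<psi> x - \<phi> x)) = cmod (- 1) * p (\<lambda>x. \<psi> x - \<phi> x)"
      by (rule seminorm_onD(3)[OF p test_functions_diff[OF that(2,1)]])
    then show ?thesis by simp
  qed
  show "continuous_map (subtopology (smooth_topology X) (test_functions_in X K)) euclideanreal p"
    unfolding continuous_map
  proof (intro conjI allI impI)
    fix U :: "real set" assume "openin euclideanreal U"
    then have U: "open U" by simp
    let ?V = "{x \<in> topspace (subtopology (smooth_topology X) (test_functions_in X K)). p x \<in> U}"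
    show "openin (subtopology (smooth_topology X) (test_functions_in X K)) ?V"
    proof (subst openin_subopen, intro ballI)
      fix \<phi> assume "\<phi> \<in> ?V"
      then have \<phi>: "\<phi> \<in> test_functions_in X K" "p \<phi> \<in> U" by (auto simp: smooth_topology_def)
      obtain e where e: "0 < e" "ball (p \<phi>) e \<subseteq> U" using U \<phi>(2) open_contains_ball by metis
      let ?q = "smooth_seminorm m L"
      \<comment> \<open>The radius divides by \<open>C + 1\<close> because \<open>C\<close> may be
        \<open>0\<close>.\<close>
      let ?N = "{g \<in> smooth_functions X. \<forall>q\<in>{?q}. q (\<lambda>x. g x - \<phi> x) < ennreal (e / (C + 1))}"
      have "openin (smooth_topology X) ?N"
        unfolding smooth_topology_def using \<phi>(1) sub e L
        by (intro openin_seminorm_ball) auto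
      then have "openin (subtopology (smooth_topology X) (test_functions_in X K)) (?N \<inter> test_functions_in X K)"
        by (auto simp: openin_subtopology)
      moreover have "\<phi> \<in> ?N \<inter> test_functions_in X K" using \<phi>(1) sub e L by auto
      moreover have "?N \<inter> test_functions_in X K \<subseteq> ?V"
      proof
        fix g assume g: "g \<in> ?N \<inter> test_functions_in X K"
        then have gq: "?q (\<lambda>x. g x - \<phi> x) < ennreal (e / (C + 1))" by simp
        have d: "(\<lambda>x. g x - \<phi> x) \<in> test_functions_in X K"
          using g \<phi>(1) by (auto simp: test_functions_in_iff[OF K] intro!: smooth_on_diff)
        obtain A where A: "0 \<le> A" "?q (\<lambda>x. g x - \<phi> x) = ennreal A" "deriv_bound m L (\<lambda>x. g x - \<phi> x) A"
          using smooth_seminorm_finite[OF X L(1,2)] d sub by blast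
        then have "A < e / (C + 1)" using gq by (simp add: ennreal_less_iff)
        then have "C * A < e" using L(3) A(1) by (simp add: field_simps)
        then have lt: "p (\<lambda>x. g x - \<phi> x) < e" using C[OF d A(1,3)] by simp
        have t: "g \<in> test_functions X" "\<phi> \<in> test_functions X"
          using g \<phi>(1) test_functions_in_subset[OF K] by auto
        have "\<bar>p g - p \<phi>\<bar> < e" using tri[OF t] tri[OF t(2,1)] sym[OF t] lt by linarith
        then have "p g \<in> ball (p \<phi>) e" by (simp add: dist_real_def abs_minus_commute)
        then show "g \<in> ?V" using g e(2) by (auto simp: smooth_topology_def)
      qed
      ultimately show "\<exists>T. openin (subtopology (smooth_topology X) (test_functions_in X K)) T \<and> \<phi> \<in> T \<and> T \<subseteq> ?V"
        by blast
    qed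
  qed auto
qed

section \<open>Distributions and their order on compact sets\<close>

lemma distribution_linear:
  assumes "u \<in> distributions X" "\<phi> \<in> test_functions X"
  shows "u (\<lambda>x. c * \<phi> x) = c * u \<phi>"
    and "\<psi> \<in> test_functions X \<Longrightarrow> u (\<lambda>x. \<phi> x + \<psi> x) = u \<phi> + u \<psi>"
    and "\<psi> \<in> test_functions X \<Longrightarrow> u (\<lambda>x. \<phi> x - \<psi> x) = u \<phi> - u \<psi>"
proof -
  have 1: "u (\<lambda>x. c * \<phi> x) = c * u \<phi>" if "\<phi> \<in> test_functions X" for c \<phi>
    using assms(1) that by (auto simp: distributions_def)
  have 2: "u (\<lambda>x. \<phi> x + \<psi> x) = u \<phi> + u \<psi>" if "\<phi> \<in> test_functions X" "\<psi> \<in> test_functions X" for \<phi> \<psi>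
    using assms(1) that by (auto simp: distributions_def)
  show "u (\<lambda>x. c * \<phi> x) = c * u \<phi>" by (rule 1[OF assms(2)])
  show "u (\<lambda>x. \<phi> x + \<psi> x) = u \<phi> + u \<psi>" if "\<psi> \<in> test_functions X" by (rule 2[OF assms(2) that])
  show "u (\<lambda>x. \<phi> x - \<psi> x) = u \<phi> - u \<psi>" if "\<psi> \<in> test_functions X"
    using 1[OF that, of "-1"] 2[OF assms(2) test_functions_cmult[OF that, of "-1"]] by simp
qed

lemma distribution_sum:
  assumes u: "u \<in> distributions X" and "\<And>j. j \<in> J \<Longrightarrow> f j \<in> test_functions X"
  shows "u (\<lambda>x. \<Sum>j\<in>J. f j x) = (\<Sum>j\<in>J. u (f j))"
proof (cases "finite J")
  case True
  then show ?thesis using assms(2)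
  proof (induction J)
    case empty
    then show ?case using distribution_linear(1)[OF u test_functions_zero, of 0] by simp
  next
    case (insert j J)
    then show ?case by (simp add: distribution_linear(2)[OF u] test_functions_sum)
  qed
next
  case False
  then show ?thesis using distribution_linear(1)[OF u test_functions_zero, of 0] by simp
qed

lemma test_seminorm_triangle:
  assumes "seminorm_on (test_functions X) p" "f \<in> test_functions X" "g \<in> test_functions X" "h \<in> test_functions X"
  shows "ennreal (p (\<lambda>x. h x - f x)) \<le> ennreal (p (\<lambda>x. h x - g x)) + ennreal (p (\<lambda>x. g x - f x))"
proof -
  have "p (\<lambda>x. (h x - g x) + (g x - f x)) \<le> p (\<lambda>x. h x - g x) + p (\<lambda>x. g x - f x)"
    by (rule seminorm_onD(2)[OF assms(1) test_functions_diff[OF assms(4,3)] test_functions_diff[OF assms(3,2)]])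
  moreover have "0 \<le> p (\<lambda>x. h x - g x)" "0 \<le> p (\<lambda>x. g x - f x)"
    using assms(1) test_functions_diff[OF assms(4,3)] test_functions_diff[OF assms(3,2)]
    unfolding seminorm_on_def by simp_all
  ultimately show ?thesis by (simp flip: ennreal_plus)
qed

text \<open>Finite order on each compact set: the preimage of the unit disc contains a semiball of
  finitely many continuous seminorms, each of them bounded by derivatives on functions supported in
  \<open>K\<close>, and homogeneity applies again. Afterwards the continuity of \<open>u\<close> is
  used only in this form.\<close>

lemma distribution_bounded_on_compact:
  fixes X :: "(real^'n::finite) set"
  assumes X: "open X" and u: "u \<in> distributions X" and K: "compact K" "K \<subseteq> X"
  shows "bounded_on_compact X (\<lambda>\<phi>. cmod (u \<phi>)) K"
proof -
  let ?z = "\<lambda>x::real^'n. 0::complex"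
  have sub: "test_functions_in X K \<subseteq> test_functions X" by (rule test_functions_in_subset[OF K])
  have "continuous_map (test_topology X) euclidean u" using u by (auto simp: distributions_def)
  then have op: "openin (test_topology X) {\<phi> \<in> topspace (test_topology X). u \<phi> \<in> ball 0 1}"
    by (rule openin_continuous_map_preimage) auto
  have tri: "q (\<lambda>x. h x - f x) \<le> q (\<lambda>x. h x - g x) + q (\<lambda>x. g x - f x)"
    if q: "q \<in> {\<lambda>f. ennreal (p f) |p. test_seminorm X p}"
      and fgh: "f \<in> test_functions X" "g \<in> test_functions X" "h \<in> test_functions X" for q f g h
  proof -
    obtain p where p: "test_seminorm X p" and eq: "q = (\<lambda>f. ennreal (p f))" using q by blast
    show ?thesis unfolding eq
      by (rule test_seminorm_triangle[OF _ fgh]) (use p in \<open>simp add: test_seminorm_def\<close>)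
  qed
  have z: "?z \<in> {\<phi> \<in> topspace (test_topology X). u \<phi> \<in> ball 0 1}"
    using distribution_linear(1)[OF u test_functions_zero, of 0]
    by (simp add: test_topology_def test_functions_zero del: mem_Collect_eq) (simp add: test_functions_zero)
  have ex: "\<exists>Q e. finite Q \<and> Q \<subseteq> {\<lambda>f. ennreal (p f) |p. test_seminorm X p} \<and> 0 < e \<and>
      {g \<in> test_functions X. \<forall>q\<in>Q. q (\<lambda>x. g x - 0) < ennreal e} \<subseteq> {\<phi> \<in> topspace (test_topology X). u \<phi> \<in> ball 0 1}"
    by (rule seminorm_topology_ball[OF op[unfolded test_topology_def] z[unfolded test_topology_def],
          folded test_topology_def]) (rule tri)
  obtain Q e where Q: "finite Q" "Q \<subseteq> {\<lambda>f. ennreal (p f) |p. test_seminorm X p}" "0 < e"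
    and QU: "{g \<in> test_functions X. \<forall>q\<in>Q. q (\<lambda>x. g x - 0) < ennreal e} \<subseteq> {\<phi> \<in> topspace (test_topology X). u \<phi> \<in> ball 0 1}"
    using ex by (elim exE conjE) (rule that)
  have "\<exists>m L C. compact L \<and> L \<subseteq> X \<and> 0 \<le> C \<and>
      (\<forall>q\<in>Q. \<forall>\<phi>\<in>test_functions_in X K. \<forall>A\<ge>0. deriv_bound m L \<phi> A \<longrightarrow> q \<phi> \<le> ennreal (C * A))"
    using Q(1,2)
  proof (induction Q)
    case empty
    have "compact ({} :: (real^'n) set)" by simp
    then show ?case by (metis empty_iff empty_subsetI order_refl)
  next
    case (insert q Q)
    then obtain m L C where 1: "compact L" "L \<subseteq> X" "0 \<le> C" "\<forall>q\<in>Q. \<forall>\<phi>\<in>test_functions_in X K. \<forall>A\<ge>0.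
        deriv_bound m L \<phi> A \<longrightarrow> q \<phi> \<le> ennreal (C * A)"
      by auto
    from insert obtain p where p: "q = (\<lambda>f. ennreal (p f))" "test_seminorm X p" by auto
    obtain m' L' C' where 2: "compact L'" "L' \<subseteq> X" "0 \<le> C'"
      "\<And>\<phi> A. \<phi> \<in> test_functions_in X K \<Longrightarrow> 0 \<le> A \<Longrightarrow> deriv_bound m' L' \<phi> A \<Longrightarrow> p \<phi> \<le> C' * A"
      using test_seminorm_bounded_on_compact[OF X p(2) K] unfolding bounded_on_compact_def by blast
    show ?case
    proof (intro exI[of _ "max m m'"] exI[of _ "L \<union> L'"] exI[of _ "max C C'"] conjI ballI allI impI)
      fix q' \<phi> A assume q': "q' \<in> insert q Q" and \<phi>: "\<phi> \<in> test_functions_in X K" and A: "0 \<le> A"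
        and b: "deriv_bound (max m m') (L \<union> L') \<phi> A"
      have "deriv_bound m L \<phi> A" "deriv_bound m' L' \<phi> A" by (rule deriv_bound_mono[OF b]; simp)+
      then have "q' \<phi> \<le> ennreal (C * A) \<or> q' \<phi> \<le> ennreal (C' * A)"
        using q' 1(4)[rule_format, OF _ \<phi> A, of q'] 2(4)[OF \<phi> A] p(1) by (auto intro: ennreal_leI)
      moreover have "ennreal (C * A) \<le> ennreal (max C C' * A)" "ennreal (C' * A) \<le> ennreal (max C C' * A)"
        using A by (auto intro!: ennreal_leI mult_right_mono)
      ultimately show "q' \<phi> \<le> ennreal (max C C' * A)" by (elim disjE) (erule order_trans; assumption)+
    qed (use 1 2 in auto)
  qed
  then obtain m L C where L: "compact L" "L \<subseteq> X" "0 \<le> C"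
    and C0: "\<forall>q\<in>Q. \<forall>\<phi>\<in>test_functions_in X K. \<forall>A\<ge>0. deriv_bound m L \<phi> A \<longrightarrow> q \<phi> \<le> ennreal (C * A)"
    by auto
  note C = C0[rule_format]
  \<comment> \<open>With \<open>C + 1\<close> one gets \<open>C * d < e\<close>, strict as the
    semiball demands, also when \<open>C = 0\<close>.\<close>
  define d where "d = e / (C + 1)"
  have d: "0 < d" using Q(3) L(3) by (simp add: d_def)
  have "cmod (u \<phi>) \<le> (1 / d) * A" if "\<phi> \<in> test_functions_in X K" "0 \<le> A" "deriv_bound m L \<phi> A" for \<phi> A
  proof (rule homogeneous_bound[where p = "\<lambda>\<phi>. cmod (u \<phi>)", OF K d _ _ that])
    show "cmod (u (\<lambda>x. c * \<phi> x)) = cmod c * cmod (u \<phi>)" if "\<phi> \<in> test_functions_in X K" for c \<phi>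
      using distribution_linear(1)[OF u, of \<phi> c] that sub by (auto simp: norm_mult)
    fix \<phi> assume \<phi>: "\<phi> \<in> test_functions_in X K" and b: "deriv_bound m L \<phi> d"
    have "C * d < e" using L(3) Q(3) by (simp add: d_def field_simps)
    then have "ennreal (C * d) < ennreal e" using d L(3) by (simp add: ennreal_less_iff)
    then have "q \<phi> < ennreal e" if "q \<in> Q" for q
      using C[OF that \<phi> less_imp_le[OF d] b] by (rule order_le_less_trans[rotated])
    then show "cmod (u \<phi>) < 1" using QU \<phi> sub by (auto simp: dist_norm)
  qed
  then show ?thesis unfolding bounded_on_compact_def using L d
    by (intro exI[of _ m] exI[of _ L] exI[of _ "1 / d"]) auto
qed

text \<open>\<open>|u|\<close> is a seminorm with the required bounds, hence itself one of the
  seminorms that define the test topology, and \<open>u\<close> maps its semiballs into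
  discs.\<close>

lemma distributionI:
  fixes X :: "(real^'n::finite) set"
  assumes X: "open X"
    and add: "\<And>\<phi> \<psi>. \<phi> \<in> test_functions X \<Longrightarrow> \<psi> \<in> test_functions X \<Longrightarrow> u (\<lambda>x. \<phi> x + \<psi> x) = u \<phi> + u \<psi>"
    and cmult: "\<And>c \<phi>. \<phi> \<in> test_functions X \<Longrightarrow> u (\<lambda>x. c * \<phi> x) = c * u \<phi>"
    and out: "\<And>\<phi>. \<phi> \<notin> test_functions X \<Longrightarrow> u \<phi> = 0"
    and b: "\<And>K. compact K \<Longrightarrow> K \<subseteq> X \<Longrightarrow> bounded_on_compact X (\<lambda>\<phi>. cmod (u \<phi>)) K"
  shows "u \<in> distributions X"
proof -
  let ?p = "\<lambda>\<phi>. cmod (u \<phi>)"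
  have "seminorm_on (test_functions X) ?p"
    unfolding seminorm_on_def by (auto simp: add cmult norm_mult norm_triangle_ineq)
  then have p: "test_seminorm X ?p" by (rule test_seminormI[OF X _ b])
  have diff: "u (\<lambda>x. \<phi> x - \<psi> x) = u \<phi> - u \<psi>" if "\<phi> \<in> test_functions X" "\<psi> \<in> test_functions X" for \<phi> \<psi>
    using add[OF that(1) test_functions_cmult[OF that(2), of "-1"]] cmult[OF that(2), of "-1"] by simp
  have "continuous_map (test_topology X) euclidean u"
    unfolding continuous_map
  proof (intro conjI allI impI)
    fix U :: "complex set" assume "openin euclidean U"
    then have U: "open U" by simp
    let ?V = "{x \<in> topspace (test_topology X). u x \<in> U}"
    show "openin (test_topology X) ?V"
    proof (subst openin_subopen, intro ballI)
      fix \<phi> assume "\<phi> \<in> ?V"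
      then have \<phi>: "\<phi> \<in> test_functions X" "u \<phi> \<in> U" by (auto simp: test_topology_def)
      obtain e where e: "0 < e" "ball (u \<phi>) e \<subseteq> U" using U \<phi>(2) open_contains_ball by metis
      let ?N = "{g \<in> test_functions X. \<forall>q\<in>{\<lambda>\<phi>. ennreal (?p \<phi>)}. q (\<lambda>x. g x - \<phi> x) < ennreal e}"
      have "openin (test_topology X) ?N"
        unfolding test_topology_def using \<phi>(1) e p by (intro openin_seminorm_ball) auto
      moreover have "\<phi> \<in> ?N" using \<phi>(1) e diff[OF \<phi>(1,1)] by simp
      moreover have "?N \<subseteq> ?V"
        using e(2) diff[OF _ \<phi>(1)]
        by (auto simp: test_topology_def ennreal_less_iff dist_norm norm_minus_commute)
      ultimately show "\<exists>T. openin (test_topology X) T \<and> \<phi> \<in> T \<and> T \<subseteq> ?V" by blast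
    qed
  qed auto
  then show ?thesis unfolding distributions_def using add cmult out by auto
qed

section \<open>Smoothness of Fourier transforms\<close>

lemma has_derivative_exp_i:
  "((\<lambda>t. exp (\<i> * complex_of_real t)) has_derivative (\<lambda>h. h *\<^sub>R (\<i> * exp (\<i> * complex_of_real t)))) (at t within S)"
proof -
  have "((\<lambda>t. \<i> * complex_of_real t) has_derivative (\<lambda>h. \<i> * complex_of_real h)) (at t within S)"
    by (auto intro!: derivative_eq_intros)
  then show ?thesis
    by (rule has_derivative_compose[OF _ DERIV_exp[unfolded has_field_derivative_def], THEN has_derivative_eq_rhs])
      (simp add: fun_eq_iff scaleR_conv_of_real mult_ac)
qed

lemma norm_exp_i_diff: "cmod (exp (\<i> * complex_of_real a) - exp (\<i> * complex_of_real b)) \<le> \<bar>a - b\<bar>"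
proof -
  have "cmod (exp (\<i> * complex_of_real a) - exp (\<i> * complex_of_real b)) \<le> 1 * norm (a - b)"
  proof (rule differentiable_bound[of UNIV _ "\<lambda>t h. h *\<^sub>R (\<i> * exp (\<i> * complex_of_real t))"])
    show "((\<lambda>t. exp (\<i> * complex_of_real t)) has_derivative (\<lambda>h. h *\<^sub>R (\<i> * exp (\<i> * complex_of_real t)))) (at t within UNIV)" for t
      by (rule has_derivative_exp_i)
    show "onorm (\<lambda>h. h *\<^sub>R (\<i> * exp (\<i> * complex_of_real t))) \<le> 1" for t :: real
      by (intro onorm_bound) (auto simp: norm_mult norm_exp_i_times)
  qed auto
  then show ?thesis by simp
qed

text \<open>The mean value inequality is applied twice: the derivative
  \<open>i * (exp (i t) - 1)\<close> of the remainder is itself at most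
  \<open>|t| <= |a|\<close>.\<close>

lemma norm_exp_i_taylor: "cmod (exp (\<i> * complex_of_real a) - 1 - \<i> * complex_of_real a) \<le> a\<^sup>2"
proof -
  let ?f = "\<lambda>t. exp (\<i> * complex_of_real t) - \<i> * complex_of_real t"
  have "cmod (?f a - ?f 0) \<le> \<bar>a\<bar> * norm (a - 0)"
  proof (rule differentiable_bound[of "cball 0 \<bar>a\<bar>" _ "\<lambda>t h. h *\<^sub>R (\<i> * (exp (\<i> * complex_of_real t) - 1))"])
    show "(?f has_derivative (\<lambda>h. h *\<^sub>R (\<i> * (exp (\<i> * complex_of_real t) - 1)))) (at t within cball 0 \<bar>a\<bar>)" for t
      by (rule has_derivative_eq_rhs[OF has_derivative_diff[OF has_derivative_exp_i
            has_derivative_mult_right[OF has_derivative_of_real[OF has_derivative_ident]]]])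
        (simp add: fun_eq_iff scaleR_conv_of_real algebra_simps)
    show "onorm (\<lambda>h. h *\<^sub>R (\<i> * (exp (\<i> * complex_of_real t) - 1))) \<le> \<bar>a\<bar>" if "t \<in> cball 0 \<bar>a\<bar>" for t :: real
    proof (intro onorm_bound)
      fix h :: real
      have "cmod (exp (\<i> * complex_of_real t) - 1) \<le> \<bar>a\<bar>"
        using norm_exp_i_diff[of t 0] that by simp
      from mult_right_mono[OF this, of "\<bar>h\<bar>"]
      show "norm (h *\<^sub>R (\<i> * (exp (\<i> * complex_of_real t) - 1))) \<le> \<bar>a\<bar> * norm h"
        by (simp add: norm_mult mult.commute)
    qed simp
  qed auto
  then show ?thesis by (simp add: power2_eq_square abs_mult_self_eq algebra_simps)
qed

lemma norm_expi_diff: "cmod (expi l x - expi l' x) \<le> norm (l - l') * norm x"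
proof -
  have "cmod (expi l x - expi l' x) \<le> \<bar>l \<bullet> x - l' \<bullet> x\<bar>" unfolding expi_def by (rule norm_exp_i_diff)
  also have "\<dots> \<le> norm (l - l') * norm x" unfolding inner_diff_left[symmetric] by (rule Cauchy_Schwarz_ineq2)
  finally show ?thesis .
qed

text \<open>Differentiation under the integral with an explicit remainder: the second order bound
  for the exponential leaves \<open>(norm v)^2\<close> times the weighted integral
  \<open>M 2\<close>, which is finite by rapid decay.\<close>

lemma has_derivative_FT:
  fixes w :: "real^'n::finite \<Rightarrow> complex"
  assumes w: "rapid w"
  shows "(FT w has_derivative (\<lambda>v. \<integral>x. w x * (- (\<i> * complex_of_real (x \<bullet> v)) * expi (- k) x) \<partial>lborel)) (at k)"
    (is "(_ has_derivative ?D) _")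
proof -
  have [measurable]: "w \<in> borel_measurable borel" using w by (rule rapid_measurable)
  define M where "M m = (\<integral>x. (1 + norm x) ^ m * cmod (w x) \<partial>lborel)" for m
  have M: "integrable lborel (\<lambda>x. (1 + norm x) ^ m * cmod (w x))" for m by (rule integrable_rapid_weight[OF w])
  have iw: "integrable lborel (\<lambda>x. w x * expi k x)" for k by (rule integrable_expi[OF integrable_rapid[OF w]])
  have CS: "\<bar>x \<bullet> v\<bar> \<le> (1 + norm x) * norm v" for x v :: "real^'n"
    using Cauchy_Schwarz_ineq2[of x v] norm_ge_zero[of v] unfolding distrib_right by linarith
  have iv: "integrable lborel (\<lambda>x. w x * (- (\<i> * complex_of_real (x \<bullet> v)) * expi (- k) x))" for v
  proof (rule Bochner_Integration.integrable_bound[OF integrable_mult_right[OF M[of 1], of "norm v"]])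
    show "AE x in lborel. norm (w x * (- (\<i> * complex_of_real (x \<bullet> v)) * expi (- k) x))
        \<le> norm (norm v * ((1 + norm x) ^ 1 * cmod (w x)))"
    proof (intro always_eventually allI)
      fix x
      show "norm (w x * (- (\<i> * complex_of_real (x \<bullet> v)) * expi (- k) x))
        \<le> norm (norm v * ((1 + norm x) ^ 1 * cmod (w x)))"
        using mult_left_mono[OF CS[of x v] norm_ge_zero[of "w x"]] by (simp add: norm_mult abs_mult mult_ac)
    qed
  qed measurable
  have lin: "bounded_linear ?D"
  proof (rule bounded_linear_intro[where K = "M 1"])
    show "?D (v + v') = ?D v + ?D v'" for v v'
      unfolding Bochner_Integration.integral_add[OF iv iv, symmetric]
      by (intro Bochner_Integration.integral_cong) (auto simp: inner_add_right algebra_simps)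
    show "?D (r *\<^sub>R v) = r *\<^sub>R ?D v" for r v
      unfolding integral_scaleR_right[symmetric]
      by (intro Bochner_Integration.integral_cong) (auto simp: scaleR_conv_of_real[where 'a = complex] algebra_simps)
    show "norm (?D v) \<le> norm v * M 1" for v
    proof -
      have "norm (?D v) \<le> (\<integral>x. norm (w x * (- (\<i> * complex_of_real (x \<bullet> v)) * expi (- k) x)) \<partial>lborel)" by simp
      also have "\<dots> \<le> (\<integral>x. norm v * ((1 + norm x) ^ 1 * cmod (w x)) \<partial>lborel)"
      proof (intro integral_mono integrable_norm iv integrable_mult_right M)
        fix x
        show "norm (w x * (- (\<i> * complex_of_real (x \<bullet> v)) * expi (- k) x))
          \<le> norm v * ((1 + norm x) ^ 1 * cmod (w x))"
          using mult_left_mono[OF CS[of x v] norm_ge_zero[of "w x"]] by (simp add: norm_mult abs_mult mult_ac)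
      qed
      finally show ?thesis by (simp add: M_def)
    qed
  qed
  have rem: "norm (FT w (k + v) - FT w k - ?D v) / norm v \<le> M 2 * norm v" for v
  proof (cases "v = 0")
    case False
    have "FT w (k + v) - FT w k - ?D v
        = (\<integral>x. w x * expi (- (k + v)) x - w x * expi (- k) x - w x * (- (\<i> * complex_of_real (x \<bullet> v)) * expi (- k) x) \<partial>lborel)"
      unfolding FT_def by (simp only: Bochner_Integration.integral_diff iw iv Bochner_Integration.integrable_diff)
    also have "norm \<dots> \<le> (\<integral>x. (norm v)\<^sup>2 * ((1 + norm x) ^ 2 * cmod (w x)) \<partial>lborel)"
    proof (rule order_trans[OF integral_norm_bound], intro integral_mono integrable_norm iw iv
        Bochner_Integration.integrable_diff integrable_mult_right M)
      fix x
      have "w x * expi (- (k + v)) x - w x * expi (- k) x - w x * (- (\<i> * complex_of_real (x \<bullet> v)) * expi (- k) x)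
          = w x * expi (- k) x * (exp (\<i> * complex_of_real (- (x \<bullet> v))) - 1 - \<i> * complex_of_real (- (x \<bullet> v)))"
        unfolding minus_add_distrib expi_add by (simp add: expi_def[of "- v"] inner_commute algebra_simps)
      then have "cmod (w x * expi (- (k + v)) x - w x * expi (- k) x - w x * (- (\<i> * complex_of_real (x \<bullet> v)) * expi (- k) x))
          = cmod (w x) * cmod (exp (\<i> * complex_of_real (- (x \<bullet> v))) - 1 - \<i> * complex_of_real (- (x \<bullet> v)))"
        by (simp only: norm_mult norm_expi mult_1_right)
      also have "\<dots> \<le> cmod (w x) * (- (x \<bullet> v))\<^sup>2"
        by (intro mult_left_mono norm_exp_i_taylor) simp
      also have "\<dots> \<le> cmod (w x) * ((1 + norm x) * norm v)\<^sup>2"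
      proof (rule mult_left_mono)
        have "\<bar>x \<bullet> v\<bar>\<^sup>2 \<le> ((1 + norm x) * norm v)\<^sup>2" by (intro power_mono CS) simp
        then show "(- (x \<bullet> v))\<^sup>2 \<le> ((1 + norm x) * norm v)\<^sup>2" by simp
      qed simp
      finally show "cmod (w x * expi (- (k + v)) x - w x * expi (- k) x - w x * (- (\<i> * complex_of_real (x \<bullet> v)) * expi (- k) x))
          \<le> (norm v)\<^sup>2 * ((1 + norm x) ^ 2 * cmod (w x))"
        by (simp only: power_mult_distrib mult_ac)
    qed
    also have "\<dots> = (norm v)\<^sup>2 * M 2" by (simp add: M_def)
    finally show ?thesis using False by (simp add: field_simps power2_eq_square)
  qed simp
  have "((\<lambda>v::real^'n. M 2 * norm v) \<longlongrightarrow> M 2 * norm (0::real^'n)) (at 0)"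
    by (rule tendsto_mult[OF tendsto_const tendsto_norm[OF tendsto_ident_at]])
  then have M0: "((\<lambda>v::real^'n. M 2 * norm v) \<longlongrightarrow> 0) (at 0)" by simp
  have "((\<lambda>v. norm (FT w (k + v) - FT w k - ?D v) / norm v) \<longlongrightarrow> 0) (at 0)"
  proof (rule Lim_null_comparison[OF _ M0])
    show "\<forall>\<^sub>F v in at 0. norm (norm (FT w (k + v) - FT w k - ?D v) / norm v) \<le> M 2 * norm v"
      using rem by (intro always_eventually allI) (simp only: real_norm_def abs_divide abs_norm_cancel)
  qed
  then show ?thesis unfolding has_derivative_at using lin by simp
qed

text \<open>A derivative in direction \<open>i\<close> multiplies \<open>w\<close> by
  \<open>- i x_i\<close>, which preserves rapid decay; so the transforms of rapid functions are
  closed under partial derivatives.\<close>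

lemma smooth_on_FT:
  fixes w :: "real^'n::finite \<Rightarrow> complex"
  assumes w: "rapid w" shows "smooth_on UNIV (FT w)"
proof (rule smooth_on_coinduct[where F = "{f. \<exists>w. rapid w \<and> f = FT w}"])
  fix f :: "real^'n \<Rightarrow> complex" assume "f \<in> {f. \<exists>w. rapid w \<and> f = FT w}"
  then obtain w where w: "rapid w" "f = FT w" by auto
  show "f differentiable at x" for x
    using has_derivative_FT[OF w(1)] w(2) differentiable_def by blast
  fix i
  have "rapid (\<lambda>x. - (moment [i] x * w x))"
    using rapid_moment[OF w(1), of "[i]"] by (auto simp: rapid_def)
  moreover have "partial_deriv i f k = FT (\<lambda>x. - (moment [i] x * w x)) k" for k
    unfolding w(2) partial_deriv_eq[OF has_derivative_FT[OF w(1)]]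
    unfolding FT_def moment_def by (simp add: inner_axis mult_ac)
  ultimately show "\<exists>g\<in>{f. \<exists>w. rapid w \<and> f = FT w}. \<forall>x\<in>UNIV. partial_deriv i f x = g x" by blast
qed (use w in auto)

section \<open>Localised Fourier transforms of distributions\<close>

text \<open>With the cutoff fixed, \<open>H\<close> ranges over smooth functions on the whole space,
  so that characters and their differences can be inserted. The compact set of the order bound is
  enlarged to a ball about \<open>0\<close>, where estimates of characters can use
  \<open>norm x <= R\<close>.\<close>

lemma cutoff_bound:
  fixes X :: "(real^'n::finite) set"
  assumes X: "open X" and u: "u \<in> distributions X" and \<rho>: "\<rho> \<in> test_functions X"
  shows "\<exists>m R C. 0 \<le> R \<and> 0 \<le> C \<and> (\<forall>H A. smooth_on UNIV H \<longrightarrow> 0 \<le> A \<longrightarrow>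
    deriv_bound m (cball 0 R) H A \<longrightarrow> cmod (u (\<lambda>x. \<rho> x * H x)) \<le> C * A)"
proof -
  define K where "K = supp \<rho>"
  have K: "compact K" "K \<subseteq> X" and \<rho>K: "\<rho> \<in> test_functions_in X K"
    using test_functions_supp[OF \<rho>] by (auto simp: K_def)
  have s\<rho>: "smooth_on UNIV \<rho>" by (rule test_functions_smooth[OF \<rho>])
  obtain m L C where L: "compact L" "L \<subseteq> X" "0 \<le> C"
    and C: "\<forall>\<phi>\<in>test_functions_in X K. \<forall>A\<ge>0. deriv_bound m L \<phi> A \<longrightarrow> cmod (u \<phi>) \<le> C * A"
    using distribution_bounded_on_compact[OF X u K] unfolding bounded_on_compact_def by auto
  obtain B where B: "0 \<le> B" "deriv_bound m L \<rho> B"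
    using deriv_bound_exists[OF s\<rho> L(1)] by auto
  obtain R0 where R0: "\<And>x. x \<in> L \<Longrightarrow> norm x \<le> R0" using compact_imp_bounded[OF L(1)] bounded_iff by metis
  define R where "R = \<bar>R0\<bar>"
  have LR: "L \<subseteq> cball 0 R" using R0 by (force simp: R_def)
  show ?thesis
  proof (rule exI[of _ m], rule exI[of _ R], rule exI[of _ "C * (2 ^ m * B)"], intro conjI allI impI)
    fix H :: "real^'n \<Rightarrow> complex" and A assume H: "smooth_on UNIV H" "0 \<le> A" "deriv_bound m (cball 0 R) H A"
    have "deriv_bound m L H A" using deriv_bound_mono[OF H(3) order_refl LR order_refl] .
    then have b: "deriv_bound m L (\<lambda>x. \<rho> x * H x) (2 ^ m * B * A)"
      by (intro deriv_bound_mult[OF open_UNIV subset_UNIV s\<rho> H(1) B(2) _ B(1) H(2)])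
    have "(\<lambda>x. \<rho> x * H x) \<in> test_functions_in X K"
      using \<rho>K smooth_on_mult[OF open_UNIV s\<rho> H(1)] by (auto simp: test_functions_in_iff[OF K])
    then have "cmod (u (\<lambda>x. \<rho> x * H x)) \<le> C * (2 ^ m * B * A)"
      using C b B(1) H(2) by simp
    then show "cmod (u (\<lambda>x. \<rho> x * H x)) \<le> C * (2 ^ m * B) * A" by (simp add: mult_ac)
  qed (use L(3) B(1) in \<open>auto simp: R_def\<close>)
qed

text \<open>Controls all derivatives up to order \<open>m\<close> of \<open>expi l - expi l'\<close>
  on the ball of radius \<open>R\<close>: one summand is the change of the symbol, the other the
  change of the character. It tends to \<open>0\<close> as \<open>l'\<close> approaches
  \<open>l\<close>, and grows polynomially in \<open>l\<close> as long as
  \<open>norm l' <= 2 * norm l\<close>; dominated convergence uses both.\<close>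

definition modulus :: "nat \<Rightarrow> real \<Rightarrow> real^'n::finite \<Rightarrow> real^'n \<Rightarrow> real" where
  "modulus m R l l' = (\<Sum>\<alpha>\<in>{\<alpha>. length \<alpha> \<le> m}.
     cmod (moment \<alpha> l - moment \<alpha> l') + (1 + norm l) ^ length \<alpha> * (norm (l - l') * R))"

lemma modulus_nonneg: "0 \<le> R \<Longrightarrow> 0 \<le> modulus m R l l'"
  unfolding modulus_def by (intro sum_nonneg add_nonneg_nonneg mult_nonneg_nonneg) auto

lemma moment_expi_diff:
  assumes "length \<alpha> \<le> m" "norm x \<le> R"
  shows "cmod (moment \<alpha> l * expi l x - moment \<alpha> l' * expi l' x) \<le> modulus m R l l'"
proof -
  have R: "0 \<le> R" using assms(2) norm_ge_zero order_trans by blast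
  have "moment \<alpha> l * expi l x - moment \<alpha> l' * expi l' x
      = (moment \<alpha> l - moment \<alpha> l') * expi l' x + moment \<alpha> l * (expi l x - expi l' x)"
    by (simp add: algebra_simps)
  also have "cmod \<dots> \<le> cmod (moment \<alpha> l - moment \<alpha> l') + cmod (moment \<alpha> l) * cmod (expi l x - expi l' x)"
    by (rule order_trans[OF norm_triangle_ineq]) (simp add: norm_mult)
  also have "cmod (moment \<alpha> l) * cmod (expi l x - expi l' x) \<le> (1 + norm l) ^ length \<alpha> * (norm (l - l') * R)"
    using assms(2) by (intro mult_mono norm_moment_le order_trans[OF norm_expi_diff] mult_left_mono) auto
  also have "cmod (moment \<alpha> l - moment \<alpha> l') + (1 + norm l) ^ length \<alpha> * (norm (l - l') * R) \<le> modulus m R l l'"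
    unfolding modulus_def using assms(1) R
    by (intro member_le_sum[where f = "\<lambda>\<alpha>. cmod (moment \<alpha> l - moment \<alpha> l') + (1 + norm l) ^ length \<alpha> * (norm (l - l') * R)"]
        finite_lists_bounded) auto
  finally show ?thesis by simp
qed

lemma tendsto_modulus:
  assumes "(f \<longlongrightarrow> l) F" shows "((\<lambda>t. modulus m R l (f t)) \<longlongrightarrow> 0) F"
proof -
  have "((\<lambda>t. moment \<alpha> (f t)) \<longlongrightarrow> moment \<alpha> l) F" for \<alpha>
    using continuous_on_tendsto_compose[OF continuous_on_moment[of UNIV] assms] by simp
  then have "((\<lambda>t. modulus m R l (f t)) \<longlongrightarrow> (\<Sum>\<alpha>\<in>{\<alpha>. length \<alpha> \<le> m}.
     cmod (moment \<alpha> l - moment \<alpha> l) + (1 + norm l) ^ length \<alpha> * (norm (l - l) * R))) F"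
    unfolding modulus_def by (intro tendsto_intros assms)
  then show ?thesis by simp
qed

lemma modulus_bound:
  assumes "norm l' \<le> 2 * norm l" "0 \<le> R"
  shows "modulus m R l l' \<le> real (card {\<alpha> :: 'n::finite list. length \<alpha> \<le> m}) * (1 + 2 ^ m + 3 * R) * (1 + norm (l :: real^'n)) ^ (m + 1)"
proof -
  define L where "L = 1 + norm l"
  have L: "1 \<le> L" by (simp add: L_def)
  have Lm: "1 \<le> L ^ m" using L by (rule one_le_power)
  have "cmod (moment \<alpha> l - moment \<alpha> l') + (1 + norm l) ^ length \<alpha> * (norm (l - l') * R)
      \<le> (1 + 2 ^ m + 3 * R) * L ^ (m + 1)" if \<alpha>: "length \<alpha> \<le> m" for \<alpha>
  proof -
    have 1: "L ^ length \<alpha> \<le> L ^ m" using L \<alpha> by (rule power_increasing[rotated])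
    have "cmod (moment \<alpha> l') \<le> (1 + norm l') ^ length \<alpha>" by (rule norm_moment_le)
    also have "\<dots> \<le> (2 * L) ^ length \<alpha>" using assms by (intro power_mono) (auto simp: L_def)
    also have "\<dots> \<le> (2 * L) ^ m" using L \<alpha> by (intro power_increasing) auto
    finally have 2: "cmod (moment \<alpha> l') \<le> 2 ^ m * L ^ m" by (simp add: power_mult_distrib)
    have 3: "cmod (moment \<alpha> l) \<le> L ^ m" using norm_moment_le[of \<alpha> l] 1 by (simp add: L_def)
    have "norm (l - l') \<le> 3 * L" using norm_triangle_ineq4[of l l'] assms by (simp add: L_def)
    then have "norm (l - l') * R \<le> 3 * L * R" using assms(2) by (rule mult_right_mono)
    then have 4: "L ^ length \<alpha> * (norm (l - l') * R) \<le> L ^ m * (3 * L * R)"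
      using 1 assms L by (intro mult_mono[OF 1]) auto
    have 5: "L ^ m \<le> L ^ (m + 1)" using L by (intro power_increasing) auto
    have "cmod (moment \<alpha> l - moment \<alpha> l') \<le> (1 + 2 ^ m) * L ^ m"
      using norm_triangle_ineq4[of "moment \<alpha> l" "moment \<alpha> l'"] 2 3 by (simp add: algebra_simps)
    also have "\<dots> \<le> (1 + 2 ^ m) * L ^ (m + 1)" using 5 by (intro mult_left_mono) auto
    finally show ?thesis using 4 by (simp add: algebra_simps L_def)
  qed
  then have "modulus m R l l' \<le> (\<Sum>\<alpha>\<in>{\<alpha> :: 'n list. length \<alpha> \<le> m}. (1 + 2 ^ m + 3 * R) * L ^ (m + 1))"
    unfolding modulus_def by (intro sum_mono) auto
  then show ?thesis by (simp add: L_def mult.assoc)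
qed

text \<open>The level sets of a simple function turn the integral into a finite combination of
  values of \<open>H\<close>. For characters this gives finite sums, through which a distribution
  passes by linearity alone.\<close>

lemma integral_simple_compose:
  fixes w :: "'a \<Rightarrow> complex" and H :: "'b \<Rightarrow> complex"
  assumes s: "simple_function M s" and w: "integrable M w"
  shows "(\<integral>l. w l * H (s l) \<partial>M) = (\<Sum>v\<in>s ` space M. (\<integral>l. w l * indicator (s -` {v} \<inter> space M) l \<partial>M) * H v)"
    and "integrable M (\<lambda>l. w l * H (s l))"
proof -
  have fin: "finite (s ` space M)" and ms: "s -` {v} \<inter> space M \<in> sets M" for v
    using simple_functionD[OF s] by auto
  have eq: "w l * H (s l) = (\<Sum>v\<in>s ` space M. w l * indicator (s -` {v} \<inter> space M) l * H v)" if "l \<in> space M" for l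
  proof -
    have "(\<Sum>v\<in>s ` space M. w l * indicator (s -` {v} \<inter> space M) l * H v)
        = (\<Sum>v\<in>s ` space M. if v = s l then w l * H v else 0)"
      using that by (intro sum.cong) (auto simp: indicator_def)
    then show ?thesis using that fin by simp
  qed
  have i: "integrable M (\<lambda>l. w l * indicator (s -` {v} \<inter> space M) l * H v)" for v
    by (intro integrable_mult_left integrable_mult_indicator[OF ms, of w, simplified scaleR_conv_of_real mult.commute] )
      (use integrable_mult_indicator[OF ms w] in \<open>auto simp: scaleR_conv_of_real mult.commute of_real_indicator\<close>)
  show "integrable M (\<lambda>l. w l * H (s l))"
    using Bochner_Integration.integrable_sum[of "s ` space M", OF i]
    by (subst Bochner_Integration.integrable_cong[OF refl eq]) auto
  have "(\<integral>l. w l * H (s l) \<partial>M) = (\<integral>l. (\<Sum>v\<in>s ` space M. w l * indicator (s -` {v} \<inter> space M) l * H v) \<partial>M)"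
    by (intro Bochner_Integration.integral_cong refl eq)
  also have "\<dots> = (\<Sum>v\<in>s ` space M. (\<integral>l. w l * indicator (s -` {v} \<inter> space M) l * H v \<partial>M))"
    by (intro Bochner_Integration.integral_sum i)
  finally show "(\<integral>l. w l * H (s l) \<partial>M)
      = (\<Sum>v\<in>s ` space M. (\<integral>l. w l * indicator (s -` {v} \<inter> space M) l \<partial>M) * H v)" by simp
qed

text \<open>The sign opposite to that of \<open>fourier_cutoff\<close>: in the inversion formula
  \<open>\<psi>\<close> is a superposition of the characters \<open>expi l\<close>, and these are
  what \<open>u\<close> is paired with.\<close>

definition modulated :: "((real^'n::finite \<Rightarrow> complex) \<Rightarrow> complex) \<Rightarrow> (real^'n \<Rightarrow> complex) \<Rightarrow> real^'n \<Rightarrow> complex" where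
  "modulated u \<rho> l = u (\<lambda>x. \<rho> x * expi l x)"

lemma fourier_cutoff_eq: "fourier_cutoff u \<rho> k = modulated u \<rho> (- k)"
  by (simp add: fourier_cutoff_def modulated_def expi_def)

lemma deriv_bound_expi: "deriv_bound m K (expi l) ((1 + norm l) ^ m)"
  unfolding deriv_bound_def
proof (intro ballI allI impI)
  fix x and \<alpha> :: "'a list" assume "length \<alpha> \<le> m"
  then have "(1 + norm l) ^ length \<alpha> \<le> (1 + norm l) ^ m" by (intro power_increasing) auto
  then show "cmod (partial_derivs \<alpha> (expi l) x) \<le> (1 + norm l) ^ m"
    using norm_moment_le[of \<alpha> l] by (simp add: partial_derivs_expi norm_mult)
qed

text \<open>An order bound sees finitely many derivatives of the character, and each of them costs
  at most one factor \<open>1 + norm l\<close>.\<close>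

lemma modulated_growth:
  assumes "open X" "u \<in> distributions X" "\<rho> \<in> test_functions X"
  obtains m C where "0 \<le> C" "\<And>l. cmod (modulated u \<rho> l) \<le> C * (1 + norm l) ^ m"
proof -
  obtain m R C where C: "0 \<le> R" "0 \<le> C"
    "\<forall>H A. smooth_on UNIV H \<longrightarrow> 0 \<le> A \<longrightarrow> deriv_bound m (cball 0 R) H A \<longrightarrow> cmod (u (\<lambda>x. \<rho> x * H x)) \<le> C * A"
    using cutoff_bound[OF assms] by (elim exE conjE)
  have "cmod (modulated u \<rho> l) \<le> C * (1 + norm l) ^ m" for l
    unfolding modulated_def by (intro C(3)[rule_format] smooth_on_expi deriv_bound_expi) auto
  with C(2) that show ?thesis by blast
qed

lemma modulated_diff:
  assumes X: "open X" and u: "u \<in> distributions X" and \<rho>: "\<rho> \<in> test_functions X"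
  shows "modulated u \<rho> l - modulated u \<rho> l' = u (\<lambda>x. \<rho> x * (expi l x - expi l' x))"
  unfolding modulated_def
  by (subst distribution_linear(3)[OF u, symmetric]) (auto intro!: test_functions_expi \<rho> simp: algebra_simps)

text \<open>The increments are bounded by \<open>modulus\<close>. Continuity supplies the
  measurability of the frequency integrals and the pointwise limits under them.\<close>

lemma continuous_modulated:
  assumes X: "open X" and u: "u \<in> distributions X" and \<rho>: "\<rho> \<in> test_functions X"
  shows "continuous_on UNIV (modulated u \<rho>)"
proof -
  obtain m R C where C: "0 \<le> R" "0 \<le> C"
    "\<forall>H A. smooth_on UNIV H \<longrightarrow> 0 \<le> A \<longrightarrow> deriv_bound m (cball 0 R) H A \<longrightarrow> cmod (u (\<lambda>x. \<rho> x * H x)) \<le> C * A"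
    using cutoff_bound[OF assms] by (elim exE conjE)
  have b: "cmod (modulated u \<rho> l - modulated u \<rho> l') \<le> C * modulus m R l l'" for l l'
    unfolding modulated_diff[OF assms]
  proof (intro C(3)[rule_format] smooth_on_diff smooth_on_expi modulus_nonneg C(1) open_UNIV)
    show "deriv_bound m (cball 0 R) (\<lambda>x. expi l x - expi l' x) (modulus m R l l')"
      unfolding deriv_bound_def
    proof (intro ballI allI impI)
      fix x :: "real^'a" and \<alpha> :: "'a list" assume "x \<in> cball 0 R" "length \<alpha> \<le> m"
      then show "cmod (partial_derivs \<alpha> (\<lambda>x. expi l x - expi l' x) x) \<le> modulus m R l l'"
        unfolding partial_derivs_diff[OF open_UNIV smooth_on_expi smooth_on_expi UNIV_I] partial_derivs_expi
        by (intro moment_expi_diff) auto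
    qed
  qed
  show ?thesis unfolding continuous_on
  proof
    fix l :: "real^'a"
    have "((\<lambda>l'. C * modulus m R l l') \<longlongrightarrow> 0) (at l)"
      by (intro tendsto_mult_right_zero tendsto_modulus tendsto_ident_at)
    moreover have "\<forall>\<^sub>F l' in at l. norm (modulated u \<rho> l' - modulated u \<rho> l) \<le> C * modulus m R l l'"
      using b[of l] by (intro always_eventually allI) (simp add: norm_minus_commute)
    ultimately have "((\<lambda>l'. modulated u \<rho> l' - modulated u \<rho> l) \<longlongrightarrow> 0) (at l)"
      by (rule Lim_null_comparison[rotated])
    then show "(modulated u \<rho> \<longlongrightarrow> modulated u \<rho> l) (at l within UNIV)"
      by (simp add: LIM_zero_iff)
  qed
qed

lemma measurable_moment [measurable]: "moment \<alpha> \<in> borel_measurable borel"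
  by (intro borel_measurable_continuous_onI continuous_on_moment)

text \<open>The inversion formula is inserted into the pairing by replacing the integral over \<open>l\<close> by
  finite sums: \<open>l\<close> is approximated by simple functions, which converge together with all
  \<open>x\<close>-derivatives, uniformly on compact sets of \<open>x\<close>.\<close>

lemma pairing_fourier:
  fixes X :: "(real^'n::finite) set"
  assumes X: "open X" and u: "u \<in> distributions X" and \<rho>: "\<rho> \<in> test_functions X"
    and \<psi>: "\<psi> \<in> test_functions Y"
    and inv: "\<forall>(g :: real^'n \<Rightarrow> complex) X x. g \<in> test_functions X \<longrightarrow> g x = c * (\<integral>k. FT g k * expi k x \<partial>lborel)"
  shows "u (\<lambda>x. \<rho> x * \<psi> x) = c * (\<integral>l. FT \<psi> l * modulated u \<rho> l \<partial>lborel)"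
proof -
  define w where "w l = c * FT \<psi> l" for l
  have "rapid (FT \<psi>)" by (rule rapid_FT[OF \<psi>])
  then have w: "rapid w"
    unfolding rapid_def w_def
  proof (elim conjE, intro conjI allI)
    fix N assume "\<forall>N. \<exists>C. \<forall>k. (1 + norm k) ^ N * cmod (FT \<psi> k) \<le> C"
    then obtain C where C: "\<And>k. (1 + norm k) ^ N * cmod (FT \<psi> k) \<le> C" by meson
    have "(1 + norm k) ^ N * cmod (c * FT \<psi> k) \<le> cmod c * C" for k
      using mult_left_mono[OF C[of k], of "cmod c"] by (simp add: norm_mult mult_ac)
    then show "\<exists>C. \<forall>k. (1 + norm k) ^ N * cmod (c * FT \<psi> k) \<le> C" by blast
  qed auto
  have [measurable]: "w \<in> borel_measurable borel" using w by (rule rapid_measurable)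
  have iw: "integrable lborel w" by (rule integrable_rapid[OF w])
  have W[measurable]: "modulated u \<rho> \<in> borel_measurable borel"
    by (intro borel_measurable_continuous_onI continuous_modulated[OF X u \<rho>])
  obtain m R C where C: "0 \<le> R" "0 \<le> C"
    "\<forall>H A. smooth_on UNIV H \<longrightarrow> 0 \<le> A \<longrightarrow> deriv_bound m (cball 0 R) H A \<longrightarrow> cmod (u (\<lambda>x. \<rho> x * H x)) \<le> C * A"
    using cutoff_bound[OF X u \<rho>] by (elim exE conjE)
  obtain m' C' where C': "0 \<le> C'" "\<And>l. cmod (modulated u \<rho> l) \<le> C' * (1 + norm l) ^ m'"
    using modulated_growth[OF X u \<rho>] by metis
  \<comment> \<open>The identity of frequency space as a pointwise limit of simple functions. The
    bound \<open>2 * norm l\<close> comes from approximating relative to the base point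
    \<open>0\<close>, and makes the dominating functions independent of \<open>j\<close>.\<close>
  obtain s :: "nat \<Rightarrow> real^'n \<Rightarrow> real^'n" where s: "\<And>j. simple_function lborel (s j)"
    "\<And>l. (\<lambda>j. s j l) \<longlonglongrightarrow> l" "\<And>j l. norm (s j l) \<le> 2 * norm l"
    using borel_measurable_implies_sequence_metric[of "\<lambda>x::real^'n. x" lborel 0] by auto
  have sm[measurable]: "s j \<in> borel_measurable borel" for j
    using borel_measurable_simple_function[OF s(1)] by simp
  \<comment> \<open>The mass of the amplitude \<open>w\<close> on a level set of \<open>s j\<close>;
    \<open>h j\<close> is the resulting finite sum of characters that approximates
    \<open>\<psi>\<close>.\<close>
  define \<gamma> where "\<gamma> j v = (\<integral>l. w l * indicator (s j -` {v} \<inter> space lborel) l \<partial>lborel)" for j v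
  define V where "V j = s j ` space lborel" for j
  define h where "h j x = (\<Sum>v\<in>V j. \<gamma> j v * expi v x)" for j x
  have sh: "smooth_on UNIV (h j)" for j
    unfolding h_def by (intro smooth_on_sum smooth_on_mult smooth_on_const smooth_on_expi open_UNIV)
  have s\<psi>: "smooth_on UNIV \<psi>" by (rule test_functions_smooth[OF \<psi>])
  have uh: "u (\<lambda>x. \<rho> x * h j x) = (\<integral>l. w l * modulated u \<rho> (s j l) \<partial>lborel)" for j
  proof -
    have "u (\<lambda>x. \<rho> x * h j x) = u (\<lambda>x. \<Sum>v\<in>V j. \<gamma> j v * (\<rho> x * expi v x))"
      by (simp add: h_def sum_distrib_left mult_ac)
    also have "\<dots> = (\<Sum>v\<in>V j. \<gamma> j v * modulated u \<rho> v)"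
      by (simp add: distribution_sum[OF u] distribution_linear(1)[OF u] test_functions_cmult
          test_functions_expi \<rho> modulated_def)
    also have "\<dots> = (\<integral>l. w l * modulated u \<rho> (s j l) \<partial>lborel)"
      unfolding integral_simple_compose(1)[OF s(1) iw] V_def \<gamma>_def ..
    finally show ?thesis .
  qed
  have lim1: "(\<lambda>j. \<integral>l. w l * modulated u \<rho> (s j l) \<partial>lborel) \<longlonglongrightarrow> (\<integral>l. w l * modulated u \<rho> l \<partial>lborel)"
  proof (rule integral_dominated_convergence[where w = "\<lambda>l. (C' * 2 ^ m') * ((1 + norm l) ^ m' * cmod (w l))"])
    show "AE l in lborel. (\<lambda>j. w l * modulated u \<rho> (s j l)) \<longlonglongrightarrow> w l * modulated u \<rho> l"
      using continuous_on_tendsto_compose[OF continuous_modulated[OF X u \<rho>] s(2)]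
      by (intro always_eventually allI tendsto_mult tendsto_const) auto
    show "AE l in lborel. norm (w l * modulated u \<rho> (s j l)) \<le> (C' * 2 ^ m') * ((1 + norm l) ^ m' * cmod (w l))" for j
    proof (intro always_eventually allI)
      fix l
      have "cmod (modulated u \<rho> (s j l)) \<le> C' * (1 + norm (s j l)) ^ m'" by (rule C')
      also have "\<dots> \<le> C' * (2 * (1 + norm l)) ^ m'"
        using s(3)[of j l] C'(1) by (intro mult_left_mono power_mono) auto
      also have "\<dots> = C' * 2 ^ m' * (1 + norm l) ^ m'" by (simp only: power_mult_distrib mult.assoc)
      finally have "cmod (w l) * cmod (modulated u \<rho> (s j l)) \<le> cmod (w l) * (C' * 2 ^ m' * (1 + norm l) ^ m')"
        by (rule mult_left_mono) simp
      then show "norm (w l * modulated u \<rho> (s j l)) \<le> (C' * 2 ^ m') * ((1 + norm l) ^ m' * cmod (w l))"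
        by (simp add: norm_mult mult_ac)
    qed
    show "integrable lborel (\<lambda>l. (C' * 2 ^ m') * ((1 + norm l) ^ m' * cmod (w l)))"
      by (intro integrable_mult_right integrable_rapid_weight[OF w])
  qed measurable
  \<comment> \<open>Bounds every derivative of \<open>\<psi> - h j\<close> up to order
    \<open>m\<close> on the ball, because differentiating a character only inserts its symbol under
    the integral. The order bound for \<open>u\<close> then makes the pairings converge as
    \<open>\<delta>\<close> tends to \<open>0\<close>.\<close>
  define \<delta> where "\<delta> j = (\<integral>l. cmod (w l) * modulus m R l (s j l) \<partial>lborel)" for j
  define D where "D = real (card {\<alpha> :: 'n list. length \<alpha> \<le> m}) * (1 + 2 ^ m + 3 * R)"
  have mod_meas[measurable]: "(\<lambda>l. modulus m R l (s j l)) \<in> borel_measurable borel" for j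
    unfolding modulus_def by measurable
  have dom: "norm (cmod (w l) * modulus m R l (s j l)) \<le> D * ((1 + norm l) ^ (m + 1) * cmod (w l))" for j l
    using mult_left_mono[OF modulus_bound[OF s(3)[of j l] C(1), of m] norm_ge_zero[of "w l"]]
      modulus_nonneg[OF C(1), of m l "s j l"] by (simp add: D_def abs_mult mult_ac)
  have iD: "integrable lborel (\<lambda>l. D * ((1 + norm l) ^ (m + 1) * cmod (w l)))"
    by (intro integrable_mult_right integrable_rapid_weight[OF w])
  have imod: "integrable lborel (\<lambda>l. cmod (w l) * modulus m R l (s j l))" for j
    by (rule Bochner_Integration.integrable_bound[OF iD])
      (use dom[of _ j] in \<open>auto intro!: always_eventually intro: order_trans[OF _ abs_ge_self]\<close>)
  have "\<delta> \<longlonglongrightarrow> (\<integral>l. 0 \<partial>(lborel :: (real^'n) measure))"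
    unfolding \<delta>_def
  proof (rule integral_dominated_convergence[OF _ _ iD])
    show "AE l in lborel. (\<lambda>j. cmod (w l) * modulus m R l (s j l)) \<longlonglongrightarrow> 0"
      using tendsto_mult_right_zero[OF tendsto_modulus[OF s(2)]] by (intro always_eventually allI) blast
    show "AE l in lborel. norm (cmod (w l) * modulus m R l (s j l)) \<le> D * ((1 + norm l) ^ (m + 1) * cmod (w l))" for j
      using dom by (intro always_eventually allI)
  qed auto
  then have \<delta>0: "\<delta> \<longlonglongrightarrow> 0" by simp
  have db: "deriv_bound m (cball 0 R) (\<lambda>x. \<psi> x - h j x) (\<delta> j)" for j
    unfolding deriv_bound_def
  proof (intro ballI allI impI)
    fix x :: "real^'n" and \<alpha> :: "'n list" assume x: "x \<in> cball 0 R" and \<alpha>: "length \<alpha> \<le> m"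
    have i1: "integrable lborel (\<lambda>l. w l * (moment \<alpha> l * expi l x))"
    proof -
      have "integrable lborel (\<lambda>l. moment \<alpha> l * w l)" by (rule integrable_rapid[OF rapid_moment[OF w]])
      from integrable_expi[OF this, of x] show ?thesis by (simp add: expi_commute[of x] mult_ac)
    qed
    note i2 = integral_simple_compose(2)[OF s(1) iw, where H = "\<lambda>v. moment \<alpha> v * expi v x"]
    have "partial_derivs \<alpha> \<psi> x = (\<integral>l. w l * (moment \<alpha> l * expi l x) \<partial>lborel)"
      unfolding inv[rule_format, OF test_functions_partial_derivs[OF \<psi>], of \<alpha> x] FT_partial_derivs[OF \<psi>] w_def
      by (simp add: mult_ac flip: integral_mult_right_zero)
    moreover have "partial_derivs \<alpha> (h j) x = (\<integral>l. w l * (moment \<alpha> (s j l) * expi (s j l) x) \<partial>lborel)"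
      unfolding integral_simple_compose(1)[OF s(1) iw, where H = "\<lambda>v. moment \<alpha> v * expi v x"]
        V_def[symmetric] \<gamma>_def[symmetric] h_def
      by (simp add: partial_derivs_sum[OF open_UNIV] smooth_on_mult smooth_on_expi
          partial_derivs_cmult[OF open_UNIV smooth_on_expi] partial_derivs_expi)
    ultimately have "partial_derivs \<alpha> (\<lambda>x. \<psi> x - h j x) x
        = (\<integral>l. w l * (moment \<alpha> l * expi l x) - w l * (moment \<alpha> (s j l) * expi (s j l) x) \<partial>lborel)"
      using i1 i2[of j] by (simp add: partial_derivs_diff[OF open_UNIV s\<psi> sh])
    also have "cmod \<dots> \<le> \<delta> j"
      unfolding \<delta>_def
    proof (rule order_trans[OF integral_norm_bound], intro integral_mono integrable_norm
        Bochner_Integration.integrable_diff i1 i2 imod)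
      fix l
      have "cmod (moment \<alpha> l * expi l x - moment \<alpha> (s j l) * expi (s j l) x) \<le> modulus m R l (s j l)"
        using x by (intro moment_expi_diff \<alpha>) auto
      then show "cmod (w l * (moment \<alpha> l * expi l x) - w l * (moment \<alpha> (s j l) * expi (s j l) x))
          \<le> cmod (w l) * modulus m R l (s j l)"
        by (simp add: norm_mult mult_left_mono flip: right_diff_distrib)
    qed
    finally show "cmod (partial_derivs \<alpha> (\<lambda>x. \<psi> x - h j x) x) \<le> \<delta> j" .
  qed
  have \<delta>nn: "0 \<le> \<delta> j" for j
    unfolding \<delta>_def by (intro integral_nonneg_AE always_eventually allI mult_nonneg_nonneg modulus_nonneg C(1)) auto
  have t: "(\<lambda>x. \<rho> x * H x) \<in> test_functions X" if "smooth_on UNIV H" for H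
    by (intro test_functions_mult_right[OF X _ \<rho>] smooth_on_subset[OF that]) auto
  have d\<delta>: "cmod (u (\<lambda>x. \<rho> x * h j x) - u (\<lambda>x. \<rho> x * \<psi> x)) \<le> C * \<delta> j" for j
  proof -
    have "cmod (u (\<lambda>x. \<rho> x * (\<psi> x - h j x))) \<le> C * \<delta> j"
      by (intro C(3)[rule_format] smooth_on_diff s\<psi> sh open_UNIV db \<delta>nn)
    moreover have "u (\<lambda>x. \<rho> x * (\<psi> x - h j x)) = u (\<lambda>x. \<rho> x * \<psi> x) - u (\<lambda>x. \<rho> x * h j x)"
      using distribution_linear(3)[OF u t[OF s\<psi>] t[OF sh[of j]]] by (simp add: right_diff_distrib)
    ultimately show ?thesis by (simp add: norm_minus_commute)
  qed
  have "(\<lambda>j. u (\<lambda>x. \<rho> x * h j x) - u (\<lambda>x. \<rho> x * \<psi> x)) \<longlonglongrightarrow> 0"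
    by (rule Lim_null_comparison[OF _ tendsto_mult_right_zero[OF \<delta>0, of C]])
      (use d\<delta> in \<open>intro always_eventually allI\<close>)
  then have "(\<lambda>j. u (\<lambda>x. \<rho> x * h j x)) \<longlonglongrightarrow> u (\<lambda>x. \<rho> x * \<psi> x)"
    by (simp add: LIM_zero_iff)
  then have "u (\<lambda>x. \<rho> x * \<psi> x) = (\<integral>l. w l * modulated u \<rho> l \<partial>lborel)"
    using lim1 unfolding uh by (rule LIMSEQ_unique)
  then show ?thesis by (simp add: w_def mult.assoc)
qed

section \<open>Distributions with empty wave front set\<close>

lemma FT_modulate: "FT (\<lambda>x. g x * expi (- k) x) l = FT g (l + k)"
  unfolding FT_def minus_add_distrib expi_add by (simp add: mult_ac)

text \<open>The character is absorbed into the test function: modulating \<open>\<psi>\<close>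
  translates its transform, and a shift of the integration variable turns the pairing formula into a
  convolution.\<close>

lemma fourier_cutoff_mult:
  fixes X :: "(real^'n::finite) set"
  assumes X: "open X" and u: "u \<in> distributions X" and \<rho>: "\<rho> \<in> test_functions X"
    and \<psi>: "\<psi> \<in> test_functions Y"
    and c: "\<forall>(g :: real^'n \<Rightarrow> complex) X x. g \<in> test_functions X \<longrightarrow> g x = c * (\<integral>k. FT g k * expi k x \<partial>lborel)"
  shows "fourier_cutoff u (\<lambda>x. \<rho> x * \<psi> x) k = c * (\<integral>l. FT \<psi> l * fourier_cutoff u \<rho> (k - l) \<partial>lborel)"
proof -
  have [measurable]: "modulated u \<rho> \<in> borel_measurable borel" "FT \<psi> \<in> borel_measurable borel"
    using rapid_measurable[OF rapid_FT[OF \<psi>]]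
    by (auto intro!: borel_measurable_continuous_onI continuous_modulated[OF X u \<rho>])
  have "fourier_cutoff u (\<lambda>x. \<rho> x * \<psi> x) k = u (\<lambda>x. \<rho> x * (\<psi> x * expi (- k) x))"
    by (simp add: fourier_cutoff_eq modulated_def mult.assoc)
  also have "\<dots> = c * (\<integral>l. FT \<psi> (l + k) * modulated u \<rho> l \<partial>lborel)"
    using pairing_fourier[OF X u \<rho> test_functions_expi[OF \<psi>, of "- k"] c] by (simp add: FT_modulate)
  also have "(\<integral>l. FT \<psi> (l + k) * modulated u \<rho> l \<partial>lborel) = (\<integral>l. FT \<psi> l * modulated u \<rho> (l - k) \<partial>lborel)"
    using lborel_integral_translate[of "\<lambda>l. FT \<psi> l * modulated u \<rho> (l - k)" k] by simp
  finally show ?thesis by (simp add: fourier_cutoff_eq)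
qed

text \<open>The convolution formula is split according to \<open>|l| < t\<delta>/2\<close>, where \<open>t\<kappa> - l\<close> stays in \<open>V\<close>, and
  \<open>|l| \<ge> t\<delta>/2\<close>, where the rapid decay of \<open>FT \<psi>\<close> beats the polynomial growth of the other factor.\<close>

lemma conic_decay_mult:
  fixes X :: "(real^'n::finite) set"
  assumes X: "open X" and u: "u \<in> distributions X" and \<rho>: "\<rho> \<in> test_functions X"
    and \<psi>: "\<psi> \<in> test_functions Y"
    and V: "cone V" "ball k0 \<delta> \<subseteq> V" "0 < \<delta>"
    and decay: "\<forall>N. \<exists>C. \<forall>k\<in>V. (1 + norm k) ^ N * cmod (fourier_cutoff u \<rho> k) \<le> C"
  shows "\<exists>C. \<forall>t\<ge>0. \<forall>\<kappa>\<in>ball k0 (\<delta> / 2).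
    (1 + norm (t *\<^sub>R \<kappa>)) ^ N * cmod (fourier_cutoff u (\<lambda>x. \<rho> x * \<psi> x) (t *\<^sub>R \<kappa>)) \<le> C"
proof -
  obtain c :: complex where c: "\<forall>(g :: real^'n \<Rightarrow> complex) X x. g \<in> test_functions X \<longrightarrow>
       g x = c * (\<integral>k. FT g k * expi k x \<partial>lborel)"
    using fourier_inversion by blast
  let ?w = "fourier_cutoff u \<rho>"
  obtain m A where A: "0 \<le> A" "\<And>l. cmod (modulated u \<rho> l) \<le> A * (1 + norm l) ^ m"
    using modulated_growth[OF X u \<rho>] by metis
  have wA: "cmod (?w k) \<le> A * (1 + norm k) ^ m" for k
    using A(2)[of "- k"] by (simp add: fourier_cutoff_eq)
  obtain B0 where "\<forall>k\<in>V. (1 + norm k) ^ N * cmod (?w k) \<le> B0" using decay by blast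
  then have B: "(1 + norm k) ^ N * cmod (?w k) \<le> \<bar>B0\<bar>" if "k \<in> V" for k using that by force
  \<comment> \<open>Chosen for large \<open>l\<close>: there
    \<open>t <= 2 * norm l / \<delta>\<close>, so that
    \<open>1 + norm (t *\<^sub>R \<kappa>)\<close> is at most
    \<open>E * (1 + norm l)\<close>.\<close>
  define E where "E = 1 + 2 * (norm k0 + \<delta>) / \<delta>"
  have E: "1 \<le> E" using V(3) by (simp add: E_def)
  define D where "D = \<bar>B0\<bar> + A * E ^ (N + m)"
  \<comment> \<open>For large \<open>l\<close>, an exponent \<open>N + m\<close> arises from trading
    powers of \<open>1 + norm (t *\<^sub>R \<kappa>)\<close> for powers of
    \<open>1 + norm l\<close>, and another \<open>m\<close> from bounding
    \<open>1 + norm (t *\<^sub>R \<kappa> - l)\<close> by a product.\<close>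
  define M where "M = N + 2 * m"
  have pw: "(1 + norm (t *\<^sub>R \<kappa>)) ^ N * cmod (?w (t *\<^sub>R \<kappa> - l)) \<le> D * (1 + norm l) ^ M"
    if t: "0 \<le> t" and \<kappa>: "\<kappa> \<in> ball k0 (\<delta> / 2)" for t \<kappa> l
  proof -
    let ?k = "t *\<^sub>R \<kappa>"
    have L1: "1 \<le> 1 + norm l" by simp
    have nonneg: "0 \<le> A * E ^ (N + m)" using A(1) E by simp
    show ?thesis
    proof (cases "norm l < t * \<delta> / 2")
      case True
      then have tpos: "0 < t" using t V(3) norm_ge_zero[of l] by (cases "t = 0") auto
      \<comment> \<open>After division by \<open>t\<close> the point lies in the ball about
        \<open>k0\<close>, half of the radius being left for \<open>l / t\<close>; the cone property
        scales it back.\<close>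
      have "dist k0 (\<kappa> - (1 / t) *\<^sub>R l) < \<delta>"
      proof -
        have "norm ((1 / t) *\<^sub>R l) < \<delta> / 2" using True tpos by (simp add: field_simps)
        moreover have "norm (k0 - \<kappa>) < \<delta> / 2" using \<kappa> by (simp add: dist_norm)
        ultimately have "norm ((k0 - \<kappa>) + (1 / t) *\<^sub>R l) < \<delta>"
          using norm_triangle_ineq[of "k0 - \<kappa>" "(1 / t) *\<^sub>R l"] by linarith
        then show ?thesis by (simp add: dist_norm algebra_simps)
      qed
      then have "\<kappa> - (1 / t) *\<^sub>R l \<in> V" using V(2) by auto
      then have "t *\<^sub>R (\<kappa> - (1 / t) *\<^sub>R l) \<in> V" using V(1) t unfolding cone_def by blast
      then have kV: "?k - l \<in> V" using tpos by (simp add: scaleR_diff_right)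
      have "1 + norm ?k \<le> (1 + norm (?k - l)) * (1 + norm l)"
        using norm_triangle_sub[of ?k l] mult_nonneg_nonneg[OF norm_ge_zero[of "?k - l"] norm_ge_zero[of l]]
        unfolding ring_distribs mult_1_left mult_1_right by linarith
      then have "(1 + norm ?k) ^ N \<le> ((1 + norm (?k - l)) * (1 + norm l)) ^ N" by (intro power_mono) auto
      then have "(1 + norm ?k) ^ N * cmod (?w (?k - l))
          \<le> ((1 + norm (?k - l)) * (1 + norm l)) ^ N * cmod (?w (?k - l))"
        by (rule mult_right_mono) simp
      also have "\<dots> = ((1 + norm (?k - l)) ^ N * cmod (?w (?k - l))) * (1 + norm l) ^ N"
        by (simp only: power_mult_distrib mult_ac)
      also have "\<dots> \<le> \<bar>B0\<bar> * (1 + norm l) ^ N" by (intro mult_right_mono B kV) auto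
      also have "\<dots> \<le> D * (1 + norm l) ^ M"
        using nonneg by (intro mult_mono power_increasing) (auto simp: D_def M_def)
      finally show ?thesis .
    next
      case False
      have "norm \<kappa> \<le> norm k0 + \<delta>"
        using \<kappa> norm_triangle_ineq2[of \<kappa> k0] V(3) by (auto simp: dist_norm norm_minus_commute)
      then have "norm ?k \<le> t * (norm k0 + \<delta>)" using t by (simp add: mult_left_mono)
      also have "\<dots> \<le> (2 * norm l / \<delta>) * (norm k0 + \<delta>)"
        using False V(3) by (intro mult_right_mono) (auto simp: field_simps)
      also have "\<dots> \<le> (E - 1) * (1 + norm l)"
        using V(3) by (simp add: E_def field_simps)
      finally have k: "1 + norm ?k \<le> E * (1 + norm l)"
        using norm_ge_zero[of l] unfolding left_diff_distrib ring_distribs mult_1_left mult_1_right by linarith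
      have "1 + norm (?k - l) \<le> (1 + norm ?k) * (1 + norm l)"
        using norm_triangle_ineq4[of ?k l] mult_nonneg_nonneg[OF norm_ge_zero[of ?k] norm_ge_zero[of l]]
        unfolding ring_distribs mult_1_left mult_1_right by linarith
      then have "(1 + norm (?k - l)) ^ m \<le> ((1 + norm ?k) * (1 + norm l)) ^ m" by (intro power_mono) auto
      then have "cmod (?w (?k - l)) \<le> A * ((1 + norm ?k) * (1 + norm l)) ^ m"
        using wA[of "?k - l"] A(1) by (meson mult_left_mono order_trans)
      then have "(1 + norm ?k) ^ N * cmod (?w (?k - l)) \<le> (1 + norm ?k) ^ N * (A * ((1 + norm ?k) * (1 + norm l)) ^ m)"
        by (intro mult_left_mono) auto
      also have "\<dots> = A * (1 + norm ?k) ^ (N + m) * (1 + norm l) ^ m"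
        by (simp add: power_mult_distrib power_add mult_ac)
      also have "\<dots> \<le> A * (E * (1 + norm l)) ^ (N + m) * (1 + norm l) ^ m"
        using k A(1) by (intro mult_right_mono mult_left_mono power_mono) auto
      also have "\<dots> = A * E ^ (N + m) * (1 + norm l) ^ M"
        unfolding M_def mult_2 by (simp only: power_mult_distrib power_add mult_ac)
      also have "\<dots> \<le> D * (1 + norm l) ^ M"
        by (intro mult_right_mono) (auto simp: D_def)
      finally show ?thesis .
    qed
  qed
  have [measurable]: "modulated u \<rho> \<in> borel_measurable borel" "FT \<psi> \<in> borel_measurable borel"
    using rapid_measurable[OF rapid_FT[OF \<psi>]]
    by (auto intro!: borel_measurable_continuous_onI continuous_modulated[OF X u \<rho>])
  then have [measurable]: "?w \<in> borel_measurable borel" unfolding fourier_cutoff_eq[abs_def] by measurable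
  have iF: "integrable lborel (\<lambda>l. D * ((1 + norm l) ^ M * cmod (FT \<psi> l)))"
    by (intro integrable_mult_right integrable_rapid_weight[OF rapid_FT[OF \<psi>]])
  show ?thesis
  proof (intro exI allI impI ballI)
    fix t :: real and \<kappa> assume t: "0 \<le> t" and \<kappa>: "\<kappa> \<in> ball k0 (\<delta> / 2)"
    let ?k = "t *\<^sub>R \<kappa>" let ?p = "complex_of_real ((1 + norm ?k) ^ N)"
    have p: "cmod ?p = (1 + norm ?k) ^ N" by (simp only: norm_of_real) simp
    have b: "cmod (?p * (FT \<psi> l * ?w (?k - l))) \<le> D * ((1 + norm l) ^ M * cmod (FT \<psi> l))" for l
      using mult_left_mono[OF pw[OF t \<kappa>, of l] norm_ge_zero[of "FT \<psi> l"]]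
      unfolding norm_mult p by (simp only: mult_ac)
    have i: "integrable lborel (\<lambda>l. ?p * (FT \<psi> l * ?w (?k - l)))"
      by (rule Bochner_Integration.integrable_bound[OF iF])
        (use b in \<open>auto intro!: always_eventually intro: order_trans[OF _ abs_ge_self]\<close>)
    have "(1 + norm ?k) ^ N * cmod (fourier_cutoff u (\<lambda>x. \<rho> x * \<psi> x) ?k)
        = cmod (c * (\<integral>l. ?p * (FT \<psi> l * ?w (?k - l)) \<partial>lborel))"
      unfolding fourier_cutoff_mult[OF X u \<rho> \<psi> c] integral_mult_right_zero norm_mult p by (simp only: mult_ac)
    also have "\<dots> \<le> cmod c * (\<integral>l. D * ((1 + norm l) ^ M * cmod (FT \<psi> l)) \<partial>lborel)"
      unfolding norm_mult[of c]
      by (intro mult_left_mono order_trans[OF integral_norm_bound] integral_mono integrable_norm i iF b) auto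
    finally show "(1 + norm ?k) ^ N * cmod (fourier_cutoff u (\<lambda>x. \<rho> x * \<psi> x) ?k)
        \<le> cmod c * (\<integral>l. D * ((1 + norm l) ^ M * cmod (FT \<psi> l)) \<partial>lborel)" .
  qed
qed

text \<open>Fubini moves the transform from \<open>\<psi>\<close> to the rapid function
  \<open>modulated u \<rho>\<close>; the transform of the latter is smooth and serves as
  density.\<close>

lemma smooth_representative:
  fixes X :: "(real^'n::finite) set"
  assumes X: "open X" and u: "u \<in> distributions X" and \<rho>: "\<rho> \<in> test_functions X"
    and w: "rapid (modulated u \<rho>)"
  shows "\<exists>f. smooth_on UNIV f \<and> (\<forall>\<psi>\<in>test_functions X. u (\<lambda>x. \<rho> x * \<psi> x) = (\<integral>x. f x * \<psi> x \<partial>lborel))"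
proof -
  obtain c :: complex where c: "\<forall>(g :: real^'n \<Rightarrow> complex) X x. g \<in> test_functions X \<longrightarrow>
       g x = c * (\<integral>k. FT g k * expi k x \<partial>lborel)"
    using fourier_inversion by blast
  let ?W = "modulated u \<rho>"
  have "u (\<lambda>x. \<rho> x * \<psi> x) = (\<integral>x. c * FT ?W x * \<psi> x \<partial>lborel)" if \<psi>: "\<psi> \<in> test_functions X" for \<psi>
  proof -
    have "(\<integral>x. c * FT ?W x * \<psi> x \<partial>lborel) = c * (\<integral>x. FT ?W x * \<psi> x \<partial>lborel)"
      by (simp add: mult.assoc)
    also have "(\<integral>x. FT ?W x * \<psi> x \<partial>lborel) = (\<integral>l. ?W l * (\<integral>x. \<psi> x * expi (- x) l \<partial>lborel) \<partial>lborel)"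
      unfolding FT_def using integrable_rapid[OF w] integrable_test_function[OF \<psi>]
      by (rule integral_swap_bounded_kernel) (auto intro!: continuous_intros)
    also have "\<dots> = (\<integral>l. FT \<psi> l * ?W l \<partial>lborel)"
      unfolding FT_def expi_minus_left by (simp add: expi_commute mult.commute)
    finally show ?thesis using pairing_fourier[OF X u \<rho> \<psi> c] by simp
  qed
  moreover have "smooth_on UNIV (\<lambda>x. c * FT ?W x)"
    by (intro smooth_on_mult smooth_on_const smooth_on_FT w open_UNIV)
  ultimately show ?thesis by blast
qed

lemma rapid_modulated_local:
  fixes X :: "(real^'n::finite) set"
  assumes X: "open X" and u: "u \<in> distributions X" and wf: "wave_front_set X u = {}" and x0: "x0 \<in> X"
  shows "\<exists>\<rho>\<in>test_functions X. \<rho> x0 \<noteq> 0 \<and> rapid (modulated u \<rho>)"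
proof -
  define P where "P k r d \<longleftrightarrow> r \<in> test_functions X \<and> r x0 \<noteq> 0 \<and> 0 < d \<and> (\<exists>V. cone V \<and> ball k d \<subseteq> V \<and>
      (\<forall>N. \<exists>C. \<forall>k\<in>V. (1 + norm k) ^ N * cmod (fourier_cutoff u r k) \<le> C))" for k r d
  have "\<exists>r d. P k r d" if k: "k \<in> sphere 0 1" for k
  proof -
    have "(x0, k) \<notin> wave_front_set X u" "k \<noteq> 0" using wf k by auto
    then obtain r V where r: "r \<in> test_functions X" "r x0 \<noteq> 0" "cone V" "k \<in> interior V"
      "\<forall>N. conic_seminorm N V r u < \<infinity>"
      using x0 unfolding wave_front_set_def by auto
    obtain d where d: "0 < d" "ball k d \<subseteq> V" using r(4) mem_interior by blast
    have "\<exists>C. \<forall>k\<in>V. (1 + norm k) ^ N * cmod (fourier_cutoff u r k) \<le> C" for N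
    proof -
      have "conic_seminorm N V r u < \<infinity>" using r(5) by blast
      then obtain C where C: "0 \<le> C" "conic_seminorm N V r u = ennreal C"
        by (cases "conic_seminorm N V r u" rule: ennreal_cases) auto
      have "(1 + norm k) ^ N * cmod (fourier_cutoff u r k) \<le> C" if "k \<in> V" for k
      proof -
        have "ennreal ((1 + norm k) ^ N * cmod (fourier_cutoff u r k)) \<le> ennreal C"
          unfolding C(2)[symmetric] conic_seminorm_def using that by (rule SUP_upper)
        then show ?thesis using C(1) by simp
      qed
      then show ?thesis by blast
    qed
    then show ?thesis unfolding P_def using r d by blast
  qed
  then obtain r d where rd: "\<And>k. k \<in> sphere 0 1 \<Longrightarrow> P k (r k) (d k)" by metis
  \<comment> \<open>Balls of half the radius, since multiplication by a further cutoff preserves the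
    decay only on the smaller ball. Unit vectors suffice because the decay is along whole
    rays.\<close>
  have "sphere 0 1 \<subseteq> (\<Union>k\<in>sphere 0 1. ball k (d k / 2))" using rd by (force simp: P_def)
  then obtain T where T: "T \<subseteq> sphere 0 1" "finite T" "sphere 0 1 \<subseteq> (\<Union>k\<in>T. ball k (d k / 2))"
    by (rule compactE_image[OF compact_sphere, rotated]) auto
  obtain \<eta> :: "real^'n \<Rightarrow> real" and R where \<eta>: "0 < R"
    "(\<lambda>x. complex_of_real (\<eta> x)) \<in> test_functions X" "\<And>x. x \<in> cball x0 R \<Longrightarrow> \<eta> x = 1"
    using test_cutoff_exists[OF X x0] by metis
  note mult = test_functions_mult[OF X]
  \<comment> \<open>The product of the selected cutoffs with a bump that starts the induction. The
    factorisation through each \<open>r k\<close> is carried along because the decay around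
    \<open>k\<close> is known for \<open>r k\<close> and is inherited by its multiples.\<close>
  have "\<exists>\<rho>\<in>test_functions X. \<rho> x0 \<noteq> 0 \<and> (\<forall>k\<in>T. \<exists>\<psi>\<in>test_functions X. \<rho> = (\<lambda>x. r k x * \<psi> x))"
    using T(2,1)
  proof (induction T)
    case empty
    show ?case using \<eta> by (intro bexI[of _ "\<lambda>x. complex_of_real (\<eta> x)"]) auto
  next
    case (insert k T)
    then obtain \<rho> where \<rho>: "\<rho> \<in> test_functions X" "\<rho> x0 \<noteq> 0"
      "\<forall>k\<in>T. \<exists>\<psi>\<in>test_functions X. \<rho> = (\<lambda>x. r k x * \<psi> x)" by auto
    have rk: "r k \<in> test_functions X" "r k x0 \<noteq> 0" using rd[of k] insert.prems by (auto simp: P_def)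
    show ?case
    proof (rule bexI[of _ "\<lambda>x. r k x * \<rho> x"], intro conjI ballI)
      show "(\<lambda>x. r k x * \<rho> x) \<in> test_functions X" by (rule mult[OF rk(1) \<rho>(1)])
      show "r k x0 * \<rho> x0 \<noteq> 0" using rk \<rho> by simp
      fix k' assume k': "k' \<in> insert k T"
      show "\<exists>\<psi>\<in>test_functions X. (\<lambda>x. r k x * \<rho> x) = (\<lambda>x. r k' x * \<psi> x)"
      proof (cases "k' = k")
        case True
        then show ?thesis using \<rho>(1) by auto
      next
        case False
        then obtain \<psi> where \<psi>: "\<psi> \<in> test_functions X" "\<rho> = (\<lambda>x. r k' x * \<psi> x)" using \<rho>(3) k' by auto
        then show ?thesis
          by (intro bexI[of _ "\<lambda>x. r k x * \<psi> x"] mult rk) (auto simp: mult_ac)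
      qed
    qed
  qed
  then obtain \<rho> where \<rho>: "\<rho> \<in> test_functions X" "\<rho> x0 \<noteq> 0"
    "\<forall>k\<in>T. \<exists>\<psi>\<in>test_functions X. \<rho> = (\<lambda>x. r k x * \<psi> x)" by auto
  have "rapid (modulated u \<rho>)"
    unfolding rapid_def
  proof (intro conjI allI)
    show "modulated u \<rho> \<in> borel_measurable borel"
      by (intro borel_measurable_continuous_onI continuous_modulated[OF X u \<rho>(1)])
    fix N
    have "\<exists>C. \<forall>t\<ge>0. \<forall>\<kappa>\<in>ball k (d k / 2). (1 + norm (t *\<^sub>R \<kappa>)) ^ N * cmod (fourier_cutoff u \<rho> (t *\<^sub>R \<kappa>)) \<le> C"
      if k: "k \<in> T" for k
    proof -
      have "P k (r k) (d k)" using rd T(1) k by blast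
      then obtain V where V: "r k \<in> test_functions X" "0 < d k" "cone V" "ball k (d k) \<subseteq> V"
        "\<forall>N. \<exists>C. \<forall>k'\<in>V. (1 + norm k') ^ N * cmod (fourier_cutoff u (r k) k') \<le> C"
        unfolding P_def by blast
      obtain \<psi> where \<psi>: "\<psi> \<in> test_functions X" "\<rho> = (\<lambda>x. r k x * \<psi> x)" using \<rho>(3) k by auto
      show ?thesis unfolding \<psi>(2) by (rule conic_decay_mult[OF X u V(1) \<psi>(1) V(3,4,2,5)])
    qed
    then obtain C where C: "\<And>k t \<kappa>. k \<in> T \<Longrightarrow> 0 \<le> t \<Longrightarrow> \<kappa> \<in> ball k (d k / 2) \<Longrightarrow>
        (1 + norm (t *\<^sub>R \<kappa>)) ^ N * cmod (fourier_cutoff u \<rho> (t *\<^sub>R \<kappa>)) \<le> C k" by metis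
    have "(1 + norm l) ^ N * cmod (modulated u \<rho> l) \<le> (\<Sum>k\<in>T. \<bar>C k\<bar>)" for l
    proof -
      \<comment> \<open>\<open>modulated\<close> at \<open>l\<close> is
        \<open>fourier_cutoff\<close> at \<open>- l\<close>, so the direction of \<open>- l\<close>
        is the one to be located in the cover; for \<open>l = 0\<close> any unit vector will
        do.\<close>
      obtain v :: "real^'n" where v: "v \<in> sphere 0 1" "- l = norm l *\<^sub>R v"
      proof (cases "l = 0")
        case True
        have "axis undefined 1 \<in> (sphere 0 1 :: (real^'n) set)" by simp
        then show ?thesis using True by (intro that[of "axis undefined 1"]) auto
      next
        case False
        then show ?thesis by (intro that[of "- (1 / norm l) *\<^sub>R l"]) auto
      qed
      then obtain k where k: "k \<in> T" "v \<in> ball k (d k / 2)" using T(3) by blast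
      have "(1 + norm l) ^ N * cmod (modulated u \<rho> l) \<le> C k"
        using C[OF k(1) norm_ge_zero[of l] k(2)] unfolding v(2)[symmetric] by (simp add: fourier_cutoff_eq)
      also have "\<dots> \<le> \<bar>C k\<bar>" by simp
      also have "\<dots> \<le> (\<Sum>k\<in>T. \<bar>C k\<bar>)" using T(2) k(1) by (intro member_le_sum) auto
      finally show ?thesis .
    qed
    then show "\<exists>C. \<forall>l. (1 + norm l) ^ N * cmod (modulated u \<rho> l) \<le> C" by blast
  qed
  then show ?thesis using \<rho> by blast
qed

text \<open>Testing against \<open>cnj h\<close> times a bump makes the integrand
  \<open>|h|^2 * \<eta>\<close>, which is continuous and nonnegative and hence zero. The product
  with the bump is an admissible test function although \<open>h\<close> is smooth on
  \<open>X\<close> only.\<close>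

lemma zero_if_integrals_zero:
  fixes h :: "real^'n::finite \<Rightarrow> complex"
  assumes X: "open X" and h: "smooth_on X h"
    and z: "\<And>\<psi>. \<psi> \<in> test_functions X \<Longrightarrow> (\<integral>x. h x * \<psi> x \<partial>lborel) = 0" and x: "x \<in> X"
  shows "h x = 0"
proof -
  obtain \<eta> :: "real^'n \<Rightarrow> real" and r where \<eta>: "0 < r"
    "(\<lambda>x. complex_of_real (\<eta> x)) \<in> test_functions X" "\<And>x. 0 \<le> \<eta> x" "\<And>y. y \<in> cball x r \<Longrightarrow> \<eta> y = 1"
    using test_cutoff_exists[OF X x] by metis
  let ?\<psi> = "\<lambda>x. cnj (h x) * complex_of_real (\<eta> x)"
  let ?f = "\<lambda>x. (cmod (h x))\<^sup>2 * \<eta> x"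
  have \<psi>: "?\<psi> \<in> test_functions X" by (intro test_functions_mult_left X smooth_on_cnj h \<eta>)
  have h\<psi>: "(\<lambda>x. h x * ?\<psi> x) \<in> test_functions X" by (intro test_functions_mult_left[OF X h \<psi>])
  have eq: "h x * ?\<psi> x = complex_of_real (?f x)" for x
    using complex_norm_square[of "h x"] by (simp add: mult.assoc[symmetric])
  have "complex_of_real (\<integral>x. ?f x \<partial>lborel) = 0"
    using z[OF \<psi>] unfolding eq integral_complex_of_real .
  then have "(\<integral>x. ?f x \<partial>lborel) = 0" by (simp only: of_real_eq_0_iff)
  moreover have "continuous_on UNIV ?f"
    using continuous_on_Re[OF test_functions_continuous[OF h\<psi>, of UNIV]] unfolding eq by simp
  moreover have "integrable lborel ?f"
    using integrable_Re[OF integrable_test_function[OF h\<psi>]] unfolding eq by simp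
  ultimately have "?f x = 0" using \<eta>(3) by (intro continuous_nonneg_integral_zero[where f = ?f]) auto
  then show ?thesis using \<eta>(1) \<eta>(4)[of x] by simp
qed

text \<open>\<open>f\<close> is a density of the product of \<open>u\<close> with
  \<open>\<rho>\<close>, so that \<open>u\<close> itself has density \<open>f / \<rho>\<close> where
  \<open>\<rho>\<close> is nonzero. Keeping the pair allows comparison and summation of local pieces
  without division.\<close>

definition has_density :: "(real^'n::finite) set \<Rightarrow> ((real^'n \<Rightarrow> complex) \<Rightarrow> complex) \<Rightarrow>
    (real^'n \<Rightarrow> complex) \<Rightarrow> (real^'n \<Rightarrow> complex) \<Rightarrow> bool" where
  "has_density X u \<rho> f \<longleftrightarrow> \<rho> \<in> test_functions X \<and> smooth_on X f \<and>
     (\<forall>\<psi>\<in>test_functions X. u (\<lambda>x. \<rho> x * \<psi> x) = (\<integral>x. f x * \<psi> x \<partial>lborel))"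

section \<open>Gluing the local densities\<close>

lemma smooth_density:
  fixes X :: "(real^'n::finite) set"
  assumes X: "open X" and u: "u \<in> distributions X" and wf: "wave_front_set X u = {}"
  shows "\<exists>f\<in>smooth_functions X. u = distribution_of X f"
proof -
  note mult = test_functions_mult[OF X]
  have int: "integrable lborel (\<lambda>x. f x * \<psi> x)" if "smooth_on X f" "\<psi> \<in> test_functions X" for f \<psi>
    by (rule integrable_test_function[OF test_functions_mult_left[OF X that]])
  have "\<exists>\<rho> f. has_density X u \<rho> f \<and> \<rho> x \<noteq> 0" if x: "x \<in> X" for x
  proof -
    obtain \<rho> where \<rho>: "\<rho> \<in> test_functions X" "\<rho> x \<noteq> 0" "rapid (modulated u \<rho>)"
      using rapid_modulated_local[OF X u wf x] by auto
    then show ?thesis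
      using smooth_representative[OF X u \<rho>(1,3)] smooth_on_subset[of UNIV _ X] unfolding has_density_def by blast
  qed
  then obtain \<rho> F where \<rho>F: "\<And>x. x \<in> X \<Longrightarrow> has_density X u (\<rho> x) (F x)" "\<And>x. x \<in> X \<Longrightarrow> \<rho> x x \<noteq> 0" by metis
  \<comment> \<open>Both sides are densities of \<open>u\<close> multiplied by
    \<open>\<sigma>\<close> and \<open>\<sigma>'\<close>; a smooth density is determined by its
    integrals against test functions.\<close>
  have consistent: "f x * \<sigma>' x = f' x * \<sigma> x"
    if g: "has_density X u \<sigma> f" "has_density X u \<sigma>' f'" and x: "x \<in> X" for \<sigma> f \<sigma>' f' x
  proof -
    have s: "smooth_on X f" "smooth_on X f'" and t: "\<sigma> \<in> test_functions X" "\<sigma>' \<in> test_functions X"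
      using g by (auto simp: has_density_def)
    have "f x * \<sigma>' x - f' x * \<sigma> x = 0"
    proof (rule zero_if_integrals_zero[OF X _ _ x, of "\<lambda>x. f x * \<sigma>' x - f' x * \<sigma> x"])
      show "smooth_on X (\<lambda>x. f x * \<sigma>' x - f' x * \<sigma> x)"
        by (intro smooth_on_diff smooth_on_mult X s test_functions_smooth[OF t(1)] test_functions_smooth[OF t(2)])
      fix \<psi> assume \<psi>: "\<psi> \<in> test_functions X"
      have "(\<integral>x. (f x * \<sigma>' x - f' x * \<sigma> x) * \<psi> x \<partial>lborel)
          = (\<integral>x. f x * (\<sigma>' x * \<psi> x) \<partial>lborel) - (\<integral>x. f' x * (\<sigma> x * \<psi> x) \<partial>lborel)"
        using int[OF s(1) mult[OF t(2) \<psi>]] int[OF s(2) mult[OF t(1) \<psi>]]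
        by (simp add: left_diff_distrib mult.assoc)
      also have "\<dots> = u (\<lambda>x. \<sigma> x * (\<sigma>' x * \<psi> x)) - u (\<lambda>x. \<sigma>' x * (\<sigma> x * \<psi> x))"
        using g mult[OF t(2) \<psi>] mult[OF t(1) \<psi>] by (simp add: has_density_def)
      also have "\<dots> = 0" by (simp add: mult.left_commute)
      finally show "(\<integral>x. (f x * \<sigma>' x - f' x * \<sigma> x) * \<psi> x \<partial>lborel) = 0" .
    qed
    then show ?thesis by simp
  qed
  \<comment> \<open>Each point uses the pair selected at that point. By consistency
    \<open>f * \<sigma> = G\<close> on \<open>X\<close> for every pair \<open>\<sigma>\<close>,
    \<open>G\<close>, which gives both the smoothness of \<open>f\<close> and the identity with
    \<open>u\<close>.\<close>
  define f where "f x = (if x \<in> X then F x x * inverse (\<rho> x x) else 0)" for x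
  have fF: "f x * \<sigma> x = G x" if "has_density X u \<sigma> G" "x \<in> X" for \<sigma> G x
    using consistent[OF \<rho>F(1)[OF that(2)] that(1) that(2)] \<rho>F(2)[OF that(2)] that(2)
    by (simp add: f_def field_simps)
  have "smooth_on X f"
  proof (rule smooth_on_local)
    fix x assume x: "x \<in> X"
    let ?U = "X \<inter> {y. \<rho> x y \<noteq> 0}"
    have g: "\<rho> x \<in> test_functions X" "smooth_on X (F x)" using \<rho>F(1)[OF x] by (auto simp: has_density_def)
    have U: "open ?U"
      using X test_functions_continuous[OF g(1), of UNIV] by (intro open_Int open_Collect_neq continuous_intros) auto
    have "smooth_on ?U (\<lambda>y. F x y * inverse (\<rho> x y))"
      by (intro smooth_on_mult smooth_on_inverse U test_functions_smooth[OF g(1)] smooth_on_subset[OF g(2)]) auto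
    moreover have "f y = F x y * inverse (\<rho> x y)" if "y \<in> ?U" for y
      using fF[OF \<rho>F(1)[OF x], of y] that by (auto simp: field_simps)
    ultimately have "smooth_on ?U f" using smooth_on_cong[OF U, of f "\<lambda>y. F x y * inverse (\<rho> x y)"] by simp
    then show "\<exists>V. x \<in> V \<and> smooth_on V f" using x \<rho>F(2)[OF x] by (intro exI[of _ ?U]) auto
  qed
  then have f: "f \<in> smooth_functions X" by (auto simp: smooth_functions_iff f_def)
  have "u \<phi> = distribution_of X f \<phi>" for \<phi>
  proof (cases "\<phi> \<in> test_functions X")
    case False
    then show ?thesis using u by (auto simp: distributions_def distribution_of_def)
  next
    case \<phi>: True
    define K where "K = supp \<phi>"
    have K: "compact K" "K \<subseteq> X" "\<And>x. x \<notin> K \<Longrightarrow> \<phi> x = 0"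
      using test_functions_supp[OF \<phi>] by (auto simp: K_def supp_outside)
    have cover: "K \<subseteq> (\<Union>x\<in>K. {y. \<rho> x y \<noteq> 0})" using \<rho>F(2) K(2) by auto
    have op: "open {y. \<rho> x y \<noteq> 0}" if "x \<in> K" for x
    proof -
      have "\<rho> x \<in> test_functions X" using \<rho>F(1) that K(2) by (auto simp: has_density_def)
      from test_functions_continuous[OF this, of UNIV] show ?thesis by (intro open_Collect_neq continuous_intros)
    qed
    from cover obtain T where T: "T \<subseteq> K" "finite T" "K \<subseteq> (\<Union>x\<in>T. {y. \<rho> x y \<noteq> 0})"
      by (rule compactE_image[OF K(1), rotated]) (use op in auto)
    \<comment> \<open>In place of a partition of unity: the sum of \<open>|\<rho> x|^2\<close> over
      a finite cover is positive on \<open>K\<close>, and linearity gives the product of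
      \<open>u\<close> with this sum the density \<open>G\<close>.\<close>
    define \<sigma> where "\<sigma> y = (\<Sum>x\<in>T. \<rho> x y * cnj (\<rho> x y))" for y
    define G where "G y = (\<Sum>x\<in>T. F x y * cnj (\<rho> x y))" for y
    have gT: "\<rho> x \<in> test_functions X" "smooth_on X (F x)" "has_density X u (\<rho> x) (F x)" if "x \<in> T" for x
      using \<rho>F(1)[of x] that T(1) K(2) by (auto simp: has_density_def)
    have density\<sigma>: "has_density X u \<sigma> G"
      unfolding has_density_def
    proof (intro conjI ballI)
      show "\<sigma> \<in> test_functions X"
        unfolding \<sigma>_def by (intro test_functions_sum mult test_functions_cnj gT)
      show "smooth_on X G"
        unfolding G_def by (intro smooth_on_sum smooth_on_mult X gT smooth_on_cnj test_functions_smooth[OF gT(1)])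
      fix \<psi> assume \<psi>: "\<psi> \<in> test_functions X"
      have t: "(\<lambda>y. cnj (\<rho> x y) * \<psi> y) \<in> test_functions X" if "x \<in> T" for x
        by (intro mult test_functions_cnj gT that \<psi>)
      have "u (\<lambda>y. \<sigma> y * \<psi> y) = u (\<lambda>y. \<Sum>x\<in>T. \<rho> x y * (cnj (\<rho> x y) * \<psi> y))"
        by (simp add: \<sigma>_def sum_distrib_right mult.assoc)
      also have "\<dots> = (\<Sum>x\<in>T. u (\<lambda>y. \<rho> x y * (cnj (\<rho> x y) * \<psi> y)))"
        by (intro distribution_sum[OF u] mult gT t)
      also have "\<dots> = (\<Sum>x\<in>T. \<integral>y. F x y * (cnj (\<rho> x y) * \<psi> y) \<partial>lborel)"
        using gT(3) t by (intro sum.cong refl) (simp add: has_density_def)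
      also have "\<dots> = (\<integral>y. (\<Sum>x\<in>T. F x y * (cnj (\<rho> x y) * \<psi> y)) \<partial>lborel)"
        by (intro Bochner_Integration.integral_sum[symmetric] int gT t)
      finally show "u (\<lambda>y. \<sigma> y * \<psi> y) = (\<integral>y. G y * \<psi> y \<partial>lborel)"
        by (simp add: G_def sum_distrib_right mult.assoc)
    qed
    then have \<sigma>: "\<sigma> \<in> test_functions X" by (simp add: has_density_def)
    have \<sigma>K: "\<sigma> y \<noteq> 0" if "y \<in> K" for y
    proof -
      obtain x where x: "x \<in> T" "\<rho> x y \<noteq> 0" using T(3) \<open>y \<in> K\<close> by auto
      have "0 < (\<Sum>x\<in>T. (cmod (\<rho> x y))\<^sup>2)"
        using T(2) x by (intro sum_pos2[of T x]) auto
      moreover have "\<sigma> y = complex_of_real (\<Sum>x\<in>T. (cmod (\<rho> x y))\<^sup>2)"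
        unfolding \<sigma>_def of_real_sum complex_norm_square ..
      ultimately show ?thesis by (simp only: of_real_eq_0_iff)
    qed
    \<comment> \<open>Off \<open>K\<close> the value is \<open>0\<close> because
      \<open>\<phi>\<close> vanishes there, whatever \<open>inverse (\<sigma> y)\<close> is; on
      \<open>K\<close> there is no zero of \<open>\<sigma>\<close>. Hence the quotient is again a
      test function.\<close>
    define \<psi> where "\<psi> y = \<phi> y * inverse (\<sigma> y)" for y
    have \<psi>: "\<psi> \<in> test_functions X"
    proof -
      let ?U = "{y. \<sigma> y \<noteq> 0}"
      have U: "open ?U"
        using test_functions_continuous[OF \<sigma>, of UNIV] by (intro open_Collect_neq continuous_intros)
      have "smooth_on ?U \<psi>"
        unfolding \<psi>_def by (intro smooth_on_mult smooth_on_inverse U test_functions_smooth[OF \<sigma>] test_functions_smooth[OF \<phi>]) auto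
      then have "smooth_on UNIV \<psi>"
        using \<sigma>K K(3) by (intro smooth_on_extend[of ?U \<psi> K] compact_imp_closed[OF K(1)]) (auto simp: \<psi>_def)
      then show ?thesis unfolding test_functions_iff using K by (auto simp: \<psi>_def)
    qed
    have \<phi>eq: "\<phi> y = \<sigma> y * \<psi> y" for y
      using \<sigma>K[of y] K(3)[of y] by (cases "y \<in> K") (auto simp: \<psi>_def)
    have "u \<phi> = u (\<lambda>y. \<sigma> y * \<psi> y)" using \<phi>eq by (metis ext)
    also have "\<dots> = (\<integral>y. G y * \<psi> y \<partial>lborel)" using density\<sigma> \<psi> by (simp add: has_density_def)
    also have "\<dots> = (\<integral>y. f y * \<phi> y \<partial>lborel)"
    proof (rule Bochner_Integration.integral_cong[OF refl])
      fix y
      show "G y * \<psi> y = f y * \<phi> y"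
      proof (cases "y \<in> X")
        case True
        show ?thesis unfolding fF[OF density\<sigma> True, symmetric] \<phi>eq[of y] by (rule mult.assoc)
      next
        case False
        then show ?thesis using K(2) K(3)[of y] by (auto simp: \<psi>_def)
      qed
    qed
    finally show ?thesis using distribution_of_eq[OF _ \<phi>, of f] by (simp add: f_def)
  qed
  then show ?thesis using f by blast
qed

section \<open>Bounded sets of test functions\<close>

text \<open>If no compact set carries all of \<open>B\<close>, an exhaustion \<open>K j\<close> of
  \<open>X\<close> yields members \<open>\<Phi> j\<close> of \<open>B\<close> that are nonzero at
  points \<open>x j\<close> outside \<open>K j\<close>. A weighted sum of the evaluations at these
  points is a continuous seminorm, yet it is unbounded on \<open>B\<close>.\<close>

lemma bounded_test_set_support:
  fixes X :: "(real^'n::finite) set"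
  assumes X: "open X" and B: "bounded_test_set X B"
  shows "\<exists>K. compact K \<and> K \<subseteq> X \<and> (\<forall>\<phi>\<in>B. \<forall>x. x \<notin> K \<longrightarrow> \<phi> x = 0)"
proof (rule ccontr)
  assume no: "\<not> ?thesis"
  obtain K :: "nat \<Rightarrow> (real^'n) set" where K: "\<And>j. compact (K j)" "\<And>j. K j \<subseteq> X"
    "\<And>L. compact L \<Longrightarrow> L \<subseteq> X \<Longrightarrow> \<exists>N. \<forall>j\<ge>N. L \<subseteq> K j"
    using open_Union_compact_subsets[OF X] by metis
  have "\<exists>\<phi> x. \<phi> \<in> B \<and> x \<notin> K j \<and> \<phi> x \<noteq> 0" for j using no K(1,2)[of j] by blast
  then obtain \<Phi> x where \<Phi>: "\<And>j. \<Phi> j \<in> B" "\<And>j. x j \<notin> K j" "\<And>j. \<Phi> j (x j) \<noteq> 0" by metis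
  \<comment> \<open>Normalised so that \<open>\<Phi> j\<close> contributes exactly \<open>j\<close>
    through its own point.\<close>
  define a where "a j = real j / cmod (\<Phi> j (x j))" for j
  have a: "0 \<le> a j" for j by (simp add: a_def)
  define p where "p \<phi> = (\<Sum>j. a j * cmod (\<phi> (x j)))" for \<phi>
  \<comment> \<open>Local finiteness: a compact \<open>L\<close> is eventually contained in
    \<open>K j\<close>, so only finitely many points matter for functions supported in
    \<open>L\<close>. This gives convergence of the series and its bound on \<open>L\<close> by
    order \<open>0\<close>.\<close>
  have fin: "\<exists>N. \<forall>\<phi>\<in>test_functions_in X L. \<forall>j\<ge>N. \<phi> (x j) = 0" if L: "compact L" "L \<subseteq> X" for L
  proof -
    obtain N where N: "\<And>j. N \<le> j \<Longrightarrow> L \<subseteq> K j" using K(3)[OF L] by blast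
    have "\<phi> (x j) = 0" if "\<phi> \<in> test_functions_in X L" "N \<le> j" for \<phi> j
      using that \<Phi>(2)[of j] N[of j] by (auto simp: test_functions_in_iff[OF L])
    then show ?thesis by blast
  qed
  have summ: "summable (\<lambda>j. a j * cmod (\<phi> (x j)))" if \<phi>: "\<phi> \<in> test_functions X" for \<phi>
  proof -
    obtain N where "\<forall>j\<ge>N. \<phi> (x j) = 0"
      using fin[OF test_functions_supp(1,2)[OF \<phi>]] test_functions_supp(3)[OF \<phi>] by blast
    then show ?thesis by (intro summable_finite[of "{..<N}"]) auto
  qed
  have "seminorm_on (test_functions X) p"
    unfolding seminorm_on_def p_def
  proof (intro conjI ballI allI)
    fix f g :: "real^'n \<Rightarrow> complex" and c assume f: "f \<in> test_functions X"
    show "0 \<le> (\<Sum>j. a j * cmod (f (x j)))" by (intro suminf_nonneg summ f mult_nonneg_nonneg a) auto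
    show "(\<Sum>j. a j * cmod (c * f (x j))) = cmod c * (\<Sum>j. a j * cmod (f (x j)))"
      unfolding suminf_mult[OF summ[OF f], symmetric] by (simp add: norm_mult mult_ac)
    assume g: "g \<in> test_functions X"
    have "(\<Sum>j. a j * cmod (f (x j) + g (x j))) \<le> (\<Sum>j. a j * cmod (f (x j)) + a j * cmod (g (x j)))"
      by (intro suminf_le summ[OF test_functions_add[OF f g]] summable_add summ f g)
        (auto simp: distrib_left[symmetric] intro!: mult_left_mono norm_triangle_ineq a)
    then show "(\<Sum>j. a j * cmod (f (x j) + g (x j)))
        \<le> (\<Sum>j. a j * cmod (f (x j))) + (\<Sum>j. a j * cmod (g (x j)))"
      using suminf_add[OF summ[OF f] summ[OF g]] by simp
  qed
  then have "test_seminorm X p"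
  proof (rule test_seminormI[OF X])
    fix L :: "(real^'n) set" assume L: "compact L" "L \<subseteq> X"
    obtain N where N: "\<forall>\<phi>\<in>test_functions_in X L. \<forall>j\<ge>N. \<phi> (x j) = 0" using fin[OF L] by blast
    have "p \<phi> \<le> (\<Sum>j<N. a j) * A" if \<phi>: "\<phi> \<in> test_functions_in X L" "0 \<le> A" "deriv_bound 0 L \<phi> A" for \<phi> A
    proof -
      have b: "cmod (\<phi> y) \<le> A" for y
        using \<phi> by (cases "y \<in> L") (auto simp: deriv_bound_def test_functions_in_iff[OF L])
      have "p \<phi> = (\<Sum>j<N. a j * cmod (\<phi> (x j)))"
        unfolding p_def using N \<phi>(1) by (intro suminf_finite) auto
      also have "\<dots> \<le> (\<Sum>j<N. a j * A)" by (intro sum_mono mult_left_mono b a)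
      finally show ?thesis by (simp add: sum_distrib_right)
    qed
    moreover have "0 \<le> (\<Sum>j<N. a j)" by (intro sum_nonneg a)
    ultimately show "bounded_on_compact X p L" unfolding bounded_on_compact_def using L by blast
  qed
  then obtain M where M: "\<And>\<phi>. \<phi> \<in> B \<Longrightarrow> norm (p \<phi>) \<le> M"
    using B unfolding bounded_test_set_def bounded_iff by (metis imageI)
  obtain j where j: "M < real j" using reals_Archimedean2 by blast
  have t: "\<Phi> j \<in> test_functions X" using \<Phi>(1) B by (auto simp: bounded_test_set_def)
  have "real j = a j * cmod (\<Phi> j (x j))" using \<Phi>(3)[of j] by (simp add: a_def)
  also have "\<dots> \<le> p (\<Phi> j)"
    unfolding p_def using sum_le_suminf[OF summ[OF t], of "{j}"] a by auto
  also have "\<dots> \<le> M" using M[OF \<Phi>(1)[of j]] by simp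
  finally show False using j by simp
qed

text \<open>The \<open>L^1\<close> norm is a continuous seminorm on test functions, so boundedness
  can be applied to it directly.\<close>

lemma bounded_test_set_L1:
  fixes X :: "(real^'n::finite) set"
  assumes X: "open X" and B: "bounded_test_set X B"
  shows "\<exists>M\<ge>0. \<forall>\<phi>\<in>B. (\<integral>x. cmod (\<phi> x) \<partial>lborel) \<le> M"
proof -
  let ?p = "\<lambda>\<phi>::real^'n \<Rightarrow> complex. \<integral>x. cmod (\<phi> x) \<partial>lborel"
  have "seminorm_on (test_functions X) ?p"
    unfolding seminorm_on_def
  proof (intro conjI ballI allI)
    fix f g :: "real^'n \<Rightarrow> complex" and c
    show "0 \<le> ?p f" by simp
    show "?p (\<lambda>x. c * f x) = cmod c * ?p f" by (simp add: norm_mult)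
    assume "f \<in> test_functions X" "g \<in> test_functions X"
    then have i: "integrable lborel f" "integrable lborel g" by (auto intro: integrable_test_function)
    then have "?p (\<lambda>x. f x + g x) \<le> (\<integral>x. cmod (f x) + cmod (g x) \<partial>lborel)"
      by (intro integral_mono) (auto intro: norm_triangle_ineq)
    then show "?p (\<lambda>x. f x + g x) \<le> ?p f + ?p g" using i by simp
  qed
  then have "test_seminorm X ?p"
  proof (rule test_seminormI[OF X])
    fix L :: "(real^'n) set" assume L: "compact L" "L \<subseteq> X"
    have "?p \<phi> \<le> measure lborel L * A" if \<phi>: "\<phi> \<in> test_functions_in X L" "0 \<le> A" "deriv_bound 0 L \<phi> A" for \<phi> A
    proof -
      have "cmod (\<integral>x. complex_of_real (cmod (\<phi> x)) \<partial>lborel) \<le> A * measure lborel L"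
        using \<phi> by (intro norm_integral_le_measure L) (auto simp: deriv_bound_def test_functions_in_iff[OF L])
      then show ?thesis unfolding integral_complex_of_real norm_of_real by (simp add: mult.commute)
    qed
    then show "bounded_on_compact X ?p L" unfolding bounded_on_compact_def using L measure_nonneg by blast
  qed
  then have "bounded (?p ` B)" using B by (simp add: bounded_test_set_def)
  then obtain M where M: "\<And>\<phi>. \<phi> \<in> B \<Longrightarrow> norm (?p \<phi>) \<le> M" unfolding bounded_iff by (metis imageI)
  then have "\<forall>\<phi>\<in>B. ?p \<phi> \<le> \<bar>M\<bar>" by force
  then show ?thesis by (intro exI[of _ "\<bar>M\<bar>"]) auto
qed

section \<open>Smooth functions as distributions\<close>

lemma distribution_of_smooth:
  assumes "f \<in> smooth_functions X" "\<phi> \<in> test_functions X"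
  shows "distribution_of X f \<phi> = (\<integral>x. f x * \<phi> x \<partial>lborel)"
  using assms by (intro distribution_of_eq) (auto simp: smooth_functions_iff)

lemma integrable_smooth_test:
  "open X \<Longrightarrow> f \<in> smooth_functions X \<Longrightarrow> \<phi> \<in> test_functions X \<Longrightarrow> integrable lborel (\<lambda>x. f x * \<phi> x)"
  by (intro integrable_test_function[OF test_functions_mult_left]) (auto simp: smooth_functions_iff)

lemma distribution_of_add:
  assumes "open X" "f \<in> smooth_functions X" "g \<in> smooth_functions X"
  shows "distribution_of X (\<lambda>x. f x + g x) = (\<lambda>\<phi>. distribution_of X f \<phi> + distribution_of X g \<phi>)"
proof
  fix \<phi>
  show "distribution_of X (\<lambda>x. f x + g x) \<phi> = distribution_of X f \<phi> + distribution_of X g \<phi>"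
  proof (cases "\<phi> \<in> test_functions X")
    case True
    then show ?thesis
      using integrable_smooth_test[OF assms(1,2) True] integrable_smooth_test[OF assms(1,3) True]
      by (simp add: distribution_of_smooth[OF _ True] smooth_functions_add assms distrib_right)
  qed (simp add: distribution_of_def)
qed

lemma distribution_of_cmult:
  assumes "open X" "f \<in> smooth_functions X"
  shows "distribution_of X (\<lambda>x. c * f x) = (\<lambda>\<phi>. c * distribution_of X f \<phi>)"
proof
  fix \<phi>
  show "distribution_of X (\<lambda>x. c * f x) \<phi> = c * distribution_of X f \<phi>"
  proof (cases "\<phi> \<in> test_functions X")
    case True
    then show ?thesis
      by (simp add: distribution_of_smooth[OF _ True] smooth_functions_cmult assms mult.assoc)
  qed (simp add: distribution_of_def)
qed

lemma distribution_of_diff: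
  assumes "open X" "f \<in> smooth_functions X" "g \<in> smooth_functions X"
  shows "distribution_of X (\<lambda>x. f x - g x) = (\<lambda>\<phi>. distribution_of X f \<phi> - distribution_of X g \<phi>)"
  using distribution_of_add[OF assms(1,2) smooth_functions_cmult[OF assms(1,3), of "-1"]]
    distribution_of_cmult[OF assms(1,3), of "-1"] by simp

lemma fourier_cutoff_distribution_of:
  assumes X: "open X" and f: "f \<in> smooth_functions X" and \<rho>: "\<rho> \<in> test_functions X"
  shows "fourier_cutoff (distribution_of X f) \<rho> k = FT (\<lambda>x. f x * \<rho> x) k"
  unfolding fourier_cutoff_eq modulated_def
  by (subst distribution_of_smooth[OF f test_functions_expi[OF \<rho>]]) (simp add: FT_def mult.assoc)

section \<open>Estimates for the embedding of smooth functions\<close>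

lemma strong_seminorm_distribution_of:
  fixes X :: "(real^'n::finite) set"
  assumes X: "open X" and B: "bounded_test_set X B"
  shows "\<exists>K C. compact K \<and> K \<subseteq> X \<and> (\<forall>h\<in>smooth_functions X.
    strong_seminorm B (distribution_of X h) \<le> ennreal C * smooth_seminorm 0 K h)"
proof -
  obtain K where K: "compact K" "K \<subseteq> X" "\<And>\<phi> x. \<phi> \<in> B \<Longrightarrow> x \<notin> K \<Longrightarrow> \<phi> x = 0"
    using bounded_test_set_support[OF X B] by blast
  obtain M where M: "0 \<le> M" "\<And>\<phi>. \<phi> \<in> B \<Longrightarrow> (\<integral>x. cmod (\<phi> x) \<partial>lborel) \<le> M"
    using bounded_test_set_L1[OF X B] by blast
  have "strong_seminorm B (distribution_of X h) \<le> ennreal M * smooth_seminorm 0 K h"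
    if h: "h \<in> smooth_functions X" for h
  proof -
    obtain A where A: "0 \<le> A" "smooth_seminorm 0 K h = ennreal A" "deriv_bound 0 K h A"
      using smooth_seminorm_finite[OF X K(1,2) h] by blast
    have "cmod (distribution_of X h \<phi>) \<le> M * A" if \<phi>: "\<phi> \<in> B" for \<phi>
    proof -
      have t: "\<phi> \<in> test_functions X" using B \<phi> by (auto simp: bounded_test_set_def)
      have "cmod (distribution_of X h \<phi>) \<le> (\<integral>x. cmod (h x * \<phi> x) \<partial>lborel)"
        unfolding distribution_of_smooth[OF h t] by simp
      also have "\<dots> \<le> (\<integral>x. A * cmod (\<phi> x) \<partial>lborel)"
      proof (intro integral_mono integrable_norm integrable_smooth_test[OF X h t] integrable_mult_right integrable_test_function[OF t])
        fix x
        show "cmod (h x * \<phi> x) \<le> A * cmod (\<phi> x)"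
        proof (cases "x \<in> K")
          case True
          then have "cmod (h x) \<le> A" using A(3) by (auto simp: deriv_bound_def)
          then show ?thesis by (simp add: norm_mult mult_right_mono)
        qed (simp add: K(3)[OF \<phi>])
      qed
      also have "\<dots> \<le> A * M" using M(2)[OF \<phi>] A(1) by (simp add: mult_left_mono)
      finally show ?thesis by (simp add: mult.commute)
    qed
    then have "strong_seminorm B (distribution_of X h) \<le> ennreal (M * A)"
      unfolding strong_seminorm_def by (intro SUP_least ennreal_leI)
    then show ?thesis using M(1) A(1,2) by (simp add: ennreal_mult)
  qed
  then show ?thesis using K by blast
qed

text \<open>The cutoff costs a Leibniz factor; then \<open>FT_decay\<close> bounds the weighted
  transform at every frequency, hence on \<open>V\<close>. The exponent \<open>N\<close> of the
  weight equals the number of derivatives spent.\<close>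

lemma conic_seminorm_distribution_of:
  fixes X :: "(real^'n::finite) set"
  assumes X: "open X" and \<rho>: "\<rho> \<in> test_functions X"
  shows "\<exists>K C. compact K \<and> K \<subseteq> X \<and> (\<forall>h\<in>smooth_functions X.
    conic_seminorm N V \<rho> (distribution_of X h) \<le> ennreal C * smooth_seminorm N K h)"
proof -
  obtain K where K: "compact K" "K \<subseteq> X" "smooth_on UNIV \<rho>" "\<And>x. x \<notin> K \<Longrightarrow> \<rho> x = 0"
    using test_functionsE[OF \<rho>] by metis
  obtain B where B: "0 \<le> B" "deriv_bound N K \<rho> B" using deriv_bound_exists[OF K(3,1)] by auto
  have "\<exists>C\<ge>0. \<forall>\<phi> A k. smooth_on UNIV \<phi> \<longrightarrow> (\<forall>x. x \<notin> K \<longrightarrow> \<phi> x = 0) \<longrightarrow> deriv_bound N K \<phi> A \<longrightarrow> 0 \<le> A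
    \<longrightarrow> (1 + norm k) ^ N * cmod (FT \<phi> k) \<le> C * A"
    by (rule FT_decay[OF K(1), where N = N]) blast
  then obtain C where C: "0 \<le> C" "\<And>\<phi> A k. smooth_on UNIV \<phi> \<Longrightarrow> \<forall>x. x \<notin> K \<longrightarrow> \<phi> x = 0 \<Longrightarrow> deriv_bound N K \<phi> A \<Longrightarrow> 0 \<le> A
    \<Longrightarrow> (1 + norm k) ^ N * cmod (FT \<phi> k) \<le> C * A"
    by blast
  have "conic_seminorm N V \<rho> (distribution_of X h) \<le> ennreal (C * (2 ^ N * B)) * smooth_seminorm N K h"
    if h: "h \<in> smooth_functions X" for h
  proof -
    obtain A where A: "0 \<le> A" "smooth_seminorm N K h = ennreal A" "deriv_bound N K h A"
      using smooth_seminorm_finite[OF X K(1,2) h] by blast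
    have sh: "smooth_on X h" using h by (simp add: smooth_functions_iff)
    have t: "(\<lambda>x. h x * \<rho> x) \<in> test_functions X" by (rule test_functions_mult_left[OF X sh \<rho>])
    have d: "deriv_bound N K (\<lambda>x. h x * \<rho> x) (2 ^ N * A * B)"
      by (rule deriv_bound_mult[OF X K(2) sh test_functions_smooth[OF \<rho>] A(3) B(2) A(1) B(1)])
    have "(1 + norm k) ^ N * cmod (FT (\<lambda>x. h x * \<rho> x) k) \<le> C * (2 ^ N * A * B)" for k
      by (rule C(2)[OF test_functions_smooth[OF t] _ d]) (use K(4) A(1) B(1) in auto)
    then have "conic_seminorm N V \<rho> (distribution_of X h) \<le> ennreal (C * (2 ^ N * A * B))"
      unfolding conic_seminorm_def fourier_cutoff_distribution_of[OF X h \<rho>]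
      by (intro SUP_least ennreal_leI)
    also have "\<dots> = ennreal (C * (2 ^ N * B)) * ennreal A"
      using A(1) B(1) C(1) by (simp add: mult_ac flip: ennreal_mult)
    finally show ?thesis unfolding A(2) .
  qed
  then show ?thesis using K(1,2) by blast
qed

lemma conic_seminorm_finite:
  assumes X: "open X" and \<rho>: "\<rho> \<in> test_functions X" and h: "h \<in> smooth_functions X"
  shows "conic_seminorm N V \<rho> (distribution_of X h) < \<infinity>"
proof -
  obtain K C where K: "compact K" "K \<subseteq> X"
    and C: "\<forall>h\<in>smooth_functions X. conic_seminorm N V \<rho> (distribution_of X h) \<le> ennreal C * smooth_seminorm N K h"
    using conic_seminorm_distribution_of[OF X \<rho>, of N V] by (elim exE conjE)
  obtain A where A: "smooth_seminorm N K h = ennreal A"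
    using smooth_seminorm_finite[OF X K h] by metis
  have "conic_seminorm N V \<rho> (distribution_of X h) \<le> ennreal C * ennreal A"
    using bspec[OF C h] unfolding A .
  also have "\<dots> < \<infinity>" by (simp add: ennreal_mult_less_top)
  finally show ?thesis .
qed

section \<open>Bijectivity of the embedding\<close>

lemma distribution_of_in_distributions:
  fixes X :: "(real^'n::finite) set"
  assumes X: "open X" and f: "f \<in> smooth_functions X"
  shows "distribution_of X f \<in> distributions X"
proof (rule distributionI[OF X])
  fix \<phi> \<psi> c assume \<phi>: "\<phi> \<in> test_functions X"
  show "distribution_of X f (\<lambda>x. c * \<phi> x) = c * distribution_of X f \<phi>"
    unfolding distribution_of_smooth[OF f \<phi>] distribution_of_smooth[OF f test_functions_cmult[OF \<phi>]]
    by (simp add: mult.left_commute)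
  assume \<psi>: "\<psi> \<in> test_functions X"
  show "distribution_of X f (\<lambda>x. \<phi> x + \<psi> x) = distribution_of X f \<phi> + distribution_of X f \<psi>"
    unfolding distribution_of_smooth[OF f \<phi>] distribution_of_smooth[OF f \<psi>]
      distribution_of_smooth[OF f test_functions_add[OF \<phi> \<psi>]]
    using integrable_smooth_test[OF X f \<phi>] integrable_smooth_test[OF X f \<psi>] by (simp add: distrib_left)
next
  show "distribution_of X f \<phi> = 0" if "\<phi> \<notin> test_functions X" for \<phi>
    using that by (simp add: distribution_of_def)
next
  fix K :: "(real^'n) set" assume K: "compact K" "K \<subseteq> X"
  obtain B where B: "0 \<le> B" "deriv_bound 0 K f B"
    using smooth_seminorm_finite[OF X K f] by blast
  have "cmod (distribution_of X f \<phi>) \<le> (B * measure lborel K) * A"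
    if \<phi>: "\<phi> \<in> test_functions_in X K" "0 \<le> A" "deriv_bound 0 K \<phi> A" for \<phi> A
  proof -
    have t: "\<phi> \<in> test_functions X" using \<phi>(1) test_functions_in_subset[OF K] by blast
    have "cmod (\<integral>x. f x * \<phi> x \<partial>lborel) \<le> (B * A) * measure lborel K"
    proof (rule norm_integral_le_measure[OF K(1)])
      show "f x * \<phi> x = 0" if "x \<notin> K" for x using \<phi>(1) that by (auto simp: test_functions_in_iff[OF K])
      show "cmod (f x * \<phi> x) \<le> B * A" if "x \<in> K" for x
        using B \<phi> that by (auto simp: norm_mult deriv_bound_def intro!: mult_mono)
    qed
    then show ?thesis by (simp add: distribution_of_smooth[OF f t] mult_ac)
  qed
  moreover have "0 \<le> B * measure lborel K" using B(1) by simp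
  ultimately show "bounded_on_compact X (\<lambda>\<phi>. cmod (distribution_of X f \<phi>)) K"
    unfolding bounded_on_compact_def using K by blast
qed

lemma wave_front_set_distribution_of:
  fixes X :: "(real^'n::finite) set"
  assumes X: "open X" and f: "f \<in> smooth_functions X"
  shows "wave_front_set X (distribution_of X f) = {}"
proof -
  have False if xk: "(x, k) \<in> wave_front_set X (distribution_of X f)" for x k
  proof -
    have x: "x \<in> X" using xk by (simp add: wave_front_set_def)
    obtain \<eta> :: "real^'n \<Rightarrow> real" and r where \<eta>: "0 < r"
      "(\<lambda>x. complex_of_real (\<eta> x)) \<in> test_functions X" "\<And>y. y \<in> cball x r \<Longrightarrow> \<eta> y = 1"
      using test_cutoff_exists[OF X x] by metis
    let ?\<rho> = "\<lambda>x. complex_of_real (\<eta> x)"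
    \<comment> \<open>The full space is taken as cone, since the cut off function has a transform
      that decays in every direction.\<close>
    have "conic_seminorm N UNIV ?\<rho> (distribution_of X f) < \<infinity>" for N
      by (rule conic_seminorm_finite[OF X \<eta>(2) f])
    moreover have "?\<rho> x \<noteq> 0" using \<eta>(1) \<eta>(3)[of x] by simp
    moreover have "closed (UNIV :: (real^'n) set)" "cone (UNIV :: (real^'n) set)" "k \<in> interior UNIV"
      by (auto simp: cone_def)
    ultimately have "\<exists>\<rho>\<in>test_functions X. \<exists>V. \<rho> x \<noteq> 0 \<and> closed V \<and> cone V \<and> k \<in> interior V \<and>
        (\<forall>N. conic_seminorm N V \<rho> (distribution_of X f) < \<infinity>)"
      using \<eta>(2) by (intro bexI[of _ ?\<rho>] exI[of _ UNIV]) auto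
    then show False
      using xk unfolding wave_front_set_def mem_Collect_eq prod.case by (elim conjE notE)
  qed
  then show ?thesis by auto
qed

lemma bij_betw_distribution_of:
  fixes X :: "(real^'n::finite) set"
  assumes X: "open X"
  shows "bij_betw (distribution_of X) (smooth_functions X) (distributions_wf X {})"
  unfolding bij_betw_def
proof
  show "inj_on (distribution_of X) (smooth_functions X)"
  proof (rule inj_onI, rule ext)
    fix f g x assume f: "f \<in> smooth_functions X" and g: "g \<in> smooth_functions X"
      and eq: "distribution_of X f = distribution_of X g"
    have d: "(\<lambda>x. f x - g x) \<in> smooth_functions X" by (rule smooth_functions_diff[OF X f g])
    have "(\<integral>x. (f x - g x) * \<phi> x \<partial>lborel) = 0" if "\<phi> \<in> test_functions X" for \<phi>
      using distribution_of_smooth[OF d that] by (simp add: distribution_of_diff[OF X f g] eq)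
    then have "f x - g x = 0" if "x \<in> X"
      using d that by (intro zero_if_integrals_zero[OF X, of "\<lambda>x. f x - g x"]) (auto simp: smooth_functions_iff)
    then show "f x = g x" using f g by (cases "x \<in> X") (auto simp: smooth_functions_iff)
  qed
  show "distribution_of X ` smooth_functions X = distributions_wf X {}"
  proof
    show "distribution_of X ` smooth_functions X \<subseteq> distributions_wf X {}"
      using distribution_of_in_distributions[OF X] wave_front_set_distribution_of[OF X]
      by (auto simp: distributions_wf_def)
    show "distributions_wf X {} \<subseteq> distribution_of X ` smooth_functions X"
    proof
      fix u assume "u \<in> distributions_wf X {}"
      then have "u \<in> distributions X" "wave_front_set X u = {}" by (auto simp: distributions_wf_def)
      from smooth_density[OF X this] show "u \<in> distribution_of X ` smooth_functions X" by blast
    qed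
  qed
qed

text \<open>Near each point of \<open>K\<close> the function agrees with its product with a cutoff, whose derivatives
  are recovered from its Fourier transform.\<close>

lemma smooth_seminorm_le_conic:
  fixes X :: "(real^'n::finite) set"
  assumes X: "open X" and K: "compact K" "K \<subseteq> X"
  shows "\<exists>Q C. finite Q \<and> Q \<subseteq> {conic_seminorm N UNIV \<rho> | N \<rho>. \<rho> \<in> test_functions X} \<and>
    (\<forall>h\<in>smooth_functions X. smooth_seminorm m K h \<le> ennreal C * (\<Sum>q\<in>Q. q (distribution_of X h)))"
proof -
  obtain c :: complex where c: "\<forall>(g :: real^'n \<Rightarrow> complex) X x. g \<in> test_functions X \<longrightarrow>
       g x = c * (\<integral>k. FT g k * expi k x \<partial>lborel)"
    using fourier_inversion by blast
  have "\<exists>\<rho> r. 0 < r \<and> \<rho> \<in> test_functions X \<and> (\<forall>y\<in>cball x r. \<rho> y = 1)" if x: "x \<in> K" for x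
  proof -
    obtain \<eta> :: "real^'n \<Rightarrow> real" and r where "0 < r"
      "(\<lambda>x. complex_of_real (\<eta> x)) \<in> test_functions X" "\<And>y. y \<in> cball x r \<Longrightarrow> \<eta> y = 1"
      using test_cutoff_exists[OF X subsetD[OF K(2) x]] by metis
    then show ?thesis by (intro exI[of _ "\<lambda>x. complex_of_real (\<eta> x)"] exI[of _ r]) auto
  qed
  then obtain \<rho> r where \<rho>: "\<And>x. x \<in> K \<Longrightarrow> 0 < r x" "\<And>x. x \<in> K \<Longrightarrow> \<rho> x \<in> test_functions X"
    "\<And>x y. x \<in> K \<Longrightarrow> y \<in> cball x (r x) \<Longrightarrow> \<rho> x y = 1" by metis
  have cover: "K \<subseteq> (\<Union>x\<in>K. ball x (r x))" using \<rho>(1) by force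
  obtain T where T: "T \<subseteq> K" "finite T" "K \<subseteq> (\<Union>x\<in>T. ball x (r x))"
    by (rule compactE_image[OF K(1) _ cover]) auto
  \<comment> \<open>Of the \<open>?N\<close> powers, \<open>m\<close> absorb the symbol of a
    derivative of order at most \<open>m\<close>, and the other \<open>?n\<close> provide an
    integrable weight.\<close>
  let ?n = "CARD('n) + 2" let ?N = "m + ?n"
  let ?q = "\<lambda>x. conic_seminorm ?N UNIV (\<rho> x)"
  let ?I = "integral\<^sup>L lborel (\<lambda>k::real^'n. inverse ((1 + norm k) ^ ?n))"
  have I: "0 \<le> ?I" by (intro integral_nonneg_AE) auto
  have "smooth_seminorm m K h \<le> ennreal (cmod c * ?I) * (\<Sum>q\<in>?q ` T. q (distribution_of X h))"
    if h: "h \<in> smooth_functions X" for h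
    unfolding smooth_seminorm_def
  proof (intro SUP_least)
    fix y and \<alpha> :: "'n list" assume y: "y \<in> K" and \<alpha>: "\<alpha> \<in> {\<alpha>. length \<alpha> \<le> m}"
    obtain x where x: "x \<in> T" "y \<in> ball x (r x)" using T(3) y by auto
    then have xK: "x \<in> K" using T(1) by blast
    let ?g = "\<lambda>z. h z * \<rho> x z"
    have t: "?g \<in> test_functions X"
      using h \<rho>(2)[OF xK] by (intro test_functions_mult_left[OF X]) (auto simp: smooth_functions_iff)
    have FTq: "fourier_cutoff (distribution_of X h) (\<rho> x) k = FT ?g k" for k
      by (rule fourier_cutoff_distribution_of[OF X h \<rho>(2)[OF xK]])
    have "?q x (distribution_of X h) < \<infinity>"
      by (rule conic_seminorm_finite[OF X \<rho>(2)[OF xK] h])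
    then obtain s where s: "0 \<le> s" "?q x (distribution_of X h) = ennreal s"
      by (cases "?q x (distribution_of X h)" rule: ennreal_cases) auto
    have b: "(1 + norm k) ^ ?N * cmod (FT ?g k) \<le> s" for k
    proof -
      have "ennreal ((1 + norm k) ^ ?N * cmod (FT ?g k)) \<le> ennreal s"
        unfolding s(2)[symmetric] conic_seminorm_def FTq by (rule SUP_upper) simp
      then show ?thesis using s(1) by simp
    qed
    have "partial_derivs \<alpha> h y = partial_derivs \<alpha> ?g y"
      using \<rho>(3)[OF xK] x(2) by (intro partial_derivs_cong[of "ball x (r x)"]) auto
    also have "\<dots> = c * (\<integral>k. moment \<alpha> k * FT ?g k * expi k y \<partial>lborel)"
      using c[rule_format, OF test_functions_partial_derivs[OF t], of \<alpha> y] unfolding FT_partial_derivs[OF t] .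
    finally have eq: "cmod (partial_derivs \<alpha> h y) = cmod c * cmod (\<integral>k. moment \<alpha> k * FT ?g k * expi k y \<partial>lborel)"
      by (simp add: norm_mult)
    have "cmod (\<integral>k. moment \<alpha> k * FT ?g k * expi k y \<partial>lborel) \<le> (\<integral>k. s * inverse ((1 + norm (k::real^'n)) ^ ?n) \<partial>lborel)"
    proof (rule order_trans[OF integral_norm_bound], rule integral_mono)
      have "integrable lborel (\<lambda>k. moment \<alpha> k * FT ?g k)"
        by (rule integrable_rapid[OF rapid_moment[OF rapid_FT[OF t]]])
      from integrable_norm[OF integrable_expi[OF this, of y]]
      show "integrable lborel (\<lambda>k. cmod (moment \<alpha> k * FT ?g k * expi k y))" by (simp add: expi_commute)
      show "integrable lborel (\<lambda>k::real^'n. s * inverse ((1 + norm k) ^ ?n))"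
        by (intro integrable_mult_right integrable_weight)
      fix k :: "real^'n"
      have p: "0 < (1 + norm k) ^ ?n" by (simp add: add_pos_nonneg)
      have "cmod (moment \<alpha> k) \<le> (1 + norm k) ^ m"
        using norm_moment_le[of \<alpha> k] power_increasing[of "length \<alpha>" m "1 + norm k"] \<alpha> by simp
      then have "cmod (moment \<alpha> k) * cmod (FT ?g k) * (1 + norm k) ^ ?n
          \<le> (1 + norm k) ^ m * cmod (FT ?g k) * (1 + norm k) ^ ?n"
        by (intro mult_right_mono) auto
      also have "\<dots> = (1 + norm k) ^ ?N * cmod (FT ?g k)" by (simp add: power_add mult_ac)
      also have "\<dots> \<le> s" by (rule b)
      finally have "cmod (moment \<alpha> k) * cmod (FT ?g k) \<le> s / (1 + norm k) ^ ?n"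
        using p by (simp only: pos_le_divide_eq)
      then show "cmod (moment \<alpha> k * FT ?g k * expi k y) \<le> s * inverse ((1 + norm k) ^ ?n)"
        by (simp only: norm_mult norm_expi mult_1_right divide_inverse)
    qed
    also have "(\<integral>k. s * inverse ((1 + norm (k::real^'n)) ^ ?n) \<partial>lborel) = s * ?I" by simp
    finally have "cmod (partial_derivs \<alpha> h y) \<le> cmod c * (s * ?I)"
      unfolding eq by (rule mult_left_mono) simp
    also have "\<dots> = (cmod c * ?I) * s" by (simp only: mult_ac)
    finally have "cmod (partial_derivs \<alpha> h y) \<le> (cmod c * ?I) * s" .
    then have "ennreal (cmod (partial_derivs \<alpha> h y)) \<le> ennreal (cmod c * ?I) * ?q x (distribution_of X h)"
      using I s by (simp add: ennreal_leI flip: ennreal_mult)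
    also have "\<dots> \<le> ennreal (cmod c * ?I) * (\<Sum>q\<in>?q ` T. q (distribution_of X h))"
      using x(1) T(2) by (intro mult_left_mono member_le_sum[of "?q x" "?q ` T" "\<lambda>q. q (distribution_of X h)"]) auto
    finally show "ennreal (cmod (partial_derivs \<alpha> h y)) \<le> \<dots>" .
  qed
  moreover have "finite (?q ` T)" "?q ` T \<subseteq> {conic_seminorm N UNIV \<rho> | N \<rho>. \<rho> \<in> test_functions X}"
    using T(1,2) \<rho>(2) by auto
  ultimately show ?thesis by blast
qed

text \<open>Covers both kinds of seminorm of the normal topology: the strong ones have weight
  \<open>1\<close>, the conic ones \<open>(1 + norm k)^N\<close>.\<close>

lemma SUP_norm_triangle:
  "(SUP k\<in>K. ennreal (w k * cmod (a k - c k)))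
    \<le> (SUP k\<in>K. ennreal (w k * cmod (a k - b k))) + (SUP k\<in>K. ennreal (w k * cmod (b k - c k)))"
  if w: "\<And>k. 0 \<le> w k"
proof (rule SUP_least)
  fix k assume k: "k \<in> K"
  have "cmod (a k - c k) \<le> cmod (a k - b k) + cmod (b k - c k)"
    using norm_triangle_ineq[of "a k - b k" "b k - c k"] by simp
  then have "w k * cmod (a k - c k) \<le> w k * cmod (a k - b k) + w k * cmod (b k - c k)"
    unfolding distrib_left[symmetric] using w by (rule mult_left_mono)
  then have "ennreal (w k * cmod (a k - c k)) \<le> ennreal (w k * cmod (a k - b k)) + ennreal (w k * cmod (b k - c k))"
    using w by (simp add: ennreal_leI flip: ennreal_plus)
  also have "\<dots> \<le> (SUP k\<in>K. ennreal (w k * cmod (a k - b k))) + (SUP k\<in>K. ennreal (w k * cmod (b k - c k)))"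
    by (intro add_mono SUP_upper k)
  finally show "ennreal (w k * cmod (a k - c k)) \<le> \<dots>" .
qed

theorem lemma7p2:
  fixes X :: "(real^'n::finite) set"
  assumes "open X"
  shows "(\<forall>f\<in>smooth_functions X. \<forall>g\<in>smooth_functions X.
            distribution_of X (\<lambda>x. f x + g x) =
              (\<lambda>\<phi>. distribution_of X f \<phi> + distribution_of X g \<phi>)) \<and>
         (\<forall>c. \<forall>f\<in>smooth_functions X.
            distribution_of X (\<lambda>x. c * f x) = (\<lambda>\<phi>. c * distribution_of X f \<phi>)) \<and>
         homeomorphic_map (smooth_topology X) (normal_topology X {}) (distribution_of X)"
proof (intro conjI ballI allI)
  let ?T = "distribution_of X" and ?S = "smooth_functions X" and ?D = "distributions_wf X {}"
  let ?P = "{smooth_seminorm m K | m K. compact K \<and> K \<subseteq> X}"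
  let ?P' = "{strong_seminorm B | B. bounded_test_set X B} \<union>
        {conic_seminorm N V \<rho> | N V \<rho>. \<rho> \<in> test_functions X \<and> closed V \<and> cone V \<and> (supp \<rho> \<times> V) \<inter> {} = {}}"
  let ?R = "inv_into ?S ?T"
  have bij: "bij_betw ?T ?S ?D" by (rule bij_betw_distribution_of[OF assms])
  have R: "?R u \<in> ?S" "?T (?R u) = u" if "u \<in> ?D" for u
    using that bij inv_into_into[of u ?T ?S] f_inv_into_f[of u ?T ?S] by (simp_all add: bij_betw_def)
  have "continuous_map (smooth_topology X) (normal_topology X {}) ?T"
    unfolding smooth_topology_def normal_topology_def
  proof (rule continuous_map_seminorm_topologies)
    show "?T f \<in> ?D" if "f \<in> ?S" for f using bij that by (auto simp: bij_betw_def)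
    show "p (\<lambda>x. 0) = 0" if "p \<in> ?P" for p using that by auto
    show "q (\<lambda>x. h x - f x) \<le> q (\<lambda>x. h x - g x) + q (\<lambda>x. g x - f x)" if "q \<in> ?P'" for q f g h
      using that
    proof
      assume "q \<in> {strong_seminorm B | B. bounded_test_set X B}"
      then show ?thesis
        using SUP_norm_triangle[of "\<lambda>_. 1" h f _ g] by (auto simp: strong_seminorm_def)
    next
      assume "q \<in> {conic_seminorm N V \<rho> | N V \<rho>. \<rho> \<in> test_functions X \<and> closed V \<and> cone V \<and> (supp \<rho> \<times> V) \<inter> {} = {}}"
      then obtain N V \<rho> where "q = conic_seminorm N V \<rho>" by blast
      then show ?thesis
        using SUP_norm_triangle[of "\<lambda>k. (1 + norm k) ^ N" "fourier_cutoff h \<rho>" "fourier_cutoff f \<rho>" V "fourier_cutoff g \<rho>"]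
        by (simp add: conic_seminorm_def fourier_cutoff_def)
    qed
    show "\<exists>Q C. finite Q \<and> Q \<subseteq> ?P \<and> (\<forall>f\<in>?S. \<forall>g\<in>?S.
        q (\<lambda>x. ?T g x - ?T f x) \<le> ennreal C * (\<Sum>p\<in>Q. p (\<lambda>x. g x - f x)))" if "q \<in> ?P'" for q
    proof -
      have "\<exists>m K C. compact K \<and> K \<subseteq> X \<and> (\<forall>h\<in>?S. q (?T h) \<le> ennreal C * smooth_seminorm m K h)"
        using that
      proof
        assume "q \<in> {strong_seminorm B | B. bounded_test_set X B}"
        then obtain B where B: "q = strong_seminorm B" "bounded_test_set X B" by blast
        show ?thesis unfolding B(1) by (rule exI, rule strong_seminorm_distribution_of[OF assms B(2)])
      next
        assume "q \<in> {conic_seminorm N V \<rho> | N V \<rho>. \<rho> \<in> test_functions X \<and> closed V \<and> cone V \<and> (supp \<rho> \<times> V) \<inter> {} = {}}"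
        then obtain N V \<rho> where q: "q = conic_seminorm N V \<rho>" "\<rho> \<in> test_functions X" by blast
        show ?thesis unfolding q(1) by (rule exI, rule conic_seminorm_distribution_of[OF assms q(2)])
      qed
      then obtain m K C where K: "compact K" "K \<subseteq> X"
        and C: "\<forall>h\<in>?S. q (?T h) \<le> ennreal C * smooth_seminorm m K h" by (elim exE conjE)
      have "q (\<lambda>x. ?T g x - ?T f x) \<le> ennreal C * (\<Sum>p\<in>{smooth_seminorm m K}. p (\<lambda>x. g x - f x))"
        if "f \<in> ?S" "g \<in> ?S" for f g
        using bspec[OF C smooth_functions_diff[OF assms that(2,1)]] by (simp add: distribution_of_diff[OF assms that(2,1)])
      then show ?thesis using K by (intro exI[of _ "{smooth_seminorm m K}"] exI[of _ C]) auto
    qed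
  qed
  moreover have "continuous_map (normal_topology X {}) (smooth_topology X) ?R"
    unfolding smooth_topology_def normal_topology_def
  proof (rule continuous_map_seminorm_topologies)
    show "?R u \<in> ?S" if "u \<in> ?D" for u by (rule R[OF that])
    show "p (\<lambda>x. 0) = 0" if "p \<in> ?P'" for p
      using that
    proof
      assume "p \<in> {strong_seminorm B | B. bounded_test_set X B}"
      then obtain B where "p = strong_seminorm B" by blast
      \<comment> \<open>The case distinction behind \<open>SUP_constant\<close> covers an empty
        \<open>B\<close>, where the supremum is the bottom element \<open>0\<close>.\<close>
      then show ?thesis by (simp add: strong_seminorm_def SUP_constant bot_ennreal)
    next
      assume "p \<in> {conic_seminorm N V \<rho> | N V \<rho>. \<rho> \<in> test_functions X \<and> closed V \<and> cone V \<and> (supp \<rho> \<times> V) \<inter> {} = {}}"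
      then obtain N V \<rho> where "p = conic_seminorm N V \<rho>" by blast
      then show ?thesis by (simp add: conic_seminorm_def fourier_cutoff_def SUP_constant bot_ennreal)
    qed
    show "q (\<lambda>x. h x - f x) \<le> q (\<lambda>x. h x - g x) + q (\<lambda>x. g x - f x)"
      if q: "q \<in> ?P" and fgh: "f \<in> ?S" "g \<in> ?S" "h \<in> ?S" for q f g h
    proof -
      obtain m K where K: "K \<subseteq> X" and eq: "q = smooth_seminorm m K"
        using q by (elim CollectE exE conjE)
      show ?thesis unfolding eq by (rule smooth_seminorm_triangle[OF assms K fgh])
    qed
    show "\<exists>Q C. finite Q \<and> Q \<subseteq> ?P' \<and> (\<forall>u\<in>?D. \<forall>v\<in>?D.
        q (\<lambda>x. ?R v x - ?R u x) \<le> ennreal C * (\<Sum>p\<in>Q. p (\<lambda>x. v x - u x)))" if q: "q \<in> ?P" for q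
    proof -
      obtain m K where K: "compact K" "K \<subseteq> X" and eq: "q = smooth_seminorm m K"
        using q by (elim CollectE exE conjE)
      obtain Q C where Q: "finite Q" "Q \<subseteq> {conic_seminorm N UNIV \<rho> | N \<rho>. \<rho> \<in> test_functions X}"
        and C: "\<forall>h\<in>?S. smooth_seminorm m K h \<le> ennreal C * (\<Sum>q\<in>Q. q (?T h))"
        using smooth_seminorm_le_conic[OF assms K, of m] by (elim exE conjE)
      have cU: "cone (UNIV :: (real^'n) set)" by (simp add: cone_def)
      \<comment> \<open>The full space is a closed cone, and with the empty set in place of
        \<open>\<Gamma>\<close> the disjointness condition holds for it.\<close>
      have "Q \<subseteq> ?P'"
      proof
        fix q assume "q \<in> Q"
        then obtain N \<rho> where "q = conic_seminorm N UNIV \<rho>" "\<rho> \<in> test_functions X" using Q(2) by auto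
        then show "q \<in> ?P'"
          using cU by (intro UnI2 CollectI exI[of _ N] exI[of _ UNIV] exI[of _ \<rho>]) simp
      qed
      \<comment> \<open>Linearity of the embedding gives \<open>?T (?R v - ?R u) = v - u\<close>, so
        the estimate for the single smooth function \<open>?R v - ?R u\<close> is the one for the
        inverse.\<close>
      moreover have "q (\<lambda>x. ?R v x - ?R u x) \<le> ennreal C * (\<Sum>p\<in>Q. p (\<lambda>x. v x - u x))"
        if u: "u \<in> ?D" and v: "v \<in> ?D" for u v
        using bspec[OF C smooth_functions_diff[OF assms R(1)[OF v] R(1)[OF u]]]
        unfolding distribution_of_diff[OF assms R(1)[OF v] R(1)[OF u]] R(2)[OF u] R(2)[OF v] eq .
      ultimately show ?thesis using Q(1) by (intro exI[of _ Q] exI[of _ C] conjI ballI)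
    qed
  qed
  ultimately have "homeomorphic_maps (smooth_topology X) (normal_topology X {}) ?T ?R"
    unfolding homeomorphic_maps_def using R(2) bij
    by (auto simp: smooth_topology_def normal_topology_def bij_betw_def inv_into_f_f)
  then show "homeomorphic_map (smooth_topology X) (normal_topology X {}) ?T"
    using homeomorphic_map_maps by blast
qed (use assms in \<open>auto intro: distribution_of_add distribution_of_cmult\<close>)



end
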